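(* Let $CB_{\mathcal{A}}$ be a cardinality bound (for degree constraints). If there exists a join enumeration algorithm $\mathcal{A}$ which is worst-case optimal relative to $CB_{\mathcal{A}}$, then there exists an algorithm $\mathcal{A}^*$ which is worst-case optimal relative to the extension of $CB_{\mathcal{A}}$ to partition constraints. That is, for every fixed full conjunctive query $Q$, $\mathcal{A}^*$ computes $Q^I$ in time $O(|I|+CB_{\mathcal{A}}(Q,\mathbf{PC}))$ for arbitrary sets $\mathbf{PC}$ of partition constraints and databases $I\vDash\mathbf{PC}$.
   Context: A (full) conjunctive query is $Q(\mathbf{Z})\leftarrow R_1(\mathbf{Z}_1)\Join\dots\Join R_k(\mathbf{Z}_k)$ with $\mathbf{Z}=\bigcup_i\mathbf{Z}_i$, where $R_i$ is a relation over the variables $\mathbf{Z}_i$. A database instance $I$ gives a concrete finite set of tuples for each $R_i$; $Q^I$ is the natural join of these. A join algorithm receives $Q$ and $I$ and outputs $Q^I$. $\pi,\sigma$ denote projection and selection. Degree constraint: for a relation $R(\mathbf{Z}')$ and $\mathbf{X}\subseteq\mathbf{Y}\subseteq\mathbf{Z}'$, $DC_R(\mathbf{X},\mathbf{Y},d)$ asserts $\max_{\mathbf{x}}|\pi_{\mathbf{Y}}\sigma_{\mathbf{X}=\mathbf{x}}R|\le d$ (maximum over all assignments $\mathbf{x}$ of values to $\mathbf{X}$); $DC_R(\mathbf{X},\mathbf{Y})$ is the least such $d$. Partition constraint: for $\mathbf{Y}\subseteq\mathbf{Z}'$ and $\mathcal{X}\subseteq 2^{\mathbf{Y}}$, $PC_R(\mathcal{X},\mathbf{Y},d)$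 asserts $\min_{(R^{\mathbf{X}})_{\mathbf{X}\in\mathcal{X}}}\max_{\mathbf{X}\in\mathcal{X}}DC_{R^{\mathbf{X}}}(\mathbf{X},\mathbf{Y})\le d$, the minimum being over all families of pairwise disjoint (possibly empty) subrelations with union $R$. $I\vDash\mathbf{DC}$ (resp. $I\vDash\mathbf{PC}$) means $I$ satisfies all constraints in the set. Cardinality bound: a function $CB(Q,\mathbf{DC})$ of a conjunctive query $Q$ and a set $\mathbf{DC}$ of degree constraints with $|Q^I|\le CB(Q,\mathbf{DC})$ for all $I\vDash\mathbf{DC}$. Its extension to $\mathbf{PC}=\{PC_{P_i}(\mathcal{X}_i,\mathbf{Y}_i,d_i)\mid i=1,\dots,l\}$ (each $P_i\in\{R_1,\dots,R_k\}$) is $$CB(Q,\mathbf{PC}):=\sum_{\mathbf{X}^1\in\mathcal{X}_1,\dots,\mathbf{X}^l\in\mathcal{X}_l}CB\big(Q,\{DC_{P_1}(\mathbf{X}^1,\mathbf{Y}_1,d_1),\dots,DC_{P_l}(\mathbf{X}^l,\mathbf{Y}_l,d_l)\}\big).$$ Worst-case optimality: $\mathcal{A}$ is worst-case optimal relative to $CB_{\mathcal{A}}$ if for every query $Q$ its running time on $(Q,I)$ is $O(|I|+CB_{\mathcal{A}}(Q,\mathbf{DC}))$ for all $\mathbf{DC}$ and all $I\vDash\mathbf{DC}$, where the hidden constant may depend only on $Q$ (not on the constraints or on $I$). Worst-case optimality relative to the extended bound is the same with $\mathbf{PC}$ in place of $\mathbf{DC}$. Standing assumptions: (i) every variable in the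 query is covered by at least one cardinality constraint (a constraint $DC_R(\emptyset,\mathbf{Z}',d)$ for a relation $R(\mathbf{Z}')$, identified with $PC_R(\{\emptyset\},\mathbf{Z}',d)$), so bounds are finite; (ii) for each query $Q$ and cardinality bound $CB$ there is a function $f_Q$ with $CB(Q,\alpha\cdot\mathbf{DC})\le f_Q(\alpha)\cdot CB(Q,\mathbf{DC})$ for all $\alpha\in\mathbb{R}^+$ and all $\mathbf{DC}$, where $\alpha\cdot\mathbf{DC}$ multiplies every bound $d$ in $\mathbf{DC}$ by $\alpha$; (iii) $\mathbf{PC}$ contains, for each relation $R$, at most one partition constraint per pair $(\mathcal{X},\mathbf{Y})$. *)

theory Defs
  imports
    Complex_Main
    "HOL-Library.Extended_Real"
    "HOL-Library.FuncSet"
    "HOL-Library.Disjoint_Sets"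
begin

section \<open>Queries and database instances\<close>

text \<open>
  Variables and data values are natural numbers. A tuple over a set \<open>Z\<close> of variables is a
  partial map with domain \<open>Z\<close>. The query \<open>R_0(Z_0) \<Join> ... \<Join> R_(k-1)(Z_(k-1))\<close> is the list
  \<open>[Z_0, ..., Z_(k-1)]\<close>: relation symbols are identified with positions in the list, so each
  atom has its own relation and different atoms may have the same variables.
\<close>

type_synonym tuple = "nat \<rightharpoonup> nat"
type_synonym relation = "tuple set"
type_synonym query = "nat set list"
type_synonym db = "nat \<Rightarrow> relation"

definition is_query :: "query \<Rightarrow> bool" where
  "is_query Q \<longleftrightarrow> Q \<noteq> [] \<and> (\<forall>Z\<in>set Q. finite Z)"

definition vars :: "query \<Rightarrow> nat set" where
  "vars Q = \<Union> (set Q)"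

text \<open>Only the values of \<open>I\<close> at positions of \<open>Q\<close> are relevant.\<close>

definition is_db :: "query \<Rightarrow> db \<Rightarrow> bool" where
  "is_db Q I \<longleftrightarrow> (\<forall>i<length Q. finite (I i) \<and> (\<forall>t\<in>I i. dom t = Q ! i))"

definition db_size :: "query \<Rightarrow> db \<Rightarrow> nat" where
  "db_size Q I = (\<Sum>i<length Q. card (I i))"

definition project :: "nat set \<Rightarrow> relation \<Rightarrow> relation" where
  "project Y R = (\<lambda>t. t |` Y) ` R"

definition select :: "nat set \<Rightarrow> tuple \<Rightarrow> relation \<Rightarrow> relation" where
  "select X x R = {t \<in> R. t |` X = x}"

definition join :: "query \<Rightarrow> db \<Rightarrow> relation" where
  "join Q I = {t. dom t = vars Q \<and> (\<forall>i<length Q. t |` (Q ! i) \<in> I i)}"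


section \<open>Degree constraints and partition constraints\<close>

definition degree :: "relation \<Rightarrow> nat set \<Rightarrow> nat set \<Rightarrow> enat" where
  "degree R X Y = (SUP x\<in>{x. dom x = X}. enat (card (project Y (select X x R))))"

definition partitions :: "relation \<Rightarrow> nat set set \<Rightarrow> (nat set \<Rightarrow> relation) set" where
  "partitions R F = {P. disjoint_family_on P F \<and> (\<Union>X\<in>F. P X) = R}"

text \<open>
  The infimum is attained unless \<open>partitions R F\<close> is empty, that is, unless \<open>F = {}\<close> and
  \<open>R \<noteq> {}\<close>; in that case the value is \<open>\<infinity>\<close> and no bound holds.
\<close>

definition partition_degree :: "relation \<Rightarrow> nat set set \<Rightarrow> nat set \<Rightarrow> enat" where
  "partition_degree R F Y = (INF P\<in>partitions R F. SUP X\<in>F. degree (P X) X Y)"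

text \<open>
  The first component is the position of the constrained relation. Bounds are real, since they
  are rescaled by arbitrary positive reals below.
\<close>

datatype degree_constraint = DC nat "nat set" "nat set" real
datatype partition_constraint = PC nat "nat set set" "nat set" real

fun wf_dc :: "query \<Rightarrow> degree_constraint \<Rightarrow> bool" where
  "wf_dc Q (DC i X Y d) \<longleftrightarrow> i < length Q \<and> X \<subseteq> Y \<and> Y \<subseteq> Q ! i \<and> 0 \<le> d"

fun wf_pc :: "query \<Rightarrow> partition_constraint \<Rightarrow> bool" where
  "wf_pc Q (PC i F Y d) \<longleftrightarrow> i < length Q \<and> F \<subseteq> Pow Y \<and> Y \<subseteq> Q ! i \<and> 0 \<le> d"

fun sat_dc :: "db \<Rightarrow> degree_constraint \<Rightarrow> bool" where
  "sat_dc I (DC i X Y d) \<longleftrightarrow> ereal_of_enat (degree (I i) X Y) \<le> ereal d"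

fun sat_pc :: "db \<Rightarrow> partition_constraint \<Rightarrow> bool" where
  "sat_pc I (PC i F Y d) \<longleftrightarrow> ereal_of_enat (partition_degree (I i) F Y) \<le> ereal d"

fun scale_dc :: "real \<Rightarrow> degree_constraint \<Rightarrow> degree_constraint" where
  "scale_dc \<alpha> (DC i X Y d) = DC i X Y (\<alpha> * d)"

text \<open>
  The sets of constraints under consideration: each variable is covered by a cardinality
  constraint, and there is at most one partition constraint for each relation and each pair
  \<open>(F, Y)\<close>. The latter makes sets of partition constraints finite.
\<close>

definition admissible_dcs :: "query \<Rightarrow> degree_constraint set \<Rightarrow> bool" where
  "admissible_dcs Q D \<longleftrightarrow> finite D \<and> (\<forall>\<delta>\<in>D. wf_dc Q \<delta>) \<and>
     (\<forall>z\<in>vars Q. \<exists>i<length Q. z \<in> Q ! i \<and> (\<exists>d. DC i {} (Q ! i) d \<in> D))"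

definition admissible_pcs :: "query \<Rightarrow> partition_constraint set \<Rightarrow> bool" where
  "admissible_pcs Q P \<longleftrightarrow> (\<forall>\<pi>\<in>P. wf_pc Q \<pi>) \<and>
     (\<forall>z\<in>vars Q. \<exists>i<length Q. z \<in> Q ! i \<and> (\<exists>d. PC i {{}} (Q ! i) d \<in> P)) \<and>
     (\<forall>i F Y d d'. PC i F Y d \<in> P \<and> PC i F Y d' \<in> P \<longrightarrow> d = d')"


section \<open>Cardinality bounds\<close>

type_synonym dc_bound = "query \<Rightarrow> degree_constraint set \<Rightarrow> real"
type_synonym pc_bound = "query \<Rightarrow> partition_constraint set \<Rightarrow> real"

definition cardinality_bound :: "dc_bound \<Rightarrow> bool" where
  "cardinality_bound CB \<longleftrightarrow>
     (\<forall>Q D I. is_query Q \<longrightarrow> admissible_dcs Q D \<longrightarrow> is_db Q I \<longrightarrow> (\<forall>\<delta>\<in>D. sat_dc I \<delta>) \<longrightarrow>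
        real (card (join Q I)) \<le> CB Q D)"

definition scalable :: "dc_bound \<Rightarrow> bool" where
  "scalable CB \<longleftrightarrow>
     (\<forall>Q. is_query Q \<longrightarrow> (\<exists>f :: real \<Rightarrow> real. \<forall>\<alpha>>0. \<forall>D. admissible_dcs Q D \<longrightarrow>
        CB Q (scale_dc \<alpha> ` D) \<le> f \<alpha> * CB Q D))"

fun pc_keys :: "partition_constraint \<Rightarrow> nat set set" where
  "pc_keys (PC i F Y d) = F"

fun dc_of_pc :: "partition_constraint \<Rightarrow> nat set \<Rightarrow> degree_constraint" where
  "dc_of_pc (PC i F Y d) X = DC i X Y d"

definition extend_bound :: "dc_bound \<Rightarrow> pc_bound" where
  "extend_bound CB Q P =
     (\<Sum>\<sigma> \<in> Pi\<^sub>E P pc_keys. CB Q ((\<lambda>\<pi>. dc_of_pc \<pi> (\<sigma> \<pi>)) ` P))"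


section \<open>Random access machine programs\<close>

text \<open>
  Algorithms are programs of a random access machine with uniform cost measure, in structured
  form. The machine has registers and unbounded arrays of natural numbers; a program mentions
  finitely many of them, so interleaving the arrays gives an ordinary machine with a single
  memory at the price of a constant factor. The arithmetic operations are addition and
  truncated subtraction; multiplication is left out because, on unbounded numbers and at unit
  cost, it makes the machine unreasonably powerful. A condition holds if its value is nonzero.
\<close>

datatype expr =
    Const nat
  | Reg string
  | Arr string expr
  | Add expr expr
  | Sub expr expr

datatype prog =
    Skip
  | Assign string expr
  | Store string expr expr
  | Seq prog prog
  | If expr prog prog
  | While expr prog

record state =
  reg :: "string \<Rightarrow> nat"
  arr :: "string \<Rightarrow> nat \<Rightarrow> nat"

fun val :: "expr \<Rightarrow> state \<Rightarrow> nat" where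
  "val (Const n) s = n"
| "val (Reg x) s = reg s x"
| "val (Arr a e) s = arr s a (val e s)"
| "val (Add e e') s = val e s + val e' s"
| "val (Sub e e') s = val e s - val e' s"

text \<open>
  \<open>exec p s t s'\<close>: started in state \<open>s\<close>, the program \<open>p\<close> halts in state \<open>s'\<close> after \<open>t\<close> steps.
  Evaluating an expression is charged as part of the step it occurs in: this takes a number of
  operations that is bounded by the text of the program.
\<close>

inductive exec :: "prog \<Rightarrow> state \<Rightarrow> nat \<Rightarrow> state \<Rightarrow> bool" where
  Skip: "exec Skip s 1 s"
| Assign: "exec (Assign x e) s 1 (s\<lparr>reg := (reg s)(x := val e s)\<rparr>)"
| Store: "exec (Store a e e') s 1
    (s\<lparr>arr := (arr s)(a := (arr s a)(val e s := val e' s))\<rparr>)"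
| Seq: "exec p s t s' \<Longrightarrow> exec q s' t' s'' \<Longrightarrow> exec (Seq p q) s (t + t') s''"
| If_true: "val b s \<noteq> 0 \<Longrightarrow> exec p s t s' \<Longrightarrow> exec (If b p q) s (t + 1) s'"
| If_false: "val b s = 0 \<Longrightarrow> exec q s t s' \<Longrightarrow> exec (If b p q) s (t + 1) s'"
| While_true: "val b s \<noteq> 0 \<Longrightarrow> exec p s t s' \<Longrightarrow> exec (While b p) s' t' s'' \<Longrightarrow>
    exec (While b p) s (t + t' + 1) s''"
| While_false: "val b s = 0 \<Longrightarrow> exec (While b p) s 1 s"


section \<open>Join algorithms and worst-case optimality\<close>

text \<open>
  A relation over \<open>Z\<close> is written to memory as the number of its tuples followed by the tuples,
  in any order but without repetition, with the columns in increasing order of the variables.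
\<close>

definition encode_tuple :: "nat set \<Rightarrow> tuple \<Rightarrow> nat list" where
  "encode_tuple Z t = map (\<lambda>z. the (t z)) (sorted_list_of_set Z)"

definition encode_relation :: "nat set \<Rightarrow> tuple list \<Rightarrow> nat list" where
  "encode_relation Z ts = length ts # concat (map (encode_tuple Z) ts)"

definition encode_query :: "query \<Rightarrow> nat list" where
  "encode_query Q = length Q # concat (map (\<lambda>Z. card Z # sorted_list_of_set Z) Q)"

definition encode_input :: "query \<Rightarrow> (nat \<Rightarrow> tuple list) \<Rightarrow> nat list" where
  "encode_input Q L =
     encode_query Q @ concat (map (\<lambda>i. encode_relation (Q ! i) (L i)) [0..<length Q])"

definition lists_relation :: "tuple list \<Rightarrow> relation \<Rightarrow> bool" where
  "lists_relation ts R \<longleftrightarrow> distinct ts \<and> set ts = R"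

definition lists_db :: "query \<Rightarrow> (nat \<Rightarrow> tuple list) \<Rightarrow> db \<Rightarrow> bool" where
  "lists_db Q L I \<longleftrightarrow> (\<forall>i<length Q. lists_relation (L i) (I i))"

definition input_state :: "nat list \<Rightarrow> state" where
  "input_state w =
     \<lparr>reg = (\<lambda>_. 0),
      arr = (\<lambda>a j. if a = ''in'' \<and> j < length w then w ! j else 0)\<rparr>"

definition has_output :: "state \<Rightarrow> nat list \<Rightarrow> bool" where
  "has_output s w \<longleftrightarrow> (\<forall>j<length w. arr s ''out'' j = w ! j)"

definition join_algorithm :: "prog \<Rightarrow> bool" where
  "join_algorithm A \<longleftrightarrow>
     (\<forall>Q I L. is_query Q \<longrightarrow> is_db Q I \<longrightarrow> lists_db Q L I \<longrightarrow>
        (\<exists>t s ts. exec A (input_state (encode_input Q L)) t s \<and>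
           lists_relation ts (join Q I) \<and> has_output s (encode_relation (vars Q) ts)))"

definition runs_within :: "prog \<Rightarrow> query \<Rightarrow> db \<Rightarrow> real \<Rightarrow> bool" where
  "runs_within A Q I b \<longleftrightarrow>
     (\<forall>L t s. lists_db Q L I \<longrightarrow> exec A (input_state (encode_input Q L)) t s \<longrightarrow> real t \<le> b)"

text \<open>
  The constant \<open>c\<close> depends on the query only. The summand \<open>1\<close> only matters if the database is
  empty and the bound is below 1: even then, the program takes at least one step.
\<close>

definition worst_case_optimal_dc :: "prog \<Rightarrow> dc_bound \<Rightarrow> bool" where
  "worst_case_optimal_dc A B \<longleftrightarrow> join_algorithm A \<and>
     (\<forall>Q. is_query Q \<longrightarrow> (\<exists>c. \<forall>D I. admissible_dcs Q D \<longrightarrow> is_db Q I \<longrightarrow>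
        (\<forall>\<delta>\<in>D. sat_dc I \<delta>) \<longrightarrow> runs_within A Q I (c * (real (db_size Q I) + B Q D + 1))))"

definition worst_case_optimal_pc :: "prog \<Rightarrow> pc_bound \<Rightarrow> bool" where
  "worst_case_optimal_pc A B \<longleftrightarrow> join_algorithm A \<and>
     (\<forall>Q. is_query Q \<longrightarrow> (\<exists>c. \<forall>P I. admissible_pcs Q P \<longrightarrow> is_db Q I \<longrightarrow>
        (\<forall>\<pi>\<in>P. sat_pc I \<pi>) \<longrightarrow> runs_within A Q I (c * (real (db_size Q I) + B Q P + 1))))"

end

theory Submission
  imports Defs
begin

text \<open>
  Each relation is split, for every \<open>Y\<close> and every set \<open>F\<close> of subsets of \<open>Y\<close>, in linear time and
  almost optimally. The tuples of the projection to \<open>Y\<close> are edges that are incident to the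
  vertices \<open>(X, x)\<close> where \<open>X \<in> F\<close> and \<open>x\<close> is the restriction of the tuple to \<open>X\<close>; a partition
  orients each edge towards one of at most \<open>m\<close> ends, and the best in-degree \<open>d\<close> is the partition
  degree. In each round, let the threshold be the median over the edges of the minimal degree of an
  end, and orient each edge with an end of degree at most the threshold towards an end of minimal
  degree. By double counting the threshold is at most \<open>2 * m * d\<close>; the number of edges is halved, and
  a vertex receives edges in one round only.

  The common refinement has a number of classes that depends on the query only. The given
  algorithm runs on each combination of one nonempty class for each atom. By scalability, each run is
  within the cardinality bound of some choice of one \<open>X\<close> for each partition constraint, that is,
  within one summand of the extended bound.
\<close>

section \<open>Execution with a step budget\<close>

text \<open>The program sees neither the constraints nor their bounds d, so one splitting must serve
  all of them. This is why the threshold is a median and not a multiple of d: halving is then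
  automatic, and the inequality with 2 * m * d holds for every feasible d at once. The set F is not
  known either: all pairs (Y, F) are tried, coded as numbers below a bound that depends on the query
  alone. The second obstacle is linear time on a machine without multiplication, sorting or hashing.
  Tuples get identifiers from a trie in zero-initialised memory, the median is read off a histogram
  of degrees, which are at most m times the number of edges, and arrays are cleared only where they
  were written, so that the cost does not depend on the size of the data values. Combinations with
  an empty class are skipped for a reason beyond economy: a constraint with F = {} holds for the
  empty relation and makes the extended bound an empty sum, against which no run could be
  charged.\<close>

lemma exec_Skip: "exec Skip s t s' \<longleftrightarrow> t = 1 \<and> s' = s"
  by (subst exec.simps) simp

lemma exec_Assign: "exec (Assign x e) s t s' \<longleftrightarrow> t = 1 \<and> s' = s\<lparr>reg := (reg s)(x := val e s)\<rparr>"
  by (subst exec.simps) simp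

lemma exec_Store: "exec (Store a e e') s t s' \<longleftrightarrow>
    t = 1 \<and> s' = s\<lparr>arr := (arr s)(a := (arr s a)(val e s := val e' s))\<rparr>"
  by (subst exec.simps) simp

lemma exec_Seq: "exec (Seq p q) s t s'' \<longleftrightarrow> (\<exists>t1 t2 s'. exec p s t1 s' \<and> exec q s' t2 s'' \<and> t = t1 + t2)"
  by (subst exec.simps) auto

lemma exec_If: "exec (If b p q) s t s' \<longleftrightarrow> (\<exists>u. t = u + 1 \<and> exec (if val b s \<noteq> 0 then p else q) s u s')"
  by (subst exec.simps) auto

lemma exec_While: "exec (While b p) s t s'' \<longleftrightarrow>
    (if val b s = 0 then t = 1 \<and> s'' = s
     else \<exists>t1 t2 s'. exec p s t1 s' \<and> exec (While b p) s' t2 s'' \<and> t = t1 + t2 + 1)"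
  by (subst exec.simps) auto

text \<open>Time bounds are demanded of every run, whereas the calculus below exhibits one run
  within its budget. Determinism identifies the two.\<close>

lemma exec_deterministic:
  assumes "exec p s t s'" "exec p s u s''"
  shows "t = u \<and> s' = s''"
  using assms
proof (induction arbitrary: u s'' rule: exec.induct)
  case Seq from Seq.prems show ?case unfolding exec_Seq by (auto dest!: Seq.IH)
next
  case (If_true b s p t s' q)
  from If_true.prems If_true.hyps(1) show ?case unfolding exec_If by (auto dest!: If_true.IH)
next
  case (If_false b s q t s' p)
  from If_false.prems If_false.hyps(1) show ?case unfolding exec_If by (auto dest!: If_false.IH)
next
  case (While_true b s p t s' t' r)
  from While_true.prems While_true.hyps(1) show ?case
    by (subst (asm) exec_While) (auto dest!: While_true.IH)
next
  case (While_false b s p)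
  then show ?case by (subst (asm) exec_While) auto
qed (auto simp: exec_Skip exec_Assign exec_Store)

text \<open>The budget is an integer, so that it can be decreased without truncation.\<close>

definition runs :: "prog \<Rightarrow> state \<Rightarrow> int \<Rightarrow> (state \<Rightarrow> bool) \<Rightarrow> bool" where
  "runs p s T P \<longleftrightarrow> (\<exists>t s'. exec p s t s' \<and> int t \<le> T \<and> P s')"

section \<open>Frames and a calculus of postconditions with budgets\<close>

notation Seq (infixr ";;" 60)

text \<open>Targets of assignments are collected by \<open>wr\<close>, targets of stores by
  \<open>wa\<close>. Since both are computed from the text, simplification decides whether a value
  survives a program.\<close>

fun wr :: "prog \<Rightarrow> string set" where
  "wr Skip = {}"
| "wr (Assign x e) = {x}"
| "wr (Store a e e') = {}"
| "wr (Seq p q) = wr p \<union> wr q"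
| "wr (If b p q) = wr p \<union> wr q"
| "wr (While b p) = wr p"

fun wa :: "prog \<Rightarrow> string set" where
  "wa Skip = {}"
| "wa (Assign x e) = {}"
| "wa (Store a e e') = {a}"
| "wa (Seq p q) = wa p \<union> wa q"
| "wa (If b p q) = wa p \<union> wa q"
| "wa (While b p) = wa p"

definition frame :: "prog \<Rightarrow> state \<Rightarrow> state \<Rightarrow> bool" where
  "frame p s s' \<longleftrightarrow> (\<forall>x. x \<notin> wr p \<longrightarrow> reg s' x = reg s x) \<and> (\<forall>a. a \<notin> wa p \<longrightarrow> arr s' a = arr s a)"

lemma frame_reg: "frame p s s' \<Longrightarrow> x \<notin> wr p \<Longrightarrow> reg s' x = reg s x"
  and frame_arr: "frame p s s' \<Longrightarrow> a \<notin> wa p \<Longrightarrow> arr s' a = arr s a"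
  by (auto simp: frame_def)

lemma frame_exec: "exec p s t s' \<Longrightarrow> frame p s s'"
  by (induction rule: exec.induct) (auto simp: frame_def)

text \<open>Every execution satisfies the frame, so the consequence rule can hand it over.
  Postconditions therefore record only what changes.\<close>

lemma runs_mono: "runs p s T P \<Longrightarrow> T \<le> T' \<Longrightarrow> (\<And>s'. P s' \<Longrightarrow> frame p s s' \<Longrightarrow> P' s') \<Longrightarrow> runs p s T' P'"
  unfolding runs_def by (meson frame_exec order_trans)

lemma runs_Seq_eq: "runs (p ;; q) s T P \<longleftrightarrow> (\<exists>t s'. exec p s t s' \<and> runs q s' (T - int t) P)"
proof
  assume "runs (p ;; q) s T P"
  then obtain t1 t2 s' s'' where "exec p s t1 s'" "exec q s' t2 s''" "int (t1 + t2) \<le> T" "P s''"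
    unfolding runs_def exec_Seq by blast
  moreover from this have "int t2 \<le> T - int t1" by simp
  ultimately show "\<exists>t s'. exec p s t s' \<and> runs q s' (T - int t) P" unfolding runs_def by blast
next
  assume "\<exists>t s'. exec p s t s' \<and> runs q s' (T - int t) P"
  then obtain t1 t2 s' s'' where *: "exec p s t1 s'" "exec q s' t2 s''" "int t2 \<le> T - int t1" "P s''"
    unfolding runs_def by blast
  from *(3) have "int (t1 + t2) \<le> T" by simp
  with * show "runs (p ;; q) s T P" unfolding runs_def exec_Seq by blast
qed

lemma runs_Skip [simp]: "runs Skip s T P \<longleftrightarrow> 1 \<le> T \<and> P s"
  unfolding runs_def exec_Skip by auto

lemma runs_Assign [simp]:
  "runs (Assign x e) s T P \<longleftrightarrow> 1 \<le> T \<and> P (s\<lparr>reg := (reg s)(x := val e s)\<rparr>)"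
  unfolding runs_def exec_Assign by auto

lemma runs_Store [simp]:
  "runs (Store a e e') s T P \<longleftrightarrow>
    1 \<le> T \<and> P (s\<lparr>arr := (arr s)(a := (arr s a)(val e s := val e' s))\<rparr>)"
  unfolding runs_def exec_Store by auto

lemma runs_If [simp]:
  "runs (If b p q) s T P \<longleftrightarrow> (if val b s \<noteq> 0 then runs p s (T - 1) P else runs q s (T - 1) P)"
proof -
  have "runs (If b p q) s T P \<longleftrightarrow> runs (if val b s \<noteq> 0 then p else q) s (T - 1) P"
  proof
    assume "runs (If b p q) s T P"
    then obtain u s' where "exec (if val b s \<noteq> 0 then p else q) s u s'" "int (u + 1) \<le> T" "P s'"
      unfolding runs_def exec_If by blast
    moreover from this have "int u \<le> T - 1" by simp
    ultimately show "runs (if val b s \<noteq> 0 then p else q) s (T - 1) P" unfolding runs_def by blast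
  next
    assume "runs (if val b s \<noteq> 0 then p else q) s (T - 1) P"
    then obtain u s' where *: "exec (if val b s \<noteq> 0 then p else q) s u s'" "int u \<le> T - 1" "P s'"
      unfolding runs_def by blast
    moreover from *(2) have "int (u + 1) \<le> T" by simp
    ultimately show "runs (If b p q) s T P" unfolding runs_def exec_If by blast
  qed
  then show ?thesis by simp
qed

text \<open>Sequences are kept nested to the right, so that the rules for a leading
  \<open>Assign\<close>, \<open>Store\<close> or \<open>If\<close> apply and straight-line code is
  executed by simplification.\<close>

lemma runs_Seq_assoc [simp]: "runs ((p ;; q) ;; r) s T P \<longleftrightarrow> runs (p ;; q ;; r) s T P"
proof -
  have "exec ((p ;; q) ;; r) s t s' \<longleftrightarrow> exec (p ;; q ;; r) s t s'" for t s'
    unfolding exec_Seq by (metis add.assoc)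
  then show ?thesis unfolding runs_def by simp
qed

lemma runs_Seq_Skip [simp]: "runs (Skip ;; q) s T P \<longleftrightarrow> runs q s (T - 1) P"
  unfolding runs_Seq_eq exec_Skip by simp

lemma runs_Seq_Assign [simp]:
  "runs (Assign x e ;; q) s T P \<longleftrightarrow> runs q (s\<lparr>reg := (reg s)(x := val e s)\<rparr>) (T - 1) P"
  unfolding runs_Seq_eq exec_Assign by auto

lemma runs_Seq_Store [simp]:
  "runs (Store a e e' ;; q) s T P \<longleftrightarrow>
    runs q (s\<lparr>arr := (arr s)(a := (arr s a)(val e s := val e' s))\<rparr>) (T - 1) P"
  unfolding runs_Seq_eq exec_Store by auto

lemma runs_Seq_If [simp]:
  "runs (If b p q ;; r) s T P \<longleftrightarrow>
    (if val b s \<noteq> 0 then runs (p ;; r) s (T - 1) P else runs (q ;; r) s (T - 1) P)"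
proof -
  have "T - int (u + 1) = T - 1 - int u" for u by simp
  then have "runs (If b p q ;; r) s T P \<longleftrightarrow> runs ((if val b s \<noteq> 0 then p else q) ;; r) s (T - 1) P"
    unfolding runs_Seq_eq exec_If by metis
  then show ?thesis by simp
qed

lemma runs_Seq:
  assumes "runs p s T' P'" "\<And>s'. P' s' \<Longrightarrow> frame p s s' \<Longrightarrow> runs q s' (T - T') P"
  shows "runs (p ;; q) s T P"
proof -
  obtain t s' where e: "exec p s t s'" "int t \<le> T'" "P' s'" using assms(1) by (auto simp: runs_def)
  then have "runs q s' (T - T') P" using assms(2) frame_exec by blast
  then have "runs q s' (T - int t) P" by (rule runs_mono) (use e(2) in auto)
  then show ?thesis using e(1) by (auto simp: runs_Seq_eq)
qed

lemma runs_While_0: "val b s = 0 \<Longrightarrow> 1 \<le> T \<Longrightarrow> P s \<Longrightarrow> runs (While b p) s T P"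
  unfolding runs_def by (subst exec_While) auto

lemma runs_While_step:
  assumes "val b s \<noteq> 0" "runs p s T' P'"
    "\<And>s'. P' s' \<Longrightarrow> frame p s s' \<Longrightarrow> runs (While b p) s' (T - T' - 1) P"
  shows "runs (While b p) s T P"
proof -
  obtain t s' where e: "exec p s t s'" "int t \<le> T'" "P' s'" using assms(2) by (auto simp: runs_def)
  obtain u s'' where f: "exec (While b p) s' u s''" "int u \<le> T - T' - 1" "P s''"
    using assms(3)[OF e(3) frame_exec[OF e(1)]] by (auto simp: runs_def)
  have "exec (While b p) s (t + u + 1) s''" using assms(1) e(1) f(1) by (intro exec.While_true)
  moreover have "int (t + u + 1) \<le> T" using e(2) f(2) by simp
  ultimately show ?thesis unfolding runs_def using f(3) by blast
qed

section \<open>Counting loops\<close>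

definition For :: "string \<Rightarrow> string \<Rightarrow> prog \<Rightarrow> prog" where
  "For x y p = Assign x (Const 0) ;;
    While (Sub (Reg y) (Reg x)) (p ;; Assign x (Add (Reg x) (Const 1)))"

lemma wr_For [simp]: "wr (For x y p) = insert x (wr p)"
  and wa_For [simp]: "wa (For x y p) = wa p"
  by (auto simp: For_def)

text \<open>An iteration pays two steps beyond its body, for the test and the increment; the initial
  assignment and the failing test account for the final \<open>+ 2\<close>. The invariant
  \<open>I (Suc i)\<close> is demanded of the state in which the counter has already been
  advanced.\<close>

lemma runs_For:
  assumes n: "reg s y = n" and xy: "x \<noteq> y" "x \<notin> wr p" "y \<notin> wr p"
    and init: "I 0 (s\<lparr>reg := (reg s)(x := 0)\<rparr>)"
    and step: "\<And>i s'. i < n \<Longrightarrow> reg s' x = i \<Longrightarrow> reg s' y = n \<Longrightarrow> frame (For x y p) s s' \<Longrightarrow> I i s' \<Longrightarrow>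
      runs p s' (c i) (\<lambda>s''. I (Suc i) (s''\<lparr>reg := (reg s'')(x := Suc i)\<rparr>))"
    and T: "(\<Sum>i<n. c i + 2) + 2 \<le> T"
  shows "runs (For x y p) s T (\<lambda>s'. I n s' \<and> reg s' x = n)"
proof -
  let ?W = "While (Sub (Reg y) (Reg x)) (p ;; Assign x (Add (Reg x) (Const 1)))"
  \<comment> \<open>The induction is on the number m of iterations that remain, which leaves the
    tail of the cost sum as budget.\<close>
  have *: "runs ?W s' ((\<Sum>i=n-m..<n. c i + 2) + 1) (\<lambda>s'. I n s' \<and> reg s' x = n)"
    if "m \<le> n" "reg s' x = n - m" "frame (For x y p) s s'" "I (n - m) s'" for m s'
    using that
  proof (induction m arbitrary: s')
    case 0
    have "reg s' y = n" using frame_reg[OF 0(3), of y] n xy by auto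
    then show ?case using 0 by (intro runs_While_0) auto
  next
    case (Suc m)
    have y: "reg s' y = n" using frame_reg[OF Suc.prems(3), of y] n xy by auto
    have split: "{n - Suc m..<n} = insert (n - Suc m) {n - m..<n}" using Suc.prems(1) by auto
    have S: "(\<Sum>i=n - Suc m..<n. c i + 2) = c (n - Suc m) + 2 + (\<Sum>i=n-m..<n. c i + 2)"
      unfolding split using Suc.prems(1) by (subst sum.insert) auto
    have Sn: "Suc (n - Suc m) = n - m" using Suc.prems(1) by auto
    show ?case
    proof (rule runs_While_step)
      show "val (Sub (Reg y) (Reg x)) s' \<noteq> 0" using y Suc.prems by auto
      show "runs (p ;; Assign x (Add (Reg x) (Const 1))) s' (c (n - Suc m) + 1)
          (\<lambda>s''. I (n - m) s'' \<and> reg s'' x = n - m)"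
      proof (rule runs_Seq[OF step])
        fix s'' assume a: "I (Suc (n - Suc m)) (s''\<lparr>reg := (reg s'')(x := Suc (n - Suc m))\<rparr>)" "frame p s' s''"
        have "reg s'' x = n - Suc m" using frame_reg[OF a(2)] xy Suc.prems by auto
        then show "runs (Assign x (Add (Reg x) (Const 1))) s'' (c (n - Suc m) + 1 - c (n - Suc m))
          (\<lambda>s''. I (n - m) s'' \<and> reg s'' x = n - m)" using a Sn by simp
      qed (use Suc.prems y in auto)
      fix s'' assume a: "I (n - m) s'' \<and> reg s'' x = n - m"
        "frame (p ;; Assign x (Add (Reg x) (Const 1))) s' s''"
      have "frame (For x y p) s s''" using a(2) Suc.prems(3) by (auto simp: frame_def)
      from Suc.IH[OF _ _ this] a Suc.prems S
      show "runs ?W s'' ((\<Sum>i=n - Suc m..<n. c i + 2) + 1 - (c (n - Suc m) + 1) - 1)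
         (\<lambda>s'. I n s' \<and> reg s' x = n)" by (simp add: algebra_simps)
    qed
  qed
  have "runs ?W (s\<lparr>reg := (reg s)(x := 0)\<rparr>) ((\<Sum>i=0..<n. c i + 2) + 1) (\<lambda>s'. I n s' \<and> reg s' x = n)"
    using *[of n "s\<lparr>reg := (reg s)(x := 0)\<rparr>"] init by (simp add: frame_def)
  then have "runs ?W (s\<lparr>reg := (reg s)(x := 0)\<rparr>) (T - 1) (\<lambda>s'. I n s' \<and> reg s' x = n)"
    using T by (elim runs_mono) (auto simp: atLeast0LessThan)
  then show ?thesis unfolding For_def by simp
qed

lemma runs_For_const:
  assumes n: "reg s y = n" and xy: "x \<noteq> y" "x \<notin> wr p" "y \<notin> wr p"
    and init: "I 0 (s\<lparr>reg := (reg s)(x := 0)\<rparr>)"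
    and step: "\<And>i s'. i < n \<Longrightarrow> reg s' x = i \<Longrightarrow> reg s' y = n \<Longrightarrow> frame (For x y p) s s' \<Longrightarrow> I i s' \<Longrightarrow>
      runs p s' c (\<lambda>s''. I (Suc i) (s''\<lparr>reg := (reg s'')(x := Suc i)\<rparr>))"
    and T: "int n * (c + 2) + 2 \<le> T"
    and post: "\<And>s'. reg s' x = n \<Longrightarrow> frame (For x y p) s s' \<Longrightarrow> I n s' \<Longrightarrow> P s'"
  shows "runs (For x y p) s T P"
  by (rule runs_mono[OF runs_For[OF n xy, where I = I and c = "\<lambda>_. c" and T = T] order_refl])
    (use init step T post in auto)

lemma runs_For_Seq:
  assumes "reg s y = n" "x \<noteq> y" "x \<notin> wr p" "y \<notin> wr p"
    and "I 0 (s\<lparr>reg := (reg s)(x := 0)\<rparr>)"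
    and "\<And>i s'. i < n \<Longrightarrow> reg s' x = i \<Longrightarrow> reg s' y = n \<Longrightarrow> frame (For x y p) s s' \<Longrightarrow> I i s' \<Longrightarrow>
      runs p s' c (\<lambda>s''. I (Suc i) (s''\<lparr>reg := (reg s'')(x := Suc i)\<rparr>))"
    and "\<And>s'. reg s' x = n \<Longrightarrow> frame (For x y p) s s' \<Longrightarrow> I n s' \<Longrightarrow>
      runs q s' (T - (int n * (c + 2) + 2)) P"
  shows "runs (For x y p ;; q) s T P"
  by (rule runs_Seq[OF runs_For_const[OF assms(1-6) order_refl, where P = "\<lambda>s'. I n s' \<and> reg s' x = n"]])
    (use assms(7) in auto)

section \<open>Peeling\<close>

text \<open>An edge is an address \<open>e\<close>. Its ends are \<open>V (e + 1), ..., V (e + m)\<close>, with multiplicity, and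
  \<open>V e\<close> is the identifier of its tuple, which indexes the labels.\<close>

definition incidences :: "(nat \<Rightarrow> nat) \<Rightarrow> nat \<Rightarrow> nat set \<Rightarrow> nat \<Rightarrow> nat" where
  "incidences V m A u = (\<Sum>e\<in>A. card {b\<in>{1..m}. V (e + b) = u})"

definition orientable :: "(nat \<Rightarrow> nat) \<Rightarrow> nat \<Rightarrow> nat set \<Rightarrow> nat \<Rightarrow> bool" where
  "orientable V m A d \<longleftrightarrow> (\<exists>f. (\<forall>e\<in>A. f e \<in> {1..m}) \<and> (\<forall>u. card {e\<in>A. V (e + f e) = u} \<le> d))"

lemma orientable_subset: "orientable V m A d \<Longrightarrow> finite A \<Longrightarrow> B \<subseteq> A \<Longrightarrow> orientable V m B d"
  unfolding orientable_def
proof (elim exE conjE)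
  fix f assume *: "finite A" "B \<subseteq> A" "\<forall>e\<in>A. f e \<in> {1..m}" "\<forall>u. card {e \<in> A. V (e + f e) = u} \<le> d"
  have "card {e \<in> B. V (e + f e) = u} \<le> card {e \<in> A. V (e + f e) = u}" for u
    using * by (intro card_mono) auto
  then show "\<exists>f. (\<forall>e\<in>B. f e \<in> {1..m}) \<and> (\<forall>u. card {e\<in>B. V (e + f e) = u} \<le> d)"
    using * by (intro exI[of _ f]) (meson order_trans subsetD)
qed

lemma sum_card_fibres_le:
  assumes "finite H" "finite B"
  shows "(\<Sum>u\<in>H. card {b\<in>B. g b = u}) \<le> card B"
proof -
  have "(\<Sum>u\<in>H. card {b\<in>B. g b = u}) = card (\<Union>u\<in>H. {b\<in>B. g b = u})"
    using assms by (subst card_UN_disjoint) auto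
  also have "\<dots> \<le> card B" using assms by (intro card_mono) auto
  finally show ?thesis .
qed

text \<open>Exchanging the sums lets each edge contribute its ends, at most m of them.\<close>

lemma sum_incidences_le:
  assumes "finite H" "finite A"
  shows "(\<Sum>u\<in>H. incidences V m A u) \<le> m * card A"
proof -
  have "(\<Sum>u\<in>H. incidences V m A u) = (\<Sum>e\<in>A. \<Sum>u\<in>H. card {b\<in>{1..m}. V (e + b) = u})"
    unfolding incidences_def by (rule sum.swap)
  also have "\<dots> \<le> (\<Sum>e\<in>A. m)"
    using sum_card_fibres_le[OF assms(1), of "{1..m}"] by (intro sum_mono) simp
  finally show ?thesis by (simp add: mult.commute)
qed

text \<open>More than half of the edges have an end of degree at most \<open>2 * m * d\<close>: the other edges are
  oriented towards fewer than \<open>card A / (2 * d)\<close> vertices of larger degree.\<close>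

lemma median_min_incidences_le:
  assumes A: "finite A" and d: "orientable V m A d" and m: "m \<ge> 1"
    and g: "\<And>e b. e \<in> A \<Longrightarrow> b \<in> {1..m} \<Longrightarrow> g e \<le> incidences V m A (V (e + b))"
    and T: "T > 0 \<Longrightarrow> 2 * card {e\<in>A. g e < T} < card A"
  shows "T \<le> 2 * m * d"
proof (rule ccontr)
  assume neg: "\<not> T \<le> 2 * m * d"
  define S where "S = 2 * m * d"
  obtain f where f: "\<forall>e\<in>A. f e \<in> {1..m}" "\<And>u. card {e\<in>A. V (e + f e) = u} \<le> d"
    using d unfolding orientable_def by auto
  \<comment> \<open>The edges of \<open>B\<close> have only ends of degree above \<open>S\<close>;
    \<open>H\<close> collects the vertices to which the orientation \<open>f\<close> sends
    them.\<close>
  define B where "B = {e\<in>A. g e > S}"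
  define H where "H = (\<lambda>e. V (e + f e)) ` B"
  have fin: "finite B" "finite H" using A by (auto simp: B_def H_def)
  have "card B \<le> d * card H"
  proof -
    have "B = (\<Union>u\<in>H. {e\<in>B. V (e + f e) = u})" by (auto simp: H_def)
    then have "card B = card (\<Union>u\<in>H. {e\<in>B. V (e + f e) = u})" by simp
    also have "\<dots> \<le> (\<Sum>u\<in>H. card {e\<in>B. V (e + f e) = u})" by (rule card_UN_le[OF fin(2)])
    also have "\<dots> \<le> (\<Sum>u\<in>H. d)"
    proof (rule sum_mono)
      fix u
      have "card {e\<in>B. V (e + f e) = u} \<le> card {e\<in>A. V (e + f e) = u}"
        using A by (intro card_mono) (auto simp: B_def)
      then show "card {e\<in>B. V (e + f e) = u} \<le> d" using f(2)[of u] by simp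
    qed
    finally show ?thesis by (simp add: mult.commute)
  qed
  \<comment> \<open>The vertices of \<open>H\<close> have degree at least \<open>S + 1\<close>, and
    all degrees together amount to at most m per edge.\<close>
  moreover have "(S + 1) * card H \<le> m * card A"
  proof -
    have "S + 1 \<le> incidences V m A u" if "u \<in> H" for u
    proof -
      obtain e where e: "e \<in> A" "g e > S" "u = V (e + f e)" using \<open>u \<in> H\<close> by (auto simp: H_def B_def)
      then show ?thesis using g[OF e(1), of "f e"] f(1) by auto
    qed
    then have "(\<Sum>u\<in>H. S + 1) \<le> (\<Sum>u\<in>H. incidences V m A u)" by (intro sum_mono)
    then show ?thesis using sum_incidences_le[OF fin(2) A, of V m] by (simp add: mult.commute)
  qed
  ultimately have "m * (2 * card B) + card H \<le> m * card A"
  proof -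
    assume *: "card B \<le> d * card H" "(S + 1) * card H \<le> m * card A"
    from *(1) have "2 * m * card B \<le> 2 * m * (d * card H)" by (rule mult_left_mono) simp
    then have "m * (2 * card B) + card H \<le> (S + 1) * card H" by (simp add: S_def algebra_simps)
    then show ?thesis using *(2) by linarith
  qed
  then have "m * (2 * card B) \<le> m * card A" by linarith
  then have half: "2 * card B \<le> card A" using m by simp
  have "card A = card B + card {e\<in>A. g e \<le> S}"
  proof -
    have "card (B \<union> {e\<in>A. g e \<le> S}) = card B + card {e\<in>A. g e \<le> S}"
      using A by (intro card_Un_disjoint) (auto simp: B_def)
    moreover have "A = B \<union> {e\<in>A. g e \<le> S}" by (auto simp: B_def)
    ultimately show ?thesis by simp
  qed
  \<comment> \<open>As \<open>T\<close> exceeds \<open>S\<close>, at least half of the edges lie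
    strictly below \<open>T\<close>, contrary to the choice of the median.\<close>
  moreover have "card {e\<in>A. g e \<le> S} \<le> card {e\<in>A. g e < T}"
    using A neg by (intro card_mono) (auto simp: S_def)
  ultimately show False using half T neg by linarith
qed

subsection \<open>Elimination of duplicate edges\<close>

text \<open>The array still holds labels of earlier masks. Only the cells of identifiers in use are
  reset, in time proportional to the number of rows.\<close>

definition clear_labels :: prog where
  "clear_labels = Assign ''e'' (Const 0) ;;
    For ''j'' ''n''
      (Store ''lab'' (Arr ''vt'' (Reg ''e'')) (Const 0) ;;
       Assign ''e'' (Add (Reg ''e'') (Reg ''m1'')))"

text \<open>Rows with the same projection to Y have the same identifier. Keeping one of them makes
  degrees count distinct projected tuples, as the degree of a relation does. The mark 1 in
  \<open>lab\<close> is provisional and is overwritten when the edge is oriented.\<close>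

definition collect_edges :: prog where
  "collect_edges = Assign ''e'' (Const 0) ;; Assign ''na'' (Const 0) ;;
    For ''j'' ''n''
      (If (Arr ''lab'' (Arr ''vt'' (Reg ''e''))) Skip
         (Store ''lab'' (Arr ''vt'' (Reg ''e'')) (Const 1) ;;
          Store ''act'' (Reg ''na'') (Reg ''e'') ;;
          Assign ''na'' (Add (Reg ''na'') (Const 1))) ;;
       Assign ''e'' (Add (Reg ''e'') (Reg ''m1'')))"

lemma mods_clear_labels [simp]: "wr clear_labels = {''e'', ''j''}" "wa clear_labels = {''lab''}"
  and mods_collect_edges [simp]:
    "wr collect_edges = {''e'', ''j'', ''na''}" "wa collect_edges = {''lab'', ''act''}"
  by (auto simp: clear_labels_def collect_edges_def)

lemma runs_clear_labels:
  assumes n: "reg s ''n'' = n" and m1: "reg s ''m1'' = m1" and V: "arr s ''vt'' = V"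
  shows "runs clear_labels s (int n * 4 + 3) (\<lambda>s'. \<forall>j<n. arr s' ''lab'' (V (j * m1)) = 0)"
  unfolding clear_labels_def runs_Seq_Assign
proof (rule runs_For_const[where n = n and c = 2 and
    I = "\<lambda>j s. reg s ''e'' = j * m1 \<and> (\<forall>j'<j. arr s ''lab'' (V (j' * m1)) = 0)"], goal_cases)
  case (6 i s')
  have "reg s' ''m1'' = m1" "arr s' ''vt'' = V"
    using frame_reg[OF 6(4)] frame_arr[OF 6(4)] m1 V by auto
  then show ?case using 6 by (auto simp: less_Suc_eq)
qed (use n in auto)

lemma inj_on_comp_upd:
  "inj_on (\<lambda>r. V (f r)) {..<n} \<Longrightarrow> V x \<notin> (\<lambda>r. V (f r)) ` {..<n::nat} \<Longrightarrow>
    inj_on (\<lambda>r. V ((f(n := x)) r)) {..<Suc n}"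
  by (auto simp: inj_on_def lessThan_Suc) (metis imageI lessThan_iff)+

lemma runs_collect_edges:
  assumes n: "reg s ''n'' = n" and m1: "reg s ''m1'' = m1" and V: "arr s ''vt'' = V"
    and lab: "\<forall>j<n. arr s ''lab'' (V (j * m1)) = 0"
  shows "runs collect_edges s (int n * 8 + 4) (\<lambda>s'.
    reg s' ''na'' \<le> n \<and> inj_on (\<lambda>r. V (arr s' ''act'' r)) {..<reg s' ''na''} \<and>
    arr s' ''act'' ` {..<reg s' ''na''} \<subseteq> (\<lambda>j. j * m1) ` {..<n} \<and>
    (\<lambda>r. V (arr s' ''act'' r)) ` {..<reg s' ''na''} = (\<lambda>j. V (j * m1)) ` {..<n})"
  unfolding collect_edges_def runs_Seq_Assign
proof (rule runs_For_const[where n = n and c = 6 and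
    I = "\<lambda>j s. reg s ''e'' = j * m1 \<and> (\<forall>j'<n. arr s ''lab'' (V (j' * m1)) \<noteq> 0 \<longleftrightarrow>
        V (j' * m1) \<in> (\<lambda>r. V (arr s ''act'' r)) ` {..<reg s ''na''}) \<and>
      reg s ''na'' \<le> j \<and> inj_on (\<lambda>r. V (arr s ''act'' r)) {..<reg s ''na''} \<and>
      arr s ''act'' ` {..<reg s ''na''} \<subseteq> (\<lambda>j. j * m1) ` {..<j} \<and>
      (\<lambda>r. V (arr s ''act'' r)) ` {..<reg s ''na''} = (\<lambda>j. V (j * m1)) ` {..<j}"], goal_cases)
  case (6 i s')
  have [simp]: "reg s' ''m1'' = m1" "arr s' ''vt'' = V"
    using frame_reg[OF 6(4)] frame_arr[OF 6(4)] m1 V by auto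
  show ?case
  proof (cases "arr s' ''lab'' (V (i * m1)) = 0")
    case True
    let ?a = "(arr s' ''act'')(reg s' ''na'' := i * m1)"
    have new: "V (i * m1) \<notin> (\<lambda>r. V (arr s' ''act'' r)) ` {..<reg s' ''na''}"
      using 6 True by auto
    have "(\<lambda>r. V (?a r)) ` {..<Suc (reg s' ''na'')}
      = insert (V (i * m1)) ((\<lambda>r. V (arr s' ''act'' r)) ` {..<reg s' ''na''})"
      "?a ` {..<Suc (reg s' ''na'')} = insert (i * m1) (arr s' ''act'' ` {..<reg s' ''na''})"
      by (auto simp: lessThan_Suc)
    moreover have "inj_on (\<lambda>r. V (?a r)) {..<Suc (reg s' ''na'')}"
      using 6(5) new by (intro inj_on_comp_upd) auto
    ultimately show ?thesis using 6 True by (auto simp: lessThan_Suc)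
  next
    case False
    then have "V (i * m1) \<in> (\<lambda>r. V (arr s' ''act'' r)) ` {..<reg s' ''na''}"
      using 6 by auto
    then show ?thesis using 6 False by (auto simp: lessThan_Suc insert_absorb)
  qed
qed (use n lab in auto)

subsection \<open>One round\<close>

text \<open>Degrees refer to the edges that are still active and are recomputed in each round. The
  counter \<open>b\<close> starts at 0, so end number \<open>b + 1\<close> is found at
  \<open>e + 1 + b\<close>.\<close>

definition clear_degrees :: prog where
  "clear_degrees = For ''r'' ''na'' (Assign ''e'' (Arr ''act'' (Reg ''r'')) ;;
     For ''b'' ''m'' (Store ''deg'' (Arr ''vt'' (Add (Add (Reg ''e'') (Const 1)) (Reg ''b''))) (Const 0)))"

definition count_degrees :: prog where
  "count_degrees = For ''r'' ''na'' (Assign ''e'' (Arr ''act'' (Reg ''r'')) ;;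
     For ''b'' ''m'' (Store ''deg'' (Arr ''vt'' (Add (Add (Reg ''e'') (Const 1)) (Reg ''b'')))
       (Add (Arr ''deg'' (Arr ''vt'' (Add (Add (Reg ''e'') (Const 1)) (Reg ''b'')))) (Const 1))))"

text \<open>All active edges receive a label before the threshold is known. Edges that are retained
  have it overwritten in a later round.\<close>

definition min_degrees :: prog where
  "min_degrees = For ''r'' ''na'' (Assign ''e'' (Arr ''act'' (Reg ''r'')) ;;
     Assign ''c'' (Const 1) ;; Assign ''g'' (Arr ''deg'' (Arr ''vt'' (Add (Reg ''e'') (Const 1)))) ;;
     For ''b'' ''m'' (If (Sub (Reg ''g'') (Arr ''deg'' (Arr ''vt'' (Add (Add (Reg ''e'') (Const 1)) (Reg ''b'')))))
       (Assign ''c'' (Add (Reg ''b'') (Const 1)) ;;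
        Assign ''g'' (Arr ''deg'' (Arr ''vt'' (Add (Add (Reg ''e'') (Const 1)) (Reg ''b'')))))
       Skip) ;;
     Store ''gg'' (Reg ''r'') (Reg ''g'') ;;
     Store ''lab'' (Arr ''vt'' (Reg ''e'')) (Reg ''c''))"

definition count_hist :: prog where
  "count_hist = For ''r'' ''na'' (Store ''hist'' (Arr ''gg'' (Reg ''r''))
     (Add (Arr ''hist'' (Arr ''gg'' (Reg ''r''))) (Const 1)))"

text \<open>Counting upwards through the histogram replaces sorting: the scan ends at the latest at
  the largest of the minimal degrees.\<close>

definition find_median :: prog where
  "find_median = Assign ''tt'' (Const 0) ;; Assign ''acc'' (Arr ''hist'' (Const 0)) ;;
     While (Sub (Reg ''na'') (Add (Reg ''acc'') (Reg ''acc'')))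
       (Assign ''tt'' (Add (Reg ''tt'') (Const 1)) ;;
        Assign ''acc'' (Add (Reg ''acc'') (Arr ''hist'' (Reg ''tt''))))"

text \<open>Undoing the increments one by one restores the zero array for the next round, at the
  cost of the edges and not of the degrees.\<close>

definition uncount_hist :: prog where
  "uncount_hist = For ''r'' ''na'' (Store ''hist'' (Arr ''gg'' (Reg ''r''))
     (Sub (Arr ''hist'' (Arr ''gg'' (Reg ''r''))) (Const 1)))"

definition retain_edges :: prog where
  "retain_edges = Assign ''r2'' (Const 0) ;;
     For ''r'' ''na'' (If (Sub (Arr ''gg'' (Reg ''r'')) (Reg ''tt''))
       (Store ''act'' (Reg ''r2'') (Arr ''act'' (Reg ''r'')) ;; Assign ''r2'' (Add (Reg ''r2'') (Const 1)))
       Skip) ;;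
     Assign ''na'' (Reg ''r2'')"

lemma mods_round [simp]:
  "wr clear_degrees = {''r'', ''e'', ''b''}" "wa clear_degrees = {''deg''}"
  "wr count_degrees = {''r'', ''e'', ''b''}" "wa count_degrees = {''deg''}"
  "wr min_degrees = {''r'', ''e'', ''b'', ''c'', ''g''}" "wa min_degrees = {''gg'', ''lab''}"
  "wr count_hist = {''r''}" "wa count_hist = {''hist''}"
  "wr find_median = {''tt'', ''acc''}" "wa find_median = {}"
  "wr uncount_hist = {''r''}" "wa uncount_hist = {''hist''}"
  "wr retain_edges = {''r2'', ''r'', ''na''}" "wa retain_edges = {''act''}"
  by (auto simp: clear_degrees_def count_degrees_def min_degrees_def count_hist_def find_median_def
      uncount_hist_def retain_edges_def)

lemma runs_clear_degrees:
  assumes "reg s ''na'' = N" "reg s ''m'' = m" "arr s ''vt'' = V" "arr s ''act'' = a"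
  shows "runs clear_degrees s (int N * (int m * 3 + 5) + 2)
    (\<lambda>s'. \<forall>r<N. \<forall>b\<in>{1..m}. arr s' ''deg'' (V (a r + b)) = 0)"
  unfolding clear_degrees_def
proof (rule runs_For_const[where n = N and c = "int m * 3 + 3" and
    I = "\<lambda>r s. \<forall>r'<r. \<forall>b\<in>{1..m}. arr s ''deg'' (V (a r' + b)) = 0"], goal_cases)
  case (6 r s1)
  have [simp]: "reg s1 ''m'' = m" "arr s1 ''vt'' = V" "arr s1 ''act'' = a"
    using frame_reg[OF 6(4)] frame_arr[OF 6(4)] assms by auto
  show ?case unfolding runs_Seq_Assign
  proof (rule runs_For_const[where n = m and c = 1 and
    I = "\<lambda>b s. (\<forall>r'<r. \<forall>b\<in>{1..m}. arr s ''deg'' (V (a r' + b)) = 0) \<and>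
      (\<forall>b'\<in>{1..b}. arr s ''deg'' (V (a r + b')) = 0)"], goal_cases)
    case (6 b s2)
    then show ?case using frame_reg[OF 6(4)] frame_arr[OF 6(4)] \<open>reg s1 ''r'' = r\<close>
      by (auto simp: atLeastAtMostSuc_conv)
  qed (use 6 in \<open>auto simp: less_Suc_eq\<close>)
qed (use assms in \<open>auto simp: algebra_simps\<close>)

lemma card_fibre_Suc:
  "card {b'\<in>{1..Suc b}. g b' = u} = card {b'\<in>{1..b}. g b' = u} + (if g (Suc b) = u then 1 else 0)"
proof -
  have "{b'\<in>{1..Suc b}. g b' = u} = (if g (Suc b) = u then insert (Suc b) {b'\<in>{1..b}. g b' = u}
      else {b'\<in>{1..b}. g b' = u})" by (auto simp: le_Suc_eq)
  then show ?thesis by auto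
qed

lemma runs_count_degrees:
  assumes "reg s ''na'' = N" "reg s ''m'' = m" "arr s ''vt'' = V" "arr s ''act'' = a"
  shows "runs count_degrees s (int N * (int m * 3 + 5) + 2)
    (\<lambda>s'. \<forall>u. arr s' ''deg'' u = arr s ''deg'' u + (\<Sum>r<N. card {b\<in>{1..m}. V (a r + b) = u}))"
  unfolding count_degrees_def
proof (rule runs_For_const[where n = N and c = "int m * 3 + 3" and
    I = "\<lambda>i s'. \<forall>u. arr s' ''deg'' u = arr s ''deg'' u + (\<Sum>r<i. card {b\<in>{1..m}. V (a r + b) = u})"],
    goal_cases)
  case (6 r s1)
  have [simp]: "reg s1 ''m'' = m" "arr s1 ''vt'' = V" "arr s1 ''act'' = a"
    using frame_reg[OF 6(4)] frame_arr[OF 6(4)] assms by auto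
  show ?case unfolding runs_Seq_Assign
  proof (rule runs_For_const[where n = m and c = 1 and
    I = "\<lambda>b s'. \<forall>u. arr s' ''deg'' u = arr s1 ''deg'' u + card {b'\<in>{1..b}. V (a r + b') = u}"], goal_cases)
    case (6 b s2)
    show ?case using 6 frame_reg[OF 6(4)] frame_arr[OF 6(4)] \<open>reg s1 ''r'' = r\<close>
      by (simp add: card_fibre_Suc[unfolded One_nat_def] del: atLeastAtMost_iff)
  qed (use 6 in auto)
qed (use assms in \<open>auto simp: algebra_simps\<close>)

text \<open>Distinct active edges carry distinct identifiers, so writing the label of one does not
  disturb the label of another.\<close>

lemma runs_min_degrees:
  assumes "reg s ''na'' = N" "reg s ''m'' = m" "arr s ''vt'' = V" "arr s ''act'' = a" "arr s ''deg'' = D"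
    and inj: "inj_on (\<lambda>r. V (a r)) {..<N}" and m: "m \<ge> 1"
  shows "runs min_degrees s (int N * (int m * 5 + 9) + 2)
    (\<lambda>s'. (\<forall>r<N. (\<forall>b\<in>{1..m}. arr s' ''gg'' r \<le> D (V (a r + b))) \<and>
        arr s' ''lab'' (V (a r)) \<in> {1..m} \<and> D (V (a r + arr s' ''lab'' (V (a r)))) = arr s' ''gg'' r) \<and>
      (\<forall>x. x \<notin> (\<lambda>r. V (a r)) ` {..<N} \<longrightarrow> arr s' ''lab'' x = arr s ''lab'' x))"
  unfolding min_degrees_def
proof (rule runs_For_const[where n = N and c = "int m * 5 + 7" and
    I = "\<lambda>i s'. (\<forall>r<i. (\<forall>b\<in>{1..m}. arr s' ''gg'' r \<le> D (V (a r + b))) \<and>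
        arr s' ''lab'' (V (a r)) \<in> {1..m} \<and> D (V (a r + arr s' ''lab'' (V (a r)))) = arr s' ''gg'' r) \<and>
      (\<forall>x. x \<notin> (\<lambda>r. V (a r)) ` {..<i} \<longrightarrow> arr s' ''lab'' x = arr s ''lab'' x)"],
    goal_cases)
  case (6 r s1)
  have [simp]: "reg s1 ''m'' = m" "arr s1 ''vt'' = V" "arr s1 ''act'' = a" "arr s1 ''deg'' = D"
    using frame_reg[OF 6(4)] frame_arr[OF 6(4)] assms by auto
  have r: "V (a r') \<noteq> V (a r)" if "r' < r" for r' using inj 6(1) that by (auto simp: inj_on_def)
  show ?case unfolding runs_Seq_Assign
  proof (rule runs_For_Seq[where n = m and c = 3 and
    I = "\<lambda>b s'. reg s' ''c'' \<in> {1..m} \<and> reg s' ''g'' = D (V (a r + reg s' ''c'')) \<and>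
      (\<forall>b'. 1 \<le> b' \<and> b' \<le> b \<longrightarrow> reg s' ''g'' \<le> D (V (a r + b')))"], goal_cases)
    case (6 b s2)
    have s2: "reg s2 ''e'' = a r" "arr s2 ''vt'' = V" "arr s2 ''deg'' = D"
      using frame_reg[OF 6(4)] frame_arr[OF 6(4)] \<open>reg s1 ''r'' = r\<close> by simp_all
    show ?case
    proof (cases "reg s2 ''g'' \<le> D (V (a r + Suc b))")
      case True
      then show ?thesis using s2 6(2,5) by (auto simp: le_Suc_eq)
    next
      case False
      then have "\<forall>b'. 1 \<le> b' \<and> b' \<le> b \<longrightarrow> D (V (a r + Suc b)) \<le> D (V (a r + b'))"
        using 6(5) by (meson le_trans linear)
      then show ?thesis using s2 6(1,2) False by (auto simp: le_Suc_eq)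
    qed
  next
    case (7 s2)
    have "reg s2 ''e'' = a r" "reg s2 ''r'' = r" "arr s2 = arr s1"
      using frame_reg[OF 7(2)] frame_arr[OF 7(2)] \<open>reg s1 ''r'' = r\<close> by auto
    moreover have "reg s2 ''c'' \<in> {1..m}" "reg s2 ''g'' = D (V (a r + reg s2 ''c''))"
      "\<forall>b\<in>{1..m}. reg s2 ''g'' \<le> D (V (a r + b))" using 7(3) by (simp, simp, force)
    moreover note I = 6(5)
    ultimately show ?case using r by (simp add: less_Suc_eq lessThan_Suc all_conj_distrib)
  next
    case 5 then show ?case using m \<open>reg s1 ''r'' = r\<close> by simp
  qed simp_all
qed (use assms in \<open>simp_all add: algebra_simps\<close>)

lemma card_below_Suc:
  "card {r. r < Suc i \<and> P r} = card {r. r < i \<and> P r} + (if P i then 1 else 0)"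
proof -
  have "{r. r < Suc i \<and> P r} = (if P i then insert i {r. r < i \<and> P r} else {r. r < i \<and> P r})"
    by (auto simp: less_Suc_eq)
  then show ?thesis by auto
qed

lemma runs_count_hist:
  assumes "reg s ''na'' = N" "arr s ''gg'' = G" "arr s ''hist'' = (\<lambda>_. 0)"
  shows "runs count_hist s (int N * 3 + 2) (\<lambda>s'. arr s' ''hist'' = (\<lambda>x. card {r. r < N \<and> G r = x}))"
  unfolding count_hist_def
proof (rule runs_For_const[where n = N and c = 1 and
    I = "\<lambda>i s'. arr s' ''hist'' = (\<lambda>x. card {r. r < i \<and> G r = x})"], goal_cases)
  case (6 r s1)
  then show ?case using frame_reg[OF 6(4)] frame_arr[OF 6(4)] assms
    by (auto simp: card_below_Suc)
qed (use assms in auto)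

text \<open>The invariant counts the positions whose decrement is still outstanding.\<close>

lemma runs_uncount_hist:
  assumes "reg s ''na'' = N" "arr s ''gg'' = G" "arr s ''hist'' = (\<lambda>x. card {r. r < N \<and> G r = x})"
  shows "runs uncount_hist s (int N * 3 + 2) (\<lambda>s'. arr s' ''hist'' = (\<lambda>_. 0))"
  unfolding uncount_hist_def
proof (rule runs_For_const[where n = N and c = 1 and
    I = "\<lambda>i s'. arr s' ''hist'' = (\<lambda>x. card {r. i \<le> r \<and> r < N \<and> G r = x})"], goal_cases)
  case (6 r s1)
  have "{r'. r \<le> r' \<and> r' < N \<and> G r' = x} = (if G r = x then insert r {r'. Suc r \<le> r' \<and> r' < N \<and> G r' = x}
      else {r'. Suc r \<le> r' \<and> r' < N \<and> G r' = x})" for x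
    using 6(1) by (auto simp: Suc_le_eq order_le_less)
  then have "card {r'. r \<le> r' \<and> r' < N \<and> G r' = x}
      = card {r'. Suc r \<le> r' \<and> r' < N \<and> G r' = x} + (if G r = x then 1 else 0)" for x
    by auto
  then show ?case using 6 frame_reg[OF 6(4)] frame_arr[OF 6(4)] assms
    by auto
qed (use assms in auto)

lemma card_le_Suc:
  "card {r. r < (N::nat) \<and> G r \<le> Suc t} = card {r. r < N \<and> G r \<le> t} + card {r. r < N \<and> G r = Suc t}"
proof -
  have "{r. r < N \<and> G r \<le> Suc t} = {r. r < N \<and> G r \<le> t} \<union> {r. r < N \<and> G r = Suc t}" by auto
  then show ?thesis by (simp add: card_Un_disjoint disjoint_iff)
qed

lemma runs_find_median:
  assumes "reg s ''na'' = N" "arr s ''hist'' = (\<lambda>x. card {r. r < N \<and> G r = x})"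
    and B: "\<And>r. r < N \<Longrightarrow> G r \<le> B"
  shows "runs find_median s (int B * 3 + 3) (\<lambda>s'.
    N \<le> 2 * card {r. r < N \<and> G r \<le> reg s' ''tt''} \<and>
    (0 < reg s' ''tt'' \<longrightarrow> 2 * card {r. r < N \<and> G r < reg s' ''tt''} < N))"
proof -
  let ?W = "While (Sub (Reg ''na'') (Add (Reg ''acc'') (Reg ''acc'')))
       (Assign ''tt'' (Add (Reg ''tt'') (Const 1)) ;;
        Assign ''acc'' (Add (Reg ''acc'') (Arr ''hist'' (Reg ''tt''))))"
  let ?P = "\<lambda>s'. N \<le> 2 * card {r. r < N \<and> G r \<le> reg s' ''tt''} \<and>
    (0 < reg s' ''tt'' \<longrightarrow> 2 * card {r. r < N \<and> G r < reg s' ''tt''} < N)"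
  have *: "runs ?W s' (int (B - reg s' ''tt'') * 3 + 1) ?P"
    if "reg s' ''na'' = N" "arr s' ''hist'' = (\<lambda>x. card {r. r < N \<and> G r = x})"
      "reg s' ''acc'' = card {r. r < N \<and> G r \<le> reg s' ''tt''}"
      "0 < reg s' ''tt'' \<longrightarrow> 2 * card {r. r < N \<and> G r < reg s' ''tt''} < N" for s'
    using that
  proof (induction "B - reg s' ''tt''" arbitrary: s' rule: less_induct)
    case less
    show ?case
    proof (cases "N \<le> 2 * reg s' ''acc''")
      case True
      then show ?thesis using less.prems by (intro runs_While_0) auto
    next
      case False
      \<comment> \<open>At a threshold of \<open>B\<close> every edge has been counted, so the loop
        would have stopped.\<close>
      have tB: "reg s' ''tt'' < B"
      proof (rule ccontr)
        assume "\<not> reg s' ''tt'' < B"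
        then have "{r. r < N \<and> G r \<le> reg s' ''tt''} = {..<N}" using B by force
        then show False using False less.prems by simp
      qed
      let ?s = "s'\<lparr>reg := (reg s')(''tt'' := Suc (reg s' ''tt''),
        ''acc'' := card {r. r < N \<and> G r \<le> Suc (reg s' ''tt'')})\<rparr>"
      show ?thesis
      proof (rule runs_While_step[where P' = "\<lambda>s. s = ?s" and T' = 2])
        show "val (Sub (Reg ''na'') (Add (Reg ''acc'') (Reg ''acc''))) s' \<noteq> 0"
          using False less.prems by simp
        show "runs (Assign ''tt'' (Add (Reg ''tt'') (Const 1)) ;;
          Assign ''acc'' (Add (Reg ''acc'') (Arr ''hist'' (Reg ''tt'')))) s' 2 (\<lambda>s. s = ?s)"
          using less.prems by (simp add: card_le_Suc)
        fix s1 assume "s1 = ?s"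
        moreover have "runs ?W ?s (int (B - reg ?s ''tt'') * 3 + 1) ?P"
          using tB less.prems False by (intro less.hyps) (auto simp: less_Suc_eq_le)
        ultimately show "runs ?W s1 (int (B - reg s' ''tt'') * 3 + 1 - 2 - 1) ?P"
          using tB by (simp add: of_nat_diff algebra_simps)
      qed
    qed
  qed
  have "runs ?W (s\<lparr>reg := (reg s)(''tt'' := 0, ''acc'' := card {r. r < N \<and> G r = 0})\<rparr>) (int B * 3 + 1) ?P"
    using *[of "s\<lparr>reg := (reg s)(''tt'' := 0, ''acc'' := card {r. r < N \<and> G r = 0})\<rparr>"] assms by simp
  then show ?thesis using assms unfolding find_median_def by (simp add: add.commute)
qed

text \<open>Compacting in place is safe because the write index \<open>r2\<close> never overtakes
  the read index: the cells from \<open>i\<close> on still hold their old values.\<close>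

lemma runs_retain_edges:
  assumes "reg s ''na'' = N" "arr s ''gg'' = G" "arr s ''act'' = a" "reg s ''tt'' = t" "inj_on a {..<N}"
  shows "runs retain_edges s (int N * 5 + 4) (\<lambda>s'.
    reg s' ''na'' = card {r. r < N \<and> t < G r} \<and> inj_on (arr s' ''act'') {..<reg s' ''na''} \<and>
    arr s' ''act'' ` {..<reg s' ''na''} = a ` {r. r < N \<and> t < G r})"
  unfolding retain_edges_def runs_Seq_Assign
proof (rule runs_For_Seq[where n = N and c = 3 and
    I = "\<lambda>i s'. reg s' ''r2'' = card {r. r < i \<and> t < G r} \<and> reg s' ''r2'' \<le> i \<and>
     inj_on (arr s' ''act'') {..<reg s' ''r2''} \<and> (\<forall>r. i \<le> r \<longrightarrow> arr s' ''act'' r = a r) \<and>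
    arr s' ''act'' ` {..<reg s' ''r2''} = a ` {r. r < i \<and> t < G r}"], goal_cases)
  case (6 i s1)
  have [simp]: "arr s1 ''gg'' = G" "reg s1 ''tt'' = t"
    using frame_reg[OF 6(4)] frame_arr[OF 6(4)] assms by auto
  show ?case
  proof (cases "t < G i")
    case True
    let ?a = "(arr s1 ''act'')(reg s1 ''r2'' := a i)"
    have im: "?a ` {..<Suc (reg s1 ''r2'')} = insert (a i) (arr s1 ''act'' ` {..<reg s1 ''r2''})"
      by (auto simp: lessThan_Suc)
    have set: "{r. r < Suc i \<and> t < G r} = insert i {r. r < i \<and> t < G r}" using True by (auto simp: less_Suc_eq)
    have "a r \<noteq> a i" if "r < i" for r using inj_onD[OF assms(5), of r i] 6(1) that by auto
    then have "a i \<notin> a ` {r. r < i \<and> t < G r}" by force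
    moreover have "arr s1 ''act'' ` {..<reg s1 ''r2''} = a ` {r. r < i \<and> t < G r}" using 6(5) by blast
    ultimately have "a i \<notin> arr s1 ''act'' ` {..<reg s1 ''r2''}" by (simp only: not_False_eq_True)
    then have "inj_on ?a {..<Suc (reg s1 ''r2'')}"
      using 6(5) by (intro inj_on_comp_upd[of "\<lambda>x. x"]) auto
    then show ?thesis using 6 True im set by (auto simp: card_below_Suc)
  next
    case False
    have set: "{r. r < Suc i \<and> t < G r} = {r. r < i \<and> t < G r}" using False by (auto simp: less_Suc_eq)
    then show ?thesis using 6 False by auto
  qed
qed (use assms in auto)

definition peel_round :: prog where
  "peel_round = clear_degrees ;; count_degrees ;; min_degrees ;; count_hist ;; find_median ;;
     uncount_hist ;; retain_edges"

lemma mods_peel_round [simp]: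
  "wr peel_round = {''r'', ''e'', ''b'', ''c'', ''g'', ''tt'', ''acc'', ''r2'', ''na''}"
  "wa peel_round = {''deg'', ''gg'', ''lab'', ''hist'', ''act''}"
  by (auto simp: peel_round_def)

lemma card_below_image:
  "inj_on a {..<N} \<Longrightarrow> card {r. r < (N::nat) \<and> P (a r)} = card {e\<in>a ` {..<N}. P e}"
proof -
  assume inj: "inj_on a {..<N}"
  have "{e\<in>a ` {..<N}. P e} = a ` {r. r < N \<and> P (a r)}" by auto
  moreover have "inj_on a {r. r < N \<and> P (a r)}" using inj by (rule inj_on_subset) auto
  ultimately show ?thesis by (simp add: card_image)
qed

text \<open>The minimal degree \<open>g\<close> of an edge is the degree of the end that its new
  label selects. The threshold \<open>t\<close> decides which edges stay active, and the last clause
  is the half of the median property from which \<open>median_min_incidences_le\<close> bounds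
  it.\<close>

definition round_result ::
  "(nat \<Rightarrow> nat) \<Rightarrow> nat \<Rightarrow> nat set \<Rightarrow> (nat \<Rightarrow> nat) \<Rightarrow> (nat \<Rightarrow> nat) \<Rightarrow> nat set \<Rightarrow> bool" where
  "round_result V m A lab lab' A' \<longleftrightarrow> (let g = \<lambda>e. incidences V m A (V (e + lab' (V e))) in
     (\<forall>x. x \<notin> V ` A \<longrightarrow> lab' x = lab x) \<and>
     (\<forall>e\<in>A. lab' (V e) \<in> {1..m} \<and> (\<forall>b\<in>{1..m}. g e \<le> incidences V m A (V (e + b)))) \<and>
     (\<exists>t. A' = {e\<in>A. t < g e} \<and> (0 < t \<longrightarrow> 2 * card {e\<in>A. g e < t} < card A)))"

lemma runs_peel_round:
  assumes na: "reg s ''na'' = N" and m: "reg s ''m'' = m" and V: "arr s ''vt'' = V"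
    and a: "arr s ''act'' = a" and hist: "arr s ''hist'' = (\<lambda>_. 0)"
    and inj: "inj_on (\<lambda>r. V (a r)) {..<N}" and m1: "m \<ge> 1"
  shows "runs peel_round s (int N * (int m * 14 + 30) + 17) (\<lambda>s'.
    2 * reg s' ''na'' \<le> N \<and> arr s' ''hist'' = (\<lambda>_. 0) \<and> inj_on (arr s' ''act'') {..<reg s' ''na''} \<and>
    round_result V m (a ` {..<N}) (arr s ''lab'') (arr s' ''lab'') (arr s' ''act'' ` {..<reg s' ''na''}))"
proof -
  define A where "A = a ` {..<N}"
  have inja: "inj_on a {..<N}" using inj by (auto simp: inj_on_def)
  have inc: "incidences V m A u = (\<Sum>r<N. card {b\<in>{1..m}. V (a r + b) = u})" for u
    unfolding incidences_def A_def using inja by (simp add: sum.reindex)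
  show ?thesis unfolding peel_round_def A_def[symmetric]
  proof (rule runs_Seq[OF runs_clear_degrees[OF na m V a]], goal_cases)
    case (1 s1)
    note P1 = 1(1) and f1 = frame_reg[OF 1(2)] frame_arr[OF 1(2)]
    have s1: "reg s1 ''na'' = N" "reg s1 ''m'' = m" "arr s1 ''vt'' = V" "arr s1 ''act'' = a"
      "arr s1 ''hist'' = (\<lambda>_. 0)" "arr s1 ''lab'' = arr s ''lab''"
      using f1 na m V a hist by simp_all
    show ?case
    proof (rule runs_Seq[OF runs_count_degrees[OF s1(1-4)]], goal_cases)
      case (1 s2)
      note P2 = 1(1) and f2 = frame_reg[OF 1(2)] frame_arr[OF 1(2)]
      have s2: "reg s2 ''na'' = N" "reg s2 ''m'' = m" "arr s2 ''vt'' = V" "arr s2 ''act'' = a"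
        "arr s2 ''hist'' = (\<lambda>_. 0)" "arr s2 ''lab'' = arr s ''lab''"
        using f2 s1 by simp_all
      have D: "arr s2 ''deg'' (V (a r + b)) = incidences V m A (V (a r + b))" if "r < N" "b \<in> {1..m}" for r b
        using P1 P2 that by (simp add: inc)
      show ?case
      proof (rule runs_Seq[OF runs_min_degrees[OF s2(1-4) refl inj m1]], goal_cases)
        case (1 s3)
        note P3 = 1(1) and f3 = frame_reg[OF 1(2)] frame_arr[OF 1(2)]
        have s3: "reg s3 ''na'' = N" "arr s3 ''act'' = a" "arr s3 ''hist'' = (\<lambda>_. 0)"
          using f3 s2 by simp_all
        let ?lab = "arr s3 ''lab''" and ?G = "arr s3 ''gg''"
        define g where "g = (\<lambda>e. incidences V m A (V (e + ?lab (V e))))"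
        have G: "?G r = g (a r)" if "r < N" for r
          using P3 that D[OF that, of "?lab (V (a r))"] unfolding g_def by metis
        have lab: "\<forall>e\<in>A. ?lab (V e) \<in> {1..m} \<and> (\<forall>b\<in>{1..m}. g e \<le> incidences V m A (V (e + b)))"
        proof
          fix e assume "e \<in> A"
          then obtain r where r: "r < N" "e = a r" by (auto simp: A_def)
          then show "?lab (V e) \<in> {1..m} \<and> (\<forall>b\<in>{1..m}. g e \<le> incidences V m A (V (e + b)))"
            using P3 D G by metis
        qed
        have lab': "\<forall>x. x \<notin> V ` A \<longrightarrow> ?lab x = arr s ''lab'' x"
          using P3 s2(6) by (auto simp: A_def image_image)
        \<comment> \<open>N edges with m ends each give degrees of at most \<open>m * N\<close>,
          which makes the scan for the median linear.\<close>
        have Gm: "?G r \<le> m * N" if "r < N" for r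
        proof -
          have "card {b\<in>{1..m}. V (a r + b) = u} \<le> card {1..m}" for u r by (intro card_mono) auto
          then have "(\<Sum>r<N. card {b\<in>{1..m}. V (a r + b) = u}) \<le> (\<Sum>r<N. card {1..m})" for u
            by (intro sum_mono) auto
          then show ?thesis using G[OF that] by (simp add: g_def inc mult.commute)
        qed
        show ?case
        proof (rule runs_Seq[OF runs_count_hist[OF s3(1) refl s3(3)]], goal_cases)
          case (1 s4)
          note P4 = 1(1) and f4 = frame_reg[OF 1(2)] frame_arr[OF 1(2)]
          have s4: "reg s4 ''na'' = N" "arr s4 ''act'' = a" "arr s4 ''gg'' = ?G" "arr s4 ''lab'' = ?lab"
            using f4 s3 by simp_all
          show ?case
          proof (rule runs_Seq[OF runs_find_median[OF s4(1) P4 Gm]], goal_cases)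
            case (2 s5)
            note P5 = 2(1) and f5 = frame_reg[OF 2(2)] frame_arr[OF 2(2)]
            have s5: "reg s5 ''na'' = N" "arr s5 ''act'' = a" "arr s5 ''gg'' = ?G" "arr s5 ''lab'' = ?lab"
              "arr s5 ''hist'' = (\<lambda>x. card {r. r < N \<and> ?G r = x})"
              using f5 s4 P4 by simp_all
            define t where "t = reg s5 ''tt''"
            show ?case
            proof (rule runs_Seq[OF runs_uncount_hist[OF s5(1,3,5)]], goal_cases)
              case (1 s6)
              note P6 = 1(1) and f6 = frame_reg[OF 1(2)] frame_arr[OF 1(2)]
              have s6: "reg s6 ''na'' = N" "arr s6 ''gg'' = ?G" "arr s6 ''act'' = a" "reg s6 ''tt'' = t"
                "arr s6 ''lab'' = ?lab"
                using f6 s5 by (simp_all add: t_def)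
              show ?case
              proof (rule runs_mono[OF runs_retain_edges[OF s6(1-4) inja]], goal_cases)
                case 1 show ?case by (simp add: algebra_simps)
              next
                case (2 s7)
                note P7 = 2(1) and f7 = frame_reg[OF 2(2)] frame_arr[OF 2(2)]
                have eqs: "{r. r < N \<and> t < ?G r} = {r. r < N \<and> t < g (a r)}"
                  "{r. r < N \<and> ?G r \<le> t} = {r. r < N \<and> g (a r) \<le> t}"
                  "{r. r < N \<and> ?G r < t} = {r. r < N \<and> g (a r) < t}" using G by auto
                have na': "reg s7 ''na'' = card {r. r < N \<and> t < g (a r)}"
                  using P7 eqs by simp
                have "card {r. r < N \<and> t < g (a r)} + card {r. r < N \<and> g (a r) \<le> t}
                    = card ({r. r < N \<and> t < g (a r)} \<union> {r. r < N \<and> g (a r) \<le> t})"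
                  by (subst card_Un_disjoint) auto
                also have "{r. r < N \<and> t < g (a r)} \<union> {r. r < N \<and> g (a r) \<le> t} = {..<N}" by auto
                finally have half: "2 * reg s7 ''na'' \<le> N"
                  using P5 eqs na' by (simp add: t_def)
                have fr: "arr s7 ''hist'' = (\<lambda>_. 0)" "arr s7 ''lab'' = ?lab"
                  using f7 P6 s6 by simp_all
                have c: "card {e \<in> A. g e < t} = card {r. r < N \<and> g (a r) < t}" "card A = N"
                  using card_below_image[OF inja, of "\<lambda>e. g e < t"] inja by (simp_all add: A_def card_image)
                have A': "arr s7 ''act'' ` {..<reg s7 ''na''} = {e\<in>A. t < g e}"
                proof -
                  have "arr s7 ''act'' ` {..<reg s7 ''na''} = a ` {r. r < N \<and> t < ?G r}" using P7 by blast
                  also have "\<dots> = {e\<in>A. t < g e}" unfolding eqs(1) by (auto simp: A_def)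
                  finally show ?thesis .
                qed
                have "0 < t \<longrightarrow> 2 * card {e\<in>A. g e < t} < card A"
                  using P5 eqs c by (simp add: t_def)
                then have "round_result V m A (arr s ''lab'') ?lab {e\<in>A. t < g e}"
                  using lab lab' unfolding round_result_def Let_def g_def by blast
                moreover have "inj_on (arr s7 ''act'') {..<reg s7 ''na''}" using P7 by blast
                ultimately show ?case using half fr A' by simp
              qed
            qed
          qed
        qed
      qed
    qed
  qed
qed

subsection \<open>The labelling\<close>

text \<open>The edges outside \<open>A\<close> have been oriented, and no end chosen for them is an end of an edge in \<open>A\<close>.\<close>

definition balanced_off :: "(nat \<Rightarrow> nat) \<Rightarrow> nat \<Rightarrow> nat set \<Rightarrow> (nat \<Rightarrow> nat) \<Rightarrow> nat set \<Rightarrow> bool" where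
  "balanced_off V m E lab A \<longleftrightarrow> (\<forall>e\<in>E - A. lab (V e) \<in> {1..m} \<and>
      (\<forall>e'\<in>A. \<forall>b\<in>{1..m}. V (e' + b) \<noteq> V (e + lab (V e)))) \<and>
    (\<forall>d. orientable V m E d \<longrightarrow> (\<forall>u. card {e\<in>E - A. V (e + lab (V e)) = u} \<le> 2 * m * d))"

lemma card_fibre_le_incidences:
  assumes "finite A" and "\<And>e. e \<in> A \<Longrightarrow> f e \<in> {1..m}"
  shows "card {e\<in>A. V (e + f e) = u} \<le> incidences V m A u"
proof -
  have "card {e\<in>A. V (e + f e) = u} = (\<Sum>e\<in>A. if V (e + f e) = u then 1 else 0)"
    using assms(1) by (simp add: sum.If_cases Int_def)
  also have "\<dots> \<le> incidences V m A u"
    unfolding incidences_def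
  proof (rule sum_mono)
    fix e assume e: "e \<in> A"
    show "(if V (e + f e) = u then 1 else 0) \<le> card {b\<in>{1..m}. V (e + b) = u}"
    proof (cases "V (e + f e) = u")
      case True
      then have "card {f e} \<le> card {b\<in>{1..m}. V (e + b) = u}"
        using assms(2)[OF e] by (intro card_mono) auto
      then show ?thesis using True by simp
    qed simp
  qed
  finally show ?thesis .
qed

text \<open>An end chosen in this round has degree at most t, whereas every end of a retained edge
  has degree above t; so later rounds never add to the load of a vertex that is in use. A vertex
  used for the first time receives at most its degree.\<close>

lemma balanced_off_round:
  assumes E: "finite E" "inj_on V E" "A \<subseteq> E" and m: "m \<ge> 1"
    and bal: "balanced_off V m E lab A" and r: "round_result V m A lab lab' A'"
  shows "balanced_off V m E lab' A'"
proof -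
  define g where "g = (\<lambda>e. incidences V m A (V (e + lab' (V e))))"
  have old: "\<And>x. x \<notin> V ` A \<Longrightarrow> lab' x = lab x"
    and new: "\<And>e. e \<in> A \<Longrightarrow> lab' (V e) \<in> {1..m}"
    and g: "\<And>e b. e \<in> A \<Longrightarrow> b \<in> {1..m} \<Longrightarrow> g e \<le> incidences V m A (V (e + b))"
    using r by (auto simp: round_result_def Let_def g_def)
  obtain t where A': "A' = {e\<in>A. t < g e}" and t: "0 < t \<Longrightarrow> 2 * card {e\<in>A. g e < t} < card A"
    using r by (auto simp: round_result_def Let_def g_def)
  have A: "finite A" using E finite_subset by blast
  have lab_old: "lab' (V e) = lab (V e)" if "e \<in> E - A" for e
    using that E by (intro old) (auto simp: inj_on_def)
  have part: "lab' (V e) \<in> {1..m}" if "e \<in> E - A'" for e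
    using that new lab_old bal by (cases "e \<in> A") (auto simp: balanced_off_def)
  have sep: "V (e' + b) \<noteq> V (e + lab' (V e))" if "e \<in> E - A'" "e' \<in> A'" "b \<in> {1..m}" for e e' b
  proof (cases "e \<in> A")
    case True
    then have "g e \<le> t" using that A' by auto
    moreover have "t < incidences V m A (V (e' + b))" using that A' g by fastforce
    ultimately show ?thesis by (auto simp: g_def)
  next
    case False
    then show ?thesis using that lab_old bal A' by (auto simp: balanced_off_def)
  qed
  have load: "card {e\<in>E - A'. V (e + lab' (V e)) = u} \<le> 2 * m * d" if d: "orientable V m E d" for d u
  proof (cases "\<exists>e\<in>E - A. V (e + lab (V e)) = u")
    case True
    \<comment> \<open>A vertex that an earlier round has used is no end of an edge in
      \<open>A\<close>, so its load does not grow.\<close>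
    then have "V (e + lab' (V e)) \<noteq> u" if "e \<in> A" for e
      using bal new that by (auto simp: balanced_off_def)
    then have "{e\<in>E - A'. V (e + lab' (V e)) = u} \<subseteq> {e\<in>E - A. V (e + lab (V e)) = u}"
      using lab_old by force
    then have "card {e\<in>E - A'. V (e + lab' (V e)) = u} \<le> card {e\<in>E - A. V (e + lab (V e)) = u}"
      using E by (intro card_mono) auto
    then show ?thesis using bal d unfolding balanced_off_def by (meson le_trans)
  next
    case False
    then have "V (e + lab' (V e)) \<noteq> u" if "e \<in> E - A" for e
      using that lab_old by metis
    then have eq: "{e\<in>E - A'. V (e + lab' (V e)) = u} = {e\<in>A - A'. V (e + lab' (V e)) = u}"
      using E(3) by auto
    show ?thesis
    proof (cases "{e\<in>A - A'. V (e + lab' (V e)) = u} = {}")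
      case True
      then show ?thesis unfolding eq by (simp only: card.empty zero_le)
    next
      case False
      then obtain e where e: "e \<in> A - A'" "V (e + lab' (V e)) = u" by auto
      have "card {e\<in>A - A'. V (e + lab' (V e)) = u} \<le> card {e\<in>A. V (e + lab' (V e)) = u}"
        using A by (intro card_mono) auto
      also have "\<dots> \<le> incidences V m A u"
        using A new by (intro card_fibre_le_incidences)
      also have "\<dots> \<le> t" using e A' by (auto simp: g_def)
      \<comment> \<open>\<open>A\<close> inherits the orientation of \<open>E\<close>, so the same d
        bounds the threshold in all rounds.\<close>
      also have "t \<le> 2 * m * d"
        using median_min_incidences_le[OF A orientable_subset[OF d E(1,3)] m g t] by blast
      finally show ?thesis unfolding eq .
    qed
  qed
  show ?thesis unfolding balanced_off_def using part sep load by auto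
qed

definition peel :: prog where
  "peel = clear_labels ;; collect_edges ;; While (Reg ''na'') peel_round"

lemma mods_peel [simp]:
  "wr peel = {''j'', ''r'', ''e'', ''b'', ''c'', ''g'', ''tt'', ''acc'', ''r2'', ''na''}"
  "wa peel = {''deg'', ''gg'', ''lab'', ''hist'', ''act''}"
  by (auto simp: peel_def)

text \<open>The number of active edges halves, so the costs form a geometric series. A round costs
  \<open>14 * m + 30\<close> per edge and 18 further steps with the loop test, hence at most
  \<open>14 * m + 48\<close> per edge as there is an edge; twice that rate pays for all
  rounds.\<close>

lemma runs_peel_loop:
  assumes "reg s ''m'' = m" "arr s ''vt'' = V" "arr s ''hist'' = (\<lambda>_. 0)" "m \<ge> 1" "finite E" "inj_on V E"
    "inj_on (arr s ''act'') {..<reg s ''na''}" "arr s ''act'' ` {..<reg s ''na''} \<subseteq> E"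
    "balanced_off V m E (arr s ''lab'') (arr s ''act'' ` {..<reg s ''na''})"
  shows "runs (While (Reg ''na'') peel_round) s (int (reg s ''na'') * (int m * 28 + 96) + 1)
    (\<lambda>s'. arr s' ''hist'' = (\<lambda>_. 0) \<and> balanced_off V m E (arr s' ''lab'') {})"
  using assms
proof (induction "reg s ''na''" arbitrary: s rule: less_induct)
  case less
  let ?N = "reg s ''na''" and ?a = "arr s ''act''"
  show ?case
  proof (cases "?N = 0")
    case True
    then show ?thesis using less.prems by (intro runs_While_0) auto
  next
    case False
    show ?thesis
    proof (rule runs_While_step[OF _ runs_peel_round[where N = ?N and m = m and V = V and a = ?a]], goal_cases)
      case 7
      show ?case using comp_inj_on[OF less.prems(7) inj_on_subset[OF less.prems(6,8)]] by (simp add: o_def)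
    next
      case (9 s')
      note f = frame_reg[OF 9(2)] frame_arr[OF 9(2)]
      have na: "2 * reg s' ''na'' \<le> ?N" and hist: "arr s' ''hist'' = (\<lambda>_. 0)"
        and inj: "inj_on (arr s' ''act'') {..<reg s' ''na''}"
        and r: "round_result V m (?a ` {..<?N}) (arr s ''lab'') (arr s' ''lab'') (arr s' ''act'' ` {..<reg s' ''na''})"
        using 9(1) by blast+
      have sub: "arr s' ''act'' ` {..<reg s' ''na''} \<subseteq> ?a ` {..<?N}"
        using r unfolding round_result_def Let_def by blast
      have "runs (While (Reg ''na'') peel_round) s' (int (reg s' ''na'') * (int m * 28 + 96) + 1)
        (\<lambda>s'. arr s' ''hist'' = (\<lambda>_. 0) \<and> balanced_off V m E (arr s' ''lab'') {})"
      proof (rule less.hyps)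
        show "reg s' ''na'' < ?N" using na False by linarith
        show "reg s' ''m'' = m" "arr s' ''vt'' = V" using f less.prems(1,2) by simp_all
        show "arr s' ''act'' ` {..<reg s' ''na''} \<subseteq> E" using sub less.prems(8) by blast
        show "balanced_off V m E (arr s' ''lab'') (arr s' ''act'' ` {..<reg s' ''na''})"
          by (rule balanced_off_round[OF less.prems(5,6,8,4,9) r])
      qed (fact hist inj less.prems)+
      then show ?case
      proof (rule runs_mono)
        have "int (2 * reg s' ''na'') * (int m * 14 + 48) \<le> int ?N * (int m * 14 + 48)"
          using na by (intro mult_right_mono) auto
        moreover have "int ?N \<ge> 1" using False by simp
        ultimately show "int (reg s' ''na'') * (int m * 28 + 96) + 1
          \<le> int ?N * (int m * 28 + 96) + 1 - (int ?N * (int m * 14 + 30) + 17) - 1"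
          by (simp add: algebra_simps)
      qed
    qed (use less.prems(1-4) False in simp_all)
  qed
qed

lemma runs_peel:
  assumes n: "reg s ''n'' = n" and m1: "reg s ''m1'' = m1" and m: "reg s ''m'' = m"
    and V: "arr s ''vt'' = V" and hist: "arr s ''hist'' = (\<lambda>_. 0)" and m_ge: "m \<ge> 1"
  shows "runs peel s (int n * (int m * 28 + 108) + 8) (\<lambda>s'. arr s' ''hist'' = (\<lambda>_. 0) \<and>
    (\<exists>E \<subseteq> (\<lambda>j. j * m1) ` {..<n}. inj_on V E \<and> V ` E = (\<lambda>j. V (j * m1)) ` {..<n} \<and>
      balanced_off V m E (arr s' ''lab'') {}))"
  unfolding peel_def
proof (rule runs_Seq[OF runs_clear_labels[OF n m1 V]], goal_cases)
  case (1 s1)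
  note P1 = 1(1) and f1 = frame_reg[OF 1(2)] frame_arr[OF 1(2)]
  have s1: "reg s1 ''n'' = n" "reg s1 ''m1'' = m1" "arr s1 ''vt'' = V" "reg s1 ''m'' = m" "arr s1 ''hist'' = (\<lambda>_. 0)"
    using f1 assms by simp_all
  show ?case
  proof (rule runs_Seq[OF runs_collect_edges[OF s1(1-3) P1]], goal_cases)
    case (1 s2)
    note P2 = 1(1) and f2 = frame_reg[OF 1(2)] frame_arr[OF 1(2)]
    let ?E = "arr s2 ''act'' ` {..<reg s2 ''na''}"
    have inj: "inj_on (arr s2 ''act'') {..<reg s2 ''na''}" "inj_on V ?E"
      using P2 by (auto simp: inj_on_def)
    \<comment> \<open>At the start all edges are active, so nothing has been oriented yet and the
      balance is trivial.\<close>
    have loop: "runs (While (Reg ''na'') peel_round) s2 (int (reg s2 ''na'') * (int m * 28 + 96) + 1)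
        (\<lambda>s'. arr s' ''hist'' = (\<lambda>_. 0) \<and> balanced_off V m ?E (arr s' ''lab'') {})"
      using inj s1 f2 m_ge by (intro runs_peel_loop) (simp_all add: balanced_off_def)
    have im: "V ` ?E = (\<lambda>j. V (j * m1)) ` {..<n}" "?E \<subseteq> (\<lambda>j. j * m1) ` {..<n}"
      using P2 by (simp_all add: image_image)
    show ?case
    proof (rule runs_mono[OF loop], goal_cases)
      case 1
      have "int (reg s2 ''na'') * (int m * 28 + 96) \<le> int n * (int m * 28 + 96)"
        using P2 by (intro mult_right_mono) simp_all
      then show ?case by (simp add: algebra_simps)
    next
      case 2
      then show ?case using im inj(2) by blast
    qed
  qed
qed

section \<open>Digits\<close>

text \<open>In base 2 this unfolds a mask number, in base \<open>kk\<close> it chooses a class for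
  each atom. Division is by repeated subtraction; this is affordable because the decoded numbers are
  bounded in terms of the query.\<close>

definition decode :: prog where
  "decode = Assign ''u'' (Reg ''v'') ;; For ''c'' ''bn''
     (Assign ''h'' (Const 0) ;;
      While (Sub (Add (Reg ''u'') (Const 1)) (Reg ''ba''))
        (Assign ''u'' (Sub (Reg ''u'') (Reg ''ba'')) ;; Assign ''h'' (Add (Reg ''h'') (Const 1))) ;;
      Store ''dig'' (Reg ''c'') (Reg ''u'') ;; Assign ''u'' (Reg ''h''))"

lemma mods_decode [simp]: "wr decode = {''u'', ''c'', ''h''}" "wa decode = {''dig''}"
  by (auto simp: decode_def)

lemma runs_divide:
  assumes "reg s ''ba'' = K" "K \<ge> 1"
  shows "runs (While (Sub (Add (Reg ''u'') (Const 1)) (Reg ''ba''))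
        (Assign ''u'' (Sub (Reg ''u'') (Reg ''ba'')) ;; Assign ''h'' (Add (Reg ''h'') (Const 1))))
    s (int (reg s ''u'') * 3 + 1)
    (\<lambda>s'. reg s' ''u'' = reg s ''u'' mod K \<and> reg s' ''h'' = reg s ''h'' + reg s ''u'' div K)"
  using assms(1)
proof (induction "reg s ''u''" arbitrary: s rule: less_induct)
  case less
  show ?case
  proof (cases "reg s ''u'' < K")
    case True
    then show ?thesis using less.prems by (intro runs_While_0) simp_all
  next
    case False
    let ?s = "s\<lparr>reg := (reg s)(''u'' := reg s ''u'' - K, ''h'' := Suc (reg s ''h''))\<rparr>"
    show ?thesis
    proof (rule runs_While_step[where T' = 2 and P' = "\<lambda>s'. s' = ?s"], goal_cases)
      case (3 s')
      have eq: "reg s ''u'' mod K = (reg s ''u'' - K) mod K" "reg s ''u'' div K = Suc ((reg s ''u'' - K) div K)"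
        using False assms(2) by (simp_all add: le_mod_geq le_div_geq)
      show ?case unfolding 3(1)
        by (rule runs_mono[OF less.hyps]) (use less.prems False assms(2) eq in simp_all)
    qed (use less.prems False in simp_all)
  qed
qed

lemma runs_decode:
  assumes "reg s ''ba'' = K" "K \<ge> 1" "reg s ''bn'' = N" "reg s ''v'' = v"
  shows "runs decode s (int N * (int v * 3 + 6) + 3) (\<lambda>s'. \<forall>c<N. arr s' ''dig'' c = v div K ^ c mod K)"
  unfolding decode_def runs_Seq_Assign
proof (rule runs_For_const[where n = N and c = "int v * 3 + 4" and
    I = "\<lambda>i s. reg s ''u'' = v div K ^ i \<and> (\<forall>c<i. arr s ''dig'' c = v div K ^ c mod K)"], goal_cases)
  case (6 i s1)
  note f = frame_reg[OF 6(4)] frame_arr[OF 6(4)] and P = 6(5) and c = 6(2)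
  have K: "reg (s1\<lparr>reg := (reg s1)(''h'' := 0)\<rparr>) ''ba'' = K" using f assms by simp
  show ?case unfolding runs_Seq_Assign val.simps
  proof (rule runs_Seq[OF runs_divide[OF K assms(2)]], goal_cases)
    case (1 s2)
    note P2 = 1(1) and f2 = frame_reg[OF 1(2)] frame_arr[OF 1(2)]
    have e: "reg s2 ''u'' = v div K ^ i mod K" "reg s2 ''h'' = v div K ^ Suc i" "reg s2 ''c'' = i"
      "arr s2 ''dig'' = arr s1 ''dig''"
      using P2 f2 P c by (simp_all add: div_mult2_eq power_Suc2 del: power_Suc)
    have "int (v div K ^ i) \<le> int v" using div_le_dividend of_nat_mono by blast
    then show ?case using e P by (simp add: less_Suc_eq)
  qed
qed (use assms in \<open>simp_all add: algebra_simps\<close>)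

section \<open>Interning projections\<close>

text \<open>The step descends from node \<open>id\<close> along the letter \<open>x\<close>. The
  entry 0 means that there is no such child, which is unambiguous because the root is nobody's
  child; cells are 0 from the start, so the table is never initialised.\<close>

definition intern :: prog where
  "intern = Assign ''hh'' (Add (Arr ''base'' (Reg ''id'')) (Reg ''x'')) ;;
     If (Arr ''tab'' (Reg ''hh'')) Skip
       (Assign ''cnt'' (Add (Reg ''cnt'') (Const 1)) ;;
        Store ''base'' (Reg ''cnt'') (Add (Arr ''base'' (Sub (Reg ''cnt'') (Const 1))) (Reg ''mx'')) ;;
        Store ''tab'' (Reg ''hh'') (Reg ''cnt'')) ;;
     Assign ''id'' (Arr ''tab'' (Reg ''hh''))"

lemma mods_intern [simp]: "wr intern = {''hh'', ''cnt'', ''id''}" "wa intern = {''base'', ''tab''}"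
  by (auto simp: intern_def)

text \<open>Node \<open>n\<close>, which represents the word \<open>path n\<close>, owns the cells \<open>n * M + x\<close> with \<open>x < M\<close> for its
  children. The products are tabulated since the machine cannot multiply.\<close>

definition is_trie :: "nat \<Rightarrow> nat \<Rightarrow> (nat \<Rightarrow> nat) \<Rightarrow> (nat \<Rightarrow> nat) \<Rightarrow> (nat \<Rightarrow> nat list) \<Rightarrow> bool" where
  "is_trie M cnt base tab path \<longleftrightarrow>
    (\<forall>n\<le>cnt. base n = n * M) \<and> path 0 = [] \<and> inj_on path {..cnt} \<and>
    (\<forall>n\<le>cnt. path n \<noteq> [] \<longrightarrow> butlast (path n) \<in> path ` {..cnt}) \<and>
    (\<forall>n\<le>cnt. \<forall>x<M. if tab (n * M + x) = 0 then path n @ [x] \<notin> path ` {..cnt}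
       else tab (n * M + x) \<le> cnt \<and> path (tab (n * M + x)) = path n @ [x]) \<and>
    (\<forall>q\<ge>Suc cnt * M. tab q = 0)"

lemma is_trie_insert:
  assumes t: "is_trie M cnt base tab path" and n: "n \<le> cnt" "x < M" and new: "tab (n * M + x) = 0"
  shows "is_trie M (Suc cnt) (base(Suc cnt := base cnt + M)) (tab(n * M + x := Suc cnt))
    (path(Suc cnt := path n @ [x]))"
proof -
  let ?p = "path(Suc cnt := path n @ [x])"
  have img: "?p ` {..Suc cnt} = insert (path n @ [x]) (path ` {..cnt})"
    by (auto simp: atMost_Suc)
  have fresh: "path n @ [x] \<notin> path ` {..cnt}" using t n new unfolding is_trie_def by metis
  \<comment> \<open>Letters are below \<open>M\<close>, so the address of a cell determines its node
    and its letter.\<close>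
  have idx: "n' * M + x' = n * M + x \<longleftrightarrow> n' = n \<and> x' = x" if "x' < M" for n' x'
  proof
    assume "n' * M + x' = n * M + x"
    then have "(n' * M + x') div M = (n * M + x) div M" "(n' * M + x') mod M = (n * M + x) mod M" by simp_all
    then show "n' = n \<and> x' = x" using that n by simp
  qed simp
  have lt: "n' * M + x' < Suc cnt * M" if "n' \<le> cnt" "x' < M" for n' x'
  proof -
    have "n' * M + x' < Suc n' * M" using that by simp
    also have "\<dots> \<le> Suc cnt * M" using that by (intro mult_right_mono) auto
    finally show ?thesis .
  qed
  have old: "\<And>n'. n' \<le> cnt \<Longrightarrow> base n' = n' * M" "path 0 = []" "inj_on path {..cnt}"
    "\<And>n'. n' \<le> cnt \<Longrightarrow> path n' \<noteq> [] \<Longrightarrow> butlast (path n') \<in> path ` {..cnt}"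
    "\<And>n' x'. n' \<le> cnt \<Longrightarrow> x' < M \<Longrightarrow> if tab (n' * M + x') = 0 then path n' @ [x'] \<notin> path ` {..cnt}
       else tab (n' * M + x') \<le> cnt \<and> path (tab (n' * M + x')) = path n' @ [x']"
    "\<And>q. q \<ge> Suc cnt * M \<Longrightarrow> tab q = 0"
    using t unfolding is_trie_def by blast+
  \<comment> \<open>If a child of the new node were present, closure under \<open>butlast\<close>
    would make the new word present as well.\<close>
  have top: "path n @ [x, x'] \<notin> path ` {..cnt}" for x'
  proof
    assume "path n @ [x, x'] \<in> path ` {..cnt}"
    then obtain n' where n': "n' \<le> cnt" "path n' = path n @ [x, x']" by auto
    then have "butlast (path n') = path n @ [x]" by (simp add: butlast_append)
    then show False using old(4)[OF n'(1)] n' fresh by auto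
  qed
  have c5: "if (tab(n * M + x := Suc cnt)) (n' * M + x') = 0 then ?p n' @ [x'] \<notin> ?p ` {..Suc cnt}
       else (tab(n * M + x := Suc cnt)) (n' * M + x') \<le> Suc cnt \<and>
         ?p ((tab(n * M + x := Suc cnt)) (n' * M + x')) = ?p n' @ [x']" if "n' \<le> Suc cnt" "x' < M" for n' x'
  proof (cases "n' = Suc cnt")
    case True
    have "tab (n' * M + x') = 0" using old(6) True by simp
    moreover have "n' * M + x' \<noteq> n * M + x" using idx[OF that(2), of n'] True n by simp
    ultimately show ?thesis using top True unfolding img by simp
  next
    case False
    then have n': "n' \<le> cnt" using that by simp
    show ?thesis
    proof (cases "n' * M + x' = n * M + x")
      case True
      then show ?thesis using idx[OF that(2)] n by simp
    next
      case neq: False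
      have "path n' \<noteq> path n \<or> x' \<noteq> x" using neq idx[OF that(2)] old(3) n n' by (auto simp: inj_on_def)
      then show ?thesis using old(5)[OF n' that(2)] neq n' unfolding img
        by (auto split: if_splits)
    qed
  qed
  show ?thesis unfolding is_trie_def
  proof (intro conjI)
    show "inj_on ?p {..Suc cnt}"
    proof -
      have "path i \<noteq> path n @ [x]" if "i \<le> cnt" for i
        using fresh that by (metis atMost_iff imageI)
      moreover have "i = i'" if "i \<le> cnt" "i' \<le> cnt" "path i = path i'" for i i'
        using old(3) that by (auto simp: inj_on_def)
      ultimately show ?thesis by (auto simp: inj_on_def le_Suc_eq dest: sym)
    qed
    show "\<forall>n'\<le>Suc cnt. ?p n' \<noteq> [] \<longrightarrow> butlast (?p n') \<in> ?p ` {..Suc cnt}"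
      unfolding img using old(4) n by (auto simp: le_Suc_eq)
    show "\<forall>q\<ge>Suc (Suc cnt) * M. (tab(n * M + x := Suc cnt)) q = 0"
      using old(6) lt[OF n] by auto
    show "\<forall>n'\<le>Suc cnt. (base(Suc cnt := base cnt + M)) n' = n' * M"
      using old(1) by (auto simp: le_Suc_eq)
    show "?p 0 = []" using old(2) by simp
  qed (use c5 in blast)
qed

abbreviation trie_in :: "state \<Rightarrow> (nat \<Rightarrow> nat list) \<Rightarrow> bool" where
  "trie_in s \<equiv> is_trie (reg s ''mx'') (reg s ''cnt'') (arr s ''base'') (arr s ''tab'')"

text \<open>Nodes keep their words as the trie grows, so identifiers handed out at different times
  stay comparable.\<close>

lemma runs_intern:
  assumes t: "trie_in s path" and n: "reg s ''id'' \<le> reg s ''cnt''" and x: "reg s ''x'' < reg s ''mx''"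
  shows "runs intern s 6 (\<lambda>s'. \<exists>path'. trie_in s' path' \<and> reg s ''cnt'' \<le> reg s' ''cnt'' \<and>
    (\<forall>i\<le>reg s ''cnt''. path' i = path i) \<and> reg s' ''id'' \<le> reg s' ''cnt'' \<and>
    path' (reg s' ''id'') = path (reg s ''id'') @ [reg s ''x''])"
proof -
  let ?n = "reg s ''id''" and ?x = "reg s ''x''" and ?M = "reg s ''mx''" and ?c = "reg s ''cnt''"
  have b: "arr s ''base'' ?n = ?n * ?M" using t n unfolding is_trie_def by blast
  show ?thesis
  proof (cases "arr s ''tab'' (?n * ?M + ?x) = 0")
    case True
    note ins = is_trie_insert[OF t n x True]
    show ?thesis using True b ins unfolding intern_def
      by simp (rule exI[of _ "path(Suc ?c := path ?n @ [?x])"], simp)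
  next
    case False
    have "arr s ''tab'' (?n * ?M + ?x) \<le> ?c \<and> path (arr s ''tab'' (?n * ?M + ?x)) = path ?n @ [?x]"
      using t n x False unfolding is_trie_def by metis
    then show ?thesis using False b t unfolding intern_def by auto
  qed
qed

section \<open>Identifiers of projected rows\<close>

definition intern_projection :: prog where
  "intern_projection = Assign ''id'' (Const 0) ;; For ''c'' ''z''
     (If (Arr ''dig'' (Reg ''c''))
        (If (Arr ''dig'' (Add (Reg ''bb'') (Reg ''c'')))
          (Assign ''x'' (Add (Arr ''in'' (Add (Reg ''t'') (Reg ''c''))) (Const 1)))
          (Assign ''x'' (Const 0)))
        (Assign ''x'' (Const 0)) ;;
      intern)"

text \<open>Row j contributes \<open>m1\<close> consecutive identifiers, that of its projection to Y
  and then those of its ends: this is the edge format of the peeling. All come from the same trie,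
  without confusion, since the first serves as an index of labels and the others as indices of
  degrees.\<close>

definition intern_projections :: prog where
  "intern_projections = Assign ''q'' (Const 0) ;; Assign ''t'' (Reg ''p'') ;; For ''j'' ''n''
     (Assign ''bb'' (Const 0) ;;
      For ''b'' ''m1''
        (intern_projection ;; Store ''vt'' (Reg ''q'') (Reg ''id'') ;;
         Assign ''q'' (Add (Reg ''q'') (Const 1)) ;; Assign ''bb'' (Add (Reg ''bb'') (Reg ''l''))) ;;
      Assign ''t'' (Add (Reg ''t'') (Reg ''z'')))"

lemma mods_intern_projection [simp]:
    "wr intern_projection = {''id'', ''c'', ''x'', ''hh'', ''cnt''}" "wa intern_projection = {''base'', ''tab''}"
  and mods_intern_projections [simp]:
    "wr intern_projections = {''q'', ''t'', ''j'', ''bb'', ''b'', ''id'', ''c'', ''x'', ''hh'', ''cnt''}"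
    "wa intern_projections = {''vt'', ''base'', ''tab''}"
  by (auto simp: intern_projection_def intern_projections_def)

text \<open>The letter 0 stands for a column that is masked out, and values are shifted by one. The
  word thus records the mask as well as the restricted tuple, and vertices for distinct X stay
  distinct.\<close>

definition masked :: "(nat \<Rightarrow> bool) \<Rightarrow> nat \<Rightarrow> (nat \<Rightarrow> nat) \<Rightarrow> nat list" where
  "masked B z f = map (\<lambda>c. if B c then Suc (f c) else 0) [0..<z]"

lemma masked_Suc: "masked B (Suc z) f = masked B z f @ [if B z then Suc (f z) else 0]"
  by (simp add: masked_def)

lemma runs_intern_projection:
  assumes t: "trie_in s path" and z: "reg s ''z'' = z" and pos: "0 < reg s ''mx''"
    and mx: "\<And>c. c < z \<Longrightarrow> Suc (arr s ''in'' (reg s ''t'' + c)) < reg s ''mx''"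
  shows "runs intern_projection s (int z * 11 + 3) (\<lambda>s'. \<exists>path'. trie_in s' path' \<and>
    reg s ''cnt'' \<le> reg s' ''cnt'' \<and> (\<forall>i\<le>reg s ''cnt''. path' i = path i) \<and>
    reg s' ''id'' \<le> reg s' ''cnt'' \<and> path' (reg s' ''id'') =
      masked (\<lambda>c. arr s ''dig'' c \<noteq> 0 \<and> arr s ''dig'' (reg s ''bb'' + c) \<noteq> 0) z
        (\<lambda>c. arr s ''in'' (reg s ''t'' + c)))"
  unfolding intern_projection_def runs_Seq_Assign
proof (rule runs_For_const[where n = z and c = 9 and
    I = "\<lambda>i s'. \<exists>path'. trie_in s' path' \<and>
    reg s ''cnt'' \<le> reg s' ''cnt'' \<and> (\<forall>i\<le>reg s ''cnt''. path' i = path i) \<and>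
    reg s' ''id'' \<le> reg s' ''cnt'' \<and> path' (reg s' ''id'') =
      masked (\<lambda>c. arr s ''dig'' c \<noteq> 0 \<and> arr s ''dig'' (reg s ''bb'' + c) \<noteq> 0) i
        (\<lambda>c. arr s ''in'' (reg s ''t'' + c))"], goal_cases)
  case 5
  have "path 0 = []" using t by (simp add: is_trie_def)
  then show ?case using t by (auto simp: masked_def)
next
  case (6 i s1)
  note f = frame_reg[OF 6(4)] frame_arr[OF 6(4)] and i = 6(1,2)
  have fr: "reg s1 ''mx'' = reg s ''mx''" "reg s1 ''t'' = reg s ''t''" "reg s1 ''bb'' = reg s ''bb''"
    "arr s1 ''in'' = arr s ''in''" "arr s1 ''dig'' = arr s ''dig''"
    using f by simp_all
  obtain path' where p: "trie_in s1 path'" "reg s ''cnt'' \<le> reg s1 ''cnt''"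
    "\<forall>i\<le>reg s ''cnt''. path' i = path i" "reg s1 ''id'' \<le> reg s1 ''cnt''"
    "path' (reg s1 ''id'') = masked (\<lambda>c. arr s ''dig'' c \<noteq> 0 \<and> arr s ''dig'' (reg s ''bb'' + c) \<noteq> 0) i
        (\<lambda>c. arr s ''in'' (reg s ''t'' + c))"
    using 6(5) by blast
  define x where "x = (if arr s ''dig'' i \<noteq> 0 \<and> arr s ''dig'' (reg s ''bb'' + i) \<noteq> 0
    then Suc (arr s ''in'' (reg s ''t'' + i)) else 0)"
  define s2 where "s2 = s1\<lparr>reg := (reg s1)(''x'' := x)\<rparr>"
  have s2: "trie_in s2 path'" "reg s2 ''id'' \<le> reg s2 ''cnt''" "reg s2 ''x'' < reg s2 ''mx''"
    using p mx[OF i(1)] pos fr by (simp_all add: s2_def x_def)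
  have A: "runs (If (Arr ''dig'' (Reg ''c''))
        (If (Arr ''dig'' (Add (Reg ''bb'') (Reg ''c'')))
          (Assign ''x'' (Add (Arr ''in'' (Add (Reg ''t'') (Reg ''c''))) (Const 1)))
          (Assign ''x'' (Const 0)))
        (Assign ''x'' (Const 0))) s1 3 (\<lambda>s. s = s2)"
    by (simp add: s2_def x_def fr i)
  show ?case
  proof (rule runs_Seq[OF A], goal_cases)
    case (1 s2')
    show ?case unfolding 1(1)
    proof (rule runs_mono[OF runs_intern[OF s2]], goal_cases)
      case (2 s3)
      then obtain path'' where q: "trie_in s3 path''" "reg s2 ''cnt'' \<le> reg s3 ''cnt''"
        "\<forall>i\<le>reg s2 ''cnt''. path'' i = path' i" "reg s3 ''id'' \<le> reg s3 ''cnt''"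
        "path'' (reg s3 ''id'') = path' (reg s2 ''id'') @ [reg s2 ''x'']" by blast
      have "reg s2 ''cnt'' = reg s1 ''cnt''" "reg s2 ''id'' = reg s1 ''id''" "reg s2 ''x'' = x"
        by (simp_all add: s2_def)
      then show ?case using p q by (intro exI[of _ path'']) (simp add: masked_Suc x_def)
    qed simp
  qed
qed (use z in simp_all)

lemma runs_intern_projections:
  assumes t: "trie_in s path" and pos: "0 < reg s ''mx''"
    and regs: "reg s ''z'' = z" "reg s ''n'' = n" "reg s ''m1'' = m1" "reg s ''l'' = l" "reg s ''p'' = p"
    and mx: "\<And>j c. j < n \<Longrightarrow> c < z \<Longrightarrow> Suc (arr s ''in'' (p + j * z + c)) < reg s ''mx''"
    and key: "key = (\<lambda>j b. masked (\<lambda>c. arr s ''dig'' c \<noteq> 0 \<and> arr s ''dig'' (b * l + c) \<noteq> 0) z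
        (\<lambda>c. arr s ''in'' (p + j * z + c)))"
  shows "runs intern_projections s (int n * (int m1 * (int z * 11 + 8) + 6) + 4)
    (\<lambda>s'. (\<exists>path'. trie_in s' path') \<and>
      (\<forall>j<n. \<forall>b<m1. \<forall>j'<n. \<forall>b'<m1.
        arr s' ''vt'' (j * m1 + b) = arr s' ''vt'' (j' * m1 + b') \<longleftrightarrow> key j b = key j' b'))"
proof -
  \<comment> \<open>Identifiers are addressed by the flat index \<open>j * m1 + b\<close>, from
    which division recovers the row and the block.\<close>
  let ?J = "\<lambda>q s'. \<exists>path'. trie_in s' path' \<and>
    (\<forall>q'<q. arr s' ''vt'' q' \<le> reg s' ''cnt'' \<and> path' (arr s' ''vt'' q') = key (q' div m1) (q' mod m1))"
  show ?thesis
    unfolding intern_projections_def runs_Seq_Assign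
  proof (rule runs_For_const[where n = n and c = "int m1 * (int z * 11 + 8) + 4" and
    I = "\<lambda>j s'. reg s' ''q'' = j * m1 \<and> reg s' ''t'' = p + j * z \<and> ?J (j * m1) s'"], goal_cases)
    case (6 j s1)
    note f = frame_reg[OF 6(4)] frame_arr[OF 6(4)] and j = 6(1,2) and P = 6(5)
    have fr: "reg s1 ''mx'' = reg s ''mx''" "reg s1 ''z'' = z" "reg s1 ''m1'' = m1" "reg s1 ''l'' = l"
      "reg s1 ''p'' = p" "arr s1 ''in'' = arr s ''in''" "arr s1 ''dig'' = arr s ''dig''"
      using f regs by simp_all
    show ?case unfolding runs_Seq_Assign
    proof (rule runs_For_Seq[where n = m1 and c = "int z * 11 + 6" and
      I = "\<lambda>b s'. reg s' ''bb'' = b * l \<and> reg s' ''q'' = j * m1 + b \<and> ?J (j * m1 + b) s'"], goal_cases)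
      case (6 b s2)
      note f2 = frame_reg[OF 6(4)] frame_arr[OF 6(4)] and b = 6(1,2)
      have q: "reg s2 ''q'' = j * m1 + b" "reg s2 ''bb'' = b * l" using 6(5) by blast+
      have fr2: "reg s2 ''mx'' = reg s ''mx''" "reg s2 ''z'' = z" "reg s2 ''l'' = l"
        "reg s2 ''t'' = p + j * z" "arr s2 ''in'' = arr s ''in''" "arr s2 ''dig'' = arr s ''dig''"
        using f2 fr P by simp_all
      obtain path' where p: "trie_in s2 path'" and
        old: "\<forall>q'<j * m1 + b. arr s2 ''vt'' q' \<le> reg s2 ''cnt'' \<and> path' (arr s2 ''vt'' q') = key (q' div m1) (q' mod m1)"
        using 6(5) by blast
      have mx2: "0 < reg s2 ''mx''" "\<And>c. c < z \<Longrightarrow> Suc (arr s2 ''in'' (reg s2 ''t'' + c)) < reg s2 ''mx''"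
        using pos mx[OF j(1)] fr2 by simp_all
      show ?case
      proof (rule runs_Seq[OF runs_intern_projection[OF p fr2(2) mx2]], goal_cases)
        case 1 then show ?case by simp
      next
        case (2 s3)
        note f3 = frame_reg[OF 2(2)] frame_arr[OF 2(2)]
        obtain path'' where n: "trie_in s3 path''" "reg s2 ''cnt'' \<le> reg s3 ''cnt''"
          "\<forall>i\<le>reg s2 ''cnt''. path'' i = path' i" "reg s3 ''id'' \<le> reg s3 ''cnt''"
          "path'' (reg s3 ''id'') = key j b"
          using 2(1) unfolding fr2 q key by blast
        have fr3: "reg s3 ''q'' = j * m1 + b" "reg s3 ''bb'' = b * l" "reg s3 ''l'' = l" "reg s3 ''b'' = b"
          "arr s3 ''vt'' = arr s2 ''vt''"
          using f3 q fr2 b by simp_all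
        have dm: "(j * m1 + b) div m1 = j" "(j * m1 + b) mod m1 = b" using b by simp_all
        have "?J (Suc (j * m1 + b)) (s3\<lparr>arr := (arr s3)(''vt'' := (arr s3 ''vt'')(j * m1 + b := reg s3 ''id''))\<rparr>)"
          using n old dm by (intro exI[of _ path'']) (auto simp: fr3 less_Suc_eq)
        then show ?case using fr3 by (simp add: add.commute)
      qed
    next
      case (7 s2)
      note f2 = frame_reg[OF 7(2)]
      have "reg s2 ''t'' = p + j * z" "reg s2 ''z'' = z" "reg s2 ''j'' = j" using f2 fr P j by simp_all
      then show ?case using 7(3) by (simp add: add.commute)
    qed (use fr P in simp_all)
  next
    case 7 then show ?case by (simp add: algebra_simps)
  next
    case (8 s1)
    then obtain path' where p: "trie_in s1 path'" and
      v: "\<And>q'. q' < n * m1 \<Longrightarrow> arr s1 ''vt'' q' \<le> reg s1 ''cnt'' \<and> path' (arr s1 ''vt'' q') = key (q' div m1) (q' mod m1)"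
      by blast
    have V: "arr s1 ''vt'' (j * m1 + b) \<le> reg s1 ''cnt'' \<and> path' (arr s1 ''vt'' (j * m1 + b)) = key j b"
      if "j < n" "b < m1" for j b
    proof -
      have "j * m1 + b < Suc j * m1" using that by simp
      also have "\<dots> \<le> n * m1" using that by (intro mult_right_mono) auto
      finally show ?thesis using v that by simp
    qed
    \<comment> \<open>Distinct nodes carry distinct words, so comparing identifiers compares
      words.\<close>
    have "inj_on path' {..reg s1 ''cnt''}" using p by (simp add: is_trie_def)
    then have "arr s1 ''vt'' (j * m1 + b) = arr s1 ''vt'' (j' * m1 + b') \<longleftrightarrow> key j b = key j' b'"
      if "j < n" "b < m1" "j' < n" "b' < m1" for j b j' b'
      using V[OF that(1,2)] V[OF that(3,4)] by (metis atMost_iff inj_on_eq_iff)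
    then show ?case using p by blast
  next
    case 5 show ?case using t regs by (intro conjI exI[of _ path]) simp_all
  qed (use regs in simp_all)
qed

section \<open>Refining the classes\<close>

text \<open>The pair of old class and label is packed as the old class times \<open>m1\<close> plus
  the label. This product and the new number \<open>kk\<close> of classes are formed by repeated
  addition.\<close>

definition update_classes :: prog where
  "update_classes = Assign ''e'' (Const 0) ;; Assign ''y'' (Reg ''o'') ;; For ''j'' ''n''
     (Assign ''x'' (Const 0) ;;
      For ''b'' ''m1'' (Assign ''x'' (Add (Reg ''x'') (Arr ''cls'' (Reg ''y'')))) ;;
      Store ''cls'' (Reg ''y'') (Add (Reg ''x'') (Arr ''lab'' (Arr ''vt'' (Reg ''e'')))) ;;
      Assign ''e'' (Add (Reg ''e'') (Reg ''m1'')) ;; Assign ''y'' (Add (Reg ''y'') (Const 1))) ;;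
     Assign ''x'' (Const 0) ;;
     For ''b'' ''m1'' (Assign ''x'' (Add (Reg ''x'') (Reg ''kk''))) ;;
     Assign ''kk'' (Reg ''x'')"

lemma mods_update_classes [simp]:
  "wr update_classes = {''e'', ''y'', ''j'', ''x'', ''b'', ''kk''}" "wa update_classes = {''cls''}"
  by (auto simp: update_classes_def)

lemma runs_update_classes:
  assumes regs: "reg s ''n'' = n" "reg s ''m1'' = m1" "reg s ''o'' = o'" "reg s ''kk'' = K"
    and C: "arr s ''cls'' = C" and L: "arr s ''lab'' = L" and V: "arr s ''vt'' = V"
  shows "runs update_classes s (int n * (int m1 * 3 + 8) + int m1 * 3 + 8) (\<lambda>s'. reg s' ''kk'' = K * m1 \<and>
    (\<forall>j<n. arr s' ''cls'' (o' + j) = C (o' + j) * m1 + L (V (j * m1))) \<and>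
    (\<forall>y. y < o' \<or> o' + n \<le> y \<longrightarrow> arr s' ''cls'' y = C y))"
  unfolding update_classes_def runs_Seq_Assign
proof (rule runs_For_Seq[where n = n and c = "int m1 * 3 + 6" and I = "\<lambda>i s'. reg s' ''e'' = i * m1 \<and>
    reg s' ''y'' = o' + i \<and> (\<forall>j<i. arr s' ''cls'' (o' + j) = C (o' + j) * m1 + L (V (j * m1))) \<and>
    (\<forall>y. y < o' \<or> o' + i \<le> y \<longrightarrow> arr s' ''cls'' y = C y)"], goal_cases)
  case (6 i s1)
  note f = frame_reg[OF 6(4)] frame_arr[OF 6(4)] and i = 6(1,2) and P = 6(5)
  have fr: "reg s1 ''m1'' = m1" "arr s1 ''lab'' = L" "arr s1 ''vt'' = V" using f regs L V by simp_all
  have y: "reg s1 ''y'' = o' + i" "arr s1 ''cls'' (o' + i) = C (o' + i)" using P by simp_all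
  show ?case unfolding runs_Seq_Assign
  proof (rule runs_For_Seq[where n = m1 and c = 1 and I = "\<lambda>b s'. reg s' ''x'' = b * C (o' + i)"], goal_cases)
    case (6 b s2)
    have "reg s2 ''y'' = o' + i" "arr s2 ''cls'' = arr s1 ''cls''"
      using frame_reg[OF 6(4)] frame_arr[OF 6(4)] y by simp_all
    then show ?case using 6(5) y by simp
  next
    case (7 s2)
    have "reg s2 ''y'' = o' + i" "arr s2 ''cls'' = arr s1 ''cls''" "reg s2 ''e'' = i * m1" "reg s2 ''m1'' = m1"
      "arr s2 ''lab'' = L" "arr s2 ''vt'' = V" "reg s2 ''j'' = i"
      using frame_reg[OF 7(2)] frame_arr[OF 7(2)] y P fr i by simp_all
    then show ?case using 7(3) P by (simp add: less_Suc_eq mult.commute)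
  qed (use fr in simp_all)
next
  case (7 s1)
  note f = frame_reg[OF 7(2)] frame_arr[OF 7(2)] and P = 7(3)
  have fr: "reg s1 ''m1'' = m1" "reg s1 ''kk'' = K" using f regs by simp_all
  show ?case unfolding runs_Seq_Assign
  proof (rule runs_For_Seq[where n = m1 and c = 1 and I = "\<lambda>b s'. reg s' ''x'' = b * K"], goal_cases)
    case (6 b s2)
    have "reg s2 ''kk'' = K" using frame_reg[OF 6(4)] fr by simp
    then show ?case using 6(5) by simp
  next
    case (7 s2)
    have "arr s2 ''cls'' = arr s1 ''cls''" using frame_arr[OF 7(2)] by simp
    then show ?case using 7(3) P by (simp add: mult.commute algebra_simps)
  qed (use fr in simp_all)
qed (use assms in simp_all)

section \<open>Classifying tuples\<close>

text \<open>This is orientability in terms of rows. A partition splits the relation itself, so rows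
  with the same projection to Y may go to different ends; at each vertex they count once, as in the
  definition of a degree.\<close>

definition orientable_keys :: "nat \<Rightarrow> nat \<Rightarrow> (nat \<Rightarrow> nat \<Rightarrow> 'a) \<Rightarrow> nat \<Rightarrow> bool" where
  "orientable_keys n m key d \<longleftrightarrow> (\<exists>f. (\<forall>j<n. f j \<in> {1..m}) \<and>
    (\<forall>u. card ((\<lambda>j. key j 0) ` {j. j < n \<and> key j (f j) = u}) \<le> d))"

text \<open>The bound is required for all feasible d simultaneously, since one labelling has to
  answer constraints with any d.\<close>

definition balanced_labels :: "nat \<Rightarrow> nat \<Rightarrow> (nat \<Rightarrow> nat \<Rightarrow> 'a) \<Rightarrow> (nat \<Rightarrow> nat) \<Rightarrow> bool" where
  "balanced_labels n m key lab \<longleftrightarrow> (\<forall>j<n. lab j \<in> {1..m}) \<and>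
    (\<forall>d. orientable_keys n m key d \<longrightarrow>
      (\<forall>b u. card ((\<lambda>j. key j 0) ` {j. j < n \<and> lab j = b \<and> key j b = u}) \<le> 2 * m * d))"

text \<open>The peeling works on one representative for each projection to Y. By \<open>dep\<close>
  the ends are a function of that projection, so the label of the representative is valid for every
  row that shares it.\<close>

lemma balanced_labelsI:
  assumes V: "\<And>j b j' b'. j < n \<Longrightarrow> b \<le> m \<Longrightarrow> j' < n \<Longrightarrow> b' \<le> m \<Longrightarrow>
      V (j * Suc m + b) = V (j' * Suc m + b') \<longleftrightarrow> key j b = key j' b'"
    and dep: "\<And>j j' b. j < n \<Longrightarrow> j' < n \<Longrightarrow> key j 0 = key j' 0 \<Longrightarrow> key j b = key j' b"
    and E: "E \<subseteq> (\<lambda>j. j * Suc m) ` {..<n}" "inj_on V E" "V ` E = (\<lambda>j. V (j * Suc m)) ` {..<n}"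
    and bal: "balanced_off V m E lab {}"
  shows "balanced_labels n m key (\<lambda>j. lab (V (j * Suc m)))"
proof -
  define h where "h = (\<lambda>e. key (e div Suc m) 0)"
  have V0: "V (j * Suc m) = V (j' * Suc m) \<longleftrightarrow> key j 0 = key j' 0" if "j < n" "j' < n" for j j'
    using V[OF that(1) _ that(2), of 0 0] by simp
  have h: "h (j * Suc m) = key j 0" for j unfolding h_def by (metis nonzero_mult_div_cancel_right Zero_not_Suc)
  have finE: "finite E" using E(1) finite_subset by blast
  have injh: "inj_on h E"
  proof (rule inj_onI)
    fix e e' assume e: "e \<in> E" "e' \<in> E" "h e = h e'"
    then obtain j j' where j: "j < n" "e = j * Suc m" "j' < n" "e' = j' * Suc m" using E(1) by blast
    then have "V e = V e'" using e(3) V0[OF j(1,3)] h by simp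
    then show "e = e'" using E(2) e by (meson inj_onD)
  qed
  have rep: "\<exists>e\<in>E. V e = V (j * Suc m)" if "j < n" for j
  proof -
    have "V (j * Suc m) \<in> V ` E" unfolding E(3) using that by blast
    then show ?thesis by force
  qed
  have lab: "lab (V (j * Suc m)) \<in> {1..m}" if "j < n" for j
    using rep[OF that] bal unfolding balanced_off_def by (metis Diff_empty)
  have "card ((\<lambda>j. key j 0) ` {j. j < n \<and> lab (V (j * Suc m)) = b \<and> key j b = u}) \<le> 2 * m * d"
    if d: "orientable_keys n m key d" for d b u
  proof -
    obtain f where f: "\<And>j. j < n \<Longrightarrow> f j \<in> {1..m}"
      "\<And>u. card ((\<lambda>j. key j 0) ` {j. j < n \<and> key j (f j) = u}) \<le> d"
      using d unfolding orientable_keys_def by blast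
    \<comment> \<open>Each representative keeps the end chosen for its own row; leaving out the
      other rows can only lower the load.\<close>
    have "orientable V m E d"
      unfolding orientable_def
    proof (intro exI[of _ "\<lambda>e. f (e div Suc m)"] conjI ballI allI)
      fix e assume "e \<in> E"
      then obtain j where "j < n" "e = j * Suc m" using E(1) by blast
      then show "f (e div Suc m) \<in> {1..m}" using f(1) by (metis nonzero_mult_div_cancel_right Zero_not_Suc)
    next
      fix u
      let ?S = "{e\<in>E. V (e + f (e div Suc m)) = u}"
      show "card ?S \<le> d"
      proof (cases "?S = {}")
        case False
        then obtain e0 where e0: "e0 \<in> E" "V (e0 + f (e0 div Suc m)) = u" by blast
        then obtain j0 where j0: "j0 < n" "e0 = j0 * Suc m" using E(1) by blast
        have dv: "j * Suc m div Suc m = j" for j by (metis nonzero_mult_div_cancel_right Zero_not_Suc)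
        have "h ` ?S \<subseteq> (\<lambda>j. key j 0) ` {j. j < n \<and> key j (f j) = key j0 (f j0)}"
        proof
          fix w assume "w \<in> h ` ?S"
          then obtain e where e: "e \<in> E" "V (e + f (e div Suc m)) = u" "w = h e" by blast
          then obtain j where j: "j < n" "e = j * Suc m" using E(1) by blast
          have "V (j * Suc m + f j) = V (j0 * Suc m + f j0)" using e(2) e0(2) j j0 by (simp only: dv)
          then have "key j (f j) = key j0 (f j0)"
            using V[OF j(1) _ j0(1)] f(1)[OF j(1)] f(1)[OF j0(1)] by simp
          then show "w \<in> (\<lambda>j. key j 0) ` {j. j < n \<and> key j (f j) = key j0 (f j0)}"
            using e(3) j h by blast
        qed
        then have "card (h ` ?S) \<le> card ((\<lambda>j. key j 0) ` {j. j < n \<and> key j (f j) = key j0 (f j0)})"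
          by (intro card_mono) auto
        moreover have "card (h ` ?S) = card ?S"
          using injh by (intro card_image) (auto simp: inj_on_def)
        ultimately show ?thesis using f(2)[of "key j0 (f j0)"] by linarith
      qed (simp only: card.empty zero_le)
    qed
    then have load: "card {e\<in>E. V (e + lab (V e)) = u'} \<le> 2 * m * d" for u'
      using bal unfolding balanced_off_def by (metis Diff_empty)
    show ?thesis
    proof (cases "{j. j < n \<and> lab (V (j * Suc m)) = b \<and> key j b = u} = {}")
      case False
      then obtain j0 where j0: "j0 < n" "lab (V (j0 * Suc m)) = b" "key j0 b = u" by blast
      have b: "b \<le> m" using lab[OF j0(1)] j0(2) by simp
      have "(\<lambda>j. key j 0) ` {j. j < n \<and> lab (V (j * Suc m)) = b \<and> key j b = u}
        \<subseteq> h ` {e\<in>E. V (e + lab (V e)) = V (j0 * Suc m + b)}"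
      proof
        fix w assume "w \<in> (\<lambda>j. key j 0) ` {j. j < n \<and> lab (V (j * Suc m)) = b \<and> key j b = u}"
        then obtain j where j: "j < n" "lab (V (j * Suc m)) = b" "key j b = u" "w = key j 0" by blast
        obtain e where e: "e \<in> E" "V e = V (j * Suc m)" using rep[OF j(1)] by blast
        then obtain j' where j': "j' < n" "e = j' * Suc m" using E(1) by blast
        have k: "key j' 0 = key j 0" using e(2) j' V0[OF j'(1) j(1)] by simp
        then have "key j' b = key j0 b" using dep[OF j'(1) j(1)] j(3) j0(3) by simp
        then have "V (e + b) = V (j0 * Suc m + b)" using V[OF j'(1) b j0(1) b] j'(2) by simp
        then show "w \<in> h ` {e\<in>E. V (e + lab (V e)) = V (j0 * Suc m + b)}"
          using e j(2,4) k h j'(2) by (intro image_eqI[of _ _ e]) simp_all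
      qed
      then have "card ((\<lambda>j. key j 0) ` {j. j < n \<and> lab (V (j * Suc m)) = b \<and> key j b = u})
        \<le> card (h ` {e\<in>E. V (e + lab (V e)) = V (j0 * Suc m + b)})"
        using finE by (intro card_mono) auto
      also have "\<dots> \<le> card {e\<in>E. V (e + lab (V e)) = V (j0 * Suc m + b)}"
        using finE by (intro card_image_le) auto
      finally show ?thesis using load le_trans by blast
    qed (simp only: image_empty card.empty zero_le)
  qed
  then show ?thesis using lab unfolding balanced_labels_def by blast
qed

text \<open>The binary digits of \<open>v\<close> are cut into blocks of length \<open>l\<close>. Block 0 is the mask of \<open>Y\<close>, and
  block \<open>b\<close> is the mask of the \<open>b\<close>-th candidate for \<open>X\<close>, which is intersected with \<open>Y\<close>.\<close>

definition bit_of :: "nat \<Rightarrow> nat \<Rightarrow> bool" where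
  "bit_of v c \<longleftrightarrow> v div 2 ^ c mod 2 \<noteq> 0"

definition block_key :: "nat \<Rightarrow> nat \<Rightarrow> (nat \<Rightarrow> nat) \<Rightarrow> nat \<Rightarrow> nat \<Rightarrow> nat list" where
  "block_key l z f v b = masked (\<lambda>c. bit_of v c \<and> bit_of v (b * l + c)) z f"

text \<open>Blocks are intersected with block 0, so a column that matters to block b is also
  compared in block 0. For this reason every number v is a meaningful mask.\<close>

lemma block_key_dep:
  "block_key l z f v 0 = block_key l z g v 0 \<Longrightarrow> block_key l z f v b = block_key l z g v b"
  unfolding block_key_def masked_def by (auto simp: map_eq_conv split: if_splits)

section \<open>One refinement, and its iteration over all masks\<close>

definition refine :: prog where
  "refine = decode ;; intern_projections ;; peel ;; update_classes"

lemma mods_refine [simp]: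
  "wr refine = {''u'', ''c'', ''h'', ''q'', ''t'', ''j'', ''bb'', ''b'', ''id'', ''x'', ''hh'', ''cnt'',
     ''r'', ''e'', ''g'', ''tt'', ''acc'', ''r2'', ''na'', ''y'', ''kk''}"
  "wa refine = {''dig'', ''vt'', ''base'', ''tab'', ''deg'', ''gg'', ''lab'', ''hist'', ''act'', ''cls''}"
  by (auto simp: refine_def)

definition refine_time :: "nat \<Rightarrow> nat \<Rightarrow> nat \<Rightarrow> nat \<Rightarrow> nat \<Rightarrow> int" where
  "refine_time n z l m tot = int (l * Suc m) * (int tot * 3 + 6) +
     int n * (int (Suc m) * (int z * 11 + 11) + int m * 28 + 122) + int (Suc m) * 3 + 23"

lemma runs_refine:
  assumes regs: "reg s ''z'' = z" "reg s ''n'' = n" "reg s ''m'' = m" "reg s ''m1'' = Suc m" "reg s ''l'' = l"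
      "reg s ''p'' = p" "reg s ''o'' = o'" "reg s ''kk'' = K" "reg s ''v'' = v" "reg s ''ba'' = 2"
      "reg s ''bn'' = l * Suc m"
    and zl: "z \<le> l" and m: "m \<ge> 1" and v: "v \<le> tot"
    and t: "trie_in s path" and pos: "0 < reg s ''mx''" and hist: "arr s ''hist'' = (\<lambda>_. 0)"
    and mx: "\<And>j c. j < n \<Longrightarrow> c < z \<Longrightarrow> Suc (arr s ''in'' (p + j * z + c)) < reg s ''mx''"
    and C: "arr s ''cls'' = C"
  shows "runs refine s (refine_time n z l m tot) (\<lambda>s'. (\<exists>path'. trie_in s' path') \<and> arr s' ''hist'' = (\<lambda>_. 0) \<and>
    reg s' ''kk'' = K * Suc m \<and> (\<forall>y. y < o' \<or> o' + n \<le> y \<longrightarrow> arr s' ''cls'' y = C y) \<and>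
    (\<exists>lab. balanced_labels n m (\<lambda>j. block_key l z (\<lambda>c. arr s ''in'' (p + j * z + c)) v) lab \<and>
      (\<forall>j<n. arr s' ''cls'' (o' + j) = C (o' + j) * Suc m + lab j)))"
  unfolding refine_def
proof (rule runs_Seq[OF runs_decode[OF regs(10) _ regs(11,9)]], goal_cases)
  case (2 s1)
  note P1 = 2(1) and f1 = frame_reg[OF 2(2)] frame_arr[OF 2(2)]
  define key where "key = (\<lambda>j. block_key l z (\<lambda>c. arr s ''in'' (p + j * z + c)) v)"
  define key1 where "key1 = (\<lambda>j b. masked (\<lambda>c. arr s1 ''dig'' c \<noteq> 0 \<and> arr s1 ''dig'' (b * l + c) \<noteq> 0) z
        (\<lambda>c. arr s1 ''in'' (p + j * z + c)))"
  have inp: "arr s1 ''in'' = arr s ''in''" using f1 by simp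
  have key1: "key1 j b = key j b" if "b < Suc m" for j b
  proof -
    have "b * l + c < l * Suc m" if "c < z" for c
    proof -
      have "b * l + c < Suc b * l" using that zl by simp
      also have "\<dots> \<le> Suc m * l" using \<open>b < Suc m\<close> by (intro mult_right_mono) auto
      finally show ?thesis by (simp add: mult.commute)
    qed
    moreover have "c < l * Suc m" if "c < z" for c
    proof -
      have "c < l * 1" using that zl by simp
      also have "\<dots> \<le> l * Suc m" by (intro mult_left_mono) auto
      finally show ?thesis .
    qed
    ultimately show ?thesis using P1 unfolding key1_def key_def block_key_def masked_def bit_of_def inp
      by (auto simp: map_eq_conv)
  qed
  have s1: "reg s1 ''z'' = z" "reg s1 ''n'' = n" "reg s1 ''m1'' = Suc m" "reg s1 ''l'' = l" "reg s1 ''p'' = p"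
    "trie_in s1 path" "0 < reg s1 ''mx''"
    using f1 regs t pos by simp_all
  have mx1: "Suc (arr s1 ''in'' (p + j * z + c)) < reg s1 ''mx''" if "j < n" "c < z" for j c
    using mx[OF that] f1 by simp
  have s1': "reg s1 ''m'' = m" "reg s1 ''o'' = o'" "reg s1 ''kk'' = K" "arr s1 ''cls'' = C"
    "arr s1 ''hist'' = (\<lambda>_. 0)"
    using f1 regs C hist by simp_all
  show ?case
  proof (rule runs_Seq[OF runs_intern_projections[OF s1(6,7,1-5) mx1 key1_def]], goal_cases)
    case (3 s2)
    note P2 = 3(1) and f2 = frame_reg[OF 3(2)] frame_arr[OF 3(2)]
    have s2: "reg s2 ''n'' = n" "reg s2 ''m1'' = Suc m" "reg s2 ''m'' = m" "arr s2 ''hist'' = (\<lambda>_. 0)"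
      "reg s2 ''o'' = o'" "reg s2 ''kk'' = K" "arr s2 ''cls'' = C"
      using f2 s1 s1' by simp_all
    let ?V = "arr s2 ''vt''"
    show ?case
    proof (rule runs_Seq[OF runs_peel[OF s2(1-3) refl s2(4) m]], goal_cases)
      case (1 s3)
      note f3 = frame_reg[OF 1(2)] frame_arr[OF 1(2)]
      obtain E where E: "E \<subseteq> (\<lambda>j. j * Suc m) ` {..<n}" "inj_on ?V E" "?V ` E = (\<lambda>j. ?V (j * Suc m)) ` {..<n}"
          "balanced_off ?V m E (arr s3 ''lab'') {}"
        using 1(1) by blast
      have hist3: "arr s3 ''hist'' = (\<lambda>_. 0)" using 1(1) by blast
      have bal: "balanced_labels n m key (\<lambda>j. arr s3 ''lab'' (?V (j * Suc m)))"
      proof (rule balanced_labelsI[OF _ _ E])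
        fix j b j' b' assume "j < n" "b \<le> m" "j' < n" "b' \<le> m"
        note a = this(1) le_imp_less_Suc[OF this(2)] this(3) le_imp_less_Suc[OF this(4)]
        show "?V (j * Suc m + b) = ?V (j' * Suc m + b') \<longleftrightarrow> key j b = key j' b'"
          using conjunct2[OF P2, rule_format, OF a] unfolding key1[OF a(2)] key1[OF a(4)] .
      next
        fix j j' b assume "key j 0 = key j' 0"
        then show "key j b = key j' b" unfolding key_def by (rule block_key_dep)
      qed
      have s3: "reg s3 ''n'' = n" "reg s3 ''m1'' = Suc m" "reg s3 ''o'' = o'" "reg s3 ''kk'' = K" "arr s3 ''cls'' = C"
        "arr s3 ''vt'' = ?V" "\<exists>path'. trie_in s3 path'"
        using f3 s2 P2 by simp_all
      show ?case
      proof (rule runs_mono[OF runs_update_classes[OF s3(1-5) refl s3(6)]], goal_cases)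
        case 1
        define N where "N = int (l * Suc m)"
        \<comment> \<open>The bound \<open>tot\<close> replaces the current mask number, so that all
          passes have the same budget.\<close>
        have "N * (int v * 3 + 6) \<le> N * (int tot * 3 + 6)" using v by (intro mult_left_mono) (simp_all add: N_def)
        then show ?case unfolding refine_time_def N_def[symmetric] by (simp add: algebra_simps)
      next
        case (2 s4)
        note f4 = frame_reg[OF 2(2)] frame_arr[OF 2(2)]
        have "\<exists>path'. trie_in s4 path'" "arr s4 ''hist'' = (\<lambda>_. 0)" using f4 s3(7) hist3 by simp_all
        then show ?case using 2(1) bal unfolding key_def by blast
      qed
    qed
  qed simp_all
qed simp

definition classify_atom :: prog where
  "classify_atom = Assign ''kk'' (Const 1) ;; For ''v'' ''tot'' refine"

lemma mods_classify_atom [simp]: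
  "wr classify_atom = {''u'', ''c'', ''h'', ''q'', ''t'', ''j'', ''bb'', ''b'', ''id'', ''x'', ''hh'', ''cnt'',
     ''r'', ''e'', ''g'', ''tt'', ''acc'', ''r2'', ''na'', ''y'', ''kk'', ''v''}"
  "wa classify_atom = {''dig'', ''vt'', ''base'', ''tab'', ''deg'', ''gg'', ''lab'', ''hist'', ''act'', ''cls''}"
  by (auto simp: classify_atom_def)

text \<open>The class number determines the label for every mask; nothing else is kept of the common
  refinement. The bound on the class numbers makes the number of combinations a function of the
  query.\<close>

definition classified :: "nat \<Rightarrow> nat \<Rightarrow> nat \<Rightarrow> nat \<Rightarrow> (nat \<Rightarrow> nat \<Rightarrow> nat) \<Rightarrow> nat \<Rightarrow> (nat \<Rightarrow> nat) \<Rightarrow> bool" where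
  "classified n m l z f tot C \<longleftrightarrow> (\<forall>j<n. C j < Suc m ^ tot) \<and>
    (\<forall>v<tot. \<exists>lab. balanced_labels n m (\<lambda>j. block_key l z (f j) v) lab \<and>
      (\<forall>j<n. \<forall>j'<n. C j = C j' \<longrightarrow> lab j = lab j'))"

lemma runs_classify_atom:
  assumes regs: "reg s ''z'' = z" "reg s ''n'' = n" "reg s ''m'' = m" "reg s ''m1'' = Suc m" "reg s ''l'' = l"
      "reg s ''p'' = p" "reg s ''o'' = o'" "reg s ''tot'' = tot" "reg s ''ba'' = 2" "reg s ''bn'' = l * Suc m"
    and zl: "z \<le> l" and m: "m \<ge> 1"
    and t: "\<exists>path. trie_in s path" and pos: "0 < reg s ''mx''" and hist: "arr s ''hist'' = (\<lambda>_. 0)"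
    and mx: "\<And>j c. j < n \<Longrightarrow> c < z \<Longrightarrow> Suc (arr s ''in'' (p + j * z + c)) < reg s ''mx''"
    and C: "\<And>y. y \<ge> o' \<Longrightarrow> arr s ''cls'' y = 0"
  shows "runs classify_atom s (int tot * (refine_time n z l m tot + 2) + 3) (\<lambda>s'.
    (\<exists>path'. trie_in s' path') \<and> arr s' ''hist'' = (\<lambda>_. 0) \<and> reg s' ''kk'' = Suc m ^ tot \<and>
    (\<forall>y. y < o' \<or> o' + n \<le> y \<longrightarrow> arr s' ''cls'' y = arr s ''cls'' y) \<and>
    classified n m l z (\<lambda>j c. arr s ''in'' (p + j * z + c)) tot (\<lambda>j. arr s' ''cls'' (o' + j)))"
proof -
  let ?f = "\<lambda>j c. arr s ''in'' (p + j * z + c)"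
  show ?thesis
    unfolding classify_atom_def runs_Seq_Assign
  proof (rule runs_For_const[where n = tot and c = "refine_time n z l m tot" and I = "\<lambda>v s'.
    (\<exists>path'. trie_in s' path') \<and> arr s' ''hist'' = (\<lambda>_. 0) \<and> reg s' ''kk'' = Suc m ^ v \<and>
    (\<forall>y. y < o' \<or> o' + n \<le> y \<longrightarrow> arr s' ''cls'' y = arr s ''cls'' y) \<and>
    (\<forall>j<n. arr s' ''cls'' (o' + j) < Suc m ^ v) \<and>
    (\<forall>v'<v. \<exists>lab. balanced_labels n m (\<lambda>j. block_key l z (?f j) v') lab \<and>
      (\<forall>j<n. \<forall>j'<n. arr s' ''cls'' (o' + j) = arr s' ''cls'' (o' + j') \<longrightarrow> lab j = lab j'))"], goal_cases)
    case (6 v s1)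
    note f = frame_reg[OF 6(4)] frame_arr[OF 6(4)] and v = 6(1,2) and P = 6(5)
    have s1: "reg s1 ''z'' = z" "reg s1 ''n'' = n" "reg s1 ''m'' = m" "reg s1 ''m1'' = Suc m" "reg s1 ''l'' = l"
      "reg s1 ''p'' = p" "reg s1 ''o'' = o'" "reg s1 ''kk'' = Suc m ^ v" "reg s1 ''v'' = v" "reg s1 ''ba'' = 2"
      "reg s1 ''bn'' = l * Suc m" "arr s1 ''in'' = arr s ''in''" "0 < reg s1 ''mx''" "arr s1 ''hist'' = (\<lambda>_. 0)"
      using f regs P v pos by simp_all
    have mx1: "Suc (arr s1 ''in'' (p + j * z + c)) < reg s1 ''mx''" if "j < n" "c < z" for j c
      using mx[OF that] f by simp
    obtain path where path: "trie_in s1 path" using P by blast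
    let ?C = "\<lambda>j. arr s1 ''cls'' (o' + j)"
    have Cv: "\<And>j. j < n \<Longrightarrow> ?C j < Suc m ^ v" using P by blast
    show ?case
    proof (rule runs_mono[OF runs_refine[OF s1(1-11) zl m less_imp_le[OF v(1)] path s1(13,14) mx1 refl]], goal_cases)
      case (4 s2)
      obtain lab where lab: "balanced_labels n m (\<lambda>j. block_key l z (?f j) v) lab"
        "\<And>j. j < n \<Longrightarrow> arr s2 ''cls'' (o' + j) = ?C j * Suc m + lab j"
        using 4(1) unfolding s1(12) by blast
      have labm: "\<And>j. j < n \<Longrightarrow> lab j < Suc m" using lab(1) by (simp add: balanced_labels_def less_Suc_eq_le)
      \<comment> \<open>Labels are below \<open>Suc m\<close>, so remainder and quotient recover the
        label and the old class from the packed number.\<close>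
      have eq: "?C j = ?C j' \<and> lab j = lab j'"
        if "j < n" "j' < n" "arr s2 ''cls'' (o' + j) = arr s2 ''cls'' (o' + j')" for j j'
      proof -
        have e: "lab j + ?C j * Suc m = lab j' + ?C j' * Suc m"
          using that(3) lab(2)[OF that(1)] lab(2)[OF that(2)] by (simp only: add.commute)
        have "(lab j + ?C j * Suc m) mod Suc m = lab j" "(lab j' + ?C j' * Suc m) mod Suc m = lab j'"
          using labm[OF that(1)] labm[OF that(2)] by (metis mod_less mod_mult_self1)+
        then have l: "lab j = lab j'" using e by simp
        then have "?C j * Suc m = ?C j' * Suc m" using e by linarith
        then have "?C j = ?C j'" by (metis mult_right_cancel Zero_not_Suc)
        then show ?thesis using l by blast
      qed
      have "\<exists>lab. balanced_labels n m (\<lambda>j. block_key l z (?f j) v') lab \<and>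
          (\<forall>j<n. \<forall>j'<n. arr s2 ''cls'' (o' + j) = arr s2 ''cls'' (o' + j') \<longrightarrow> lab j = lab j')"
        if "v' < Suc v" for v'
      proof (cases "v' = v")
        case True
        then show ?thesis using lab(1) eq by blast
      next
        case False
        then obtain lab' where "balanced_labels n m (\<lambda>j. block_key l z (?f j) v') lab'"
          "\<forall>j<n. \<forall>j'<n. ?C j = ?C j' \<longrightarrow> lab' j = lab' j'"
          using P \<open>v' < Suc v\<close> less_Suc_eq by metis
        then show ?thesis using eq by blast
      qed
      moreover have "arr s2 ''cls'' (o' + j) < Suc m ^ Suc v" if "j < n" for j
      proof -
        have "arr s2 ''cls'' (o' + j) < Suc (?C j) * Suc m" using lab(2)[OF that] labm[OF that] by simp
        also have "\<dots> \<le> Suc m ^ v * Suc m" using Cv[OF that] by (intro mult_right_mono) auto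
        finally show ?thesis by (simp add: mult.commute)
      qed
      moreover have "\<exists>path'. trie_in s2 path'" "arr s2 ''hist'' = (\<lambda>_. 0)" "reg s2 ''kk'' = Suc m ^ Suc v"
        using 4(1) by (blast, blast, simp add: mult.commute)
      moreover have "\<forall>y. y < o' \<or> o' + n \<le> y \<longrightarrow> arr s2 ''cls'' y = arr s ''cls'' y"
        using 4(1) P by metis
      ultimately show ?case by simp
    qed simp_all
  next
    case (8 s1)
    then show ?case unfolding classified_def by blast
  next
    case 5
    show ?case using t hist C by simp
  qed (use regs in simp_all)
qed

section \<open>Running a program as a subroutine\<close>

text \<open>All names of the program are prefixed with \<open>A\<close>. For each array, the addresses of its stores are
  logged, so that the memory can be cleared in time proportional to the running time.\<close>

abbreviation sub_name :: "string \<Rightarrow> string" where "sub_name x \<equiv> CHR ''A'' # x"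
abbreviation log_name :: "string \<Rightarrow> string" where "log_name x \<equiv> CHR ''L'' # x"

fun sub_expr :: "expr \<Rightarrow> expr" where
  "sub_expr (Const n) = Const n"
| "sub_expr (Reg x) = Reg (sub_name x)"
| "sub_expr (Arr a e) = Arr (sub_name a) (sub_expr e)"
| "sub_expr (Add e e') = Add (sub_expr e) (sub_expr e')"
| "sub_expr (Sub e e') = Sub (sub_expr e) (sub_expr e')"

text \<open>The address is logged ahead of the store, while its expression still has the old value.
  One store becomes three steps, which is where the factor 3 in \<open>exec_logged\<close> comes
  from.\<close>

fun logged :: "prog \<Rightarrow> prog" where
  "logged Skip = Skip"
| "logged (Assign x e) = Assign (sub_name x) (sub_expr e)"
| "logged (Store a e e') =
    Store (log_name a) (Reg (log_name a)) (sub_expr e) ;;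
    Assign (log_name a) (Add (Reg (log_name a)) (Const 1)) ;;
    Store (sub_name a) (sub_expr e) (sub_expr e')"
| "logged (Seq p q) = Seq (logged p) (logged q)"
| "logged (If b p q) = If (sub_expr b) (logged p) (logged q)"
| "logged (While b p) = While (sub_expr b) (logged p)"

lemma wr_logged: "wr (logged p) = sub_name ` wr p \<union> log_name ` wa p"
  by (induction p) (simp_all add: image_Un Un_ac)

lemma wa_logged: "wa (logged p) = sub_name ` wa p \<union> log_name ` wa p"
  by (induction p) (simp_all add: image_Un Un_ac insert_commute)

lemma finite_wr: "finite (wr p)" and finite_wa: "finite (wa p)"
  by (induction p) auto

definition simulates :: "state \<Rightarrow> state \<Rightarrow> bool" where
  "simulates s s' \<longleftrightarrow> (\<forall>x. reg s' (sub_name x) = reg s x) \<and> (\<forall>a. arr s' (sub_name a) = arr s a)"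

lemma val_sub_expr: "simulates s s' \<Longrightarrow> val (sub_expr e) s' = val e s"
  by (induction e) (auto simp: simulates_def)

text \<open>\<open>s\<close> and \<open>s1\<close> are states of the original program, \<open>s'\<close> and \<open>s1'\<close> those of the simulation.\<close>

definition logs :: "nat \<Rightarrow> state \<Rightarrow> state \<Rightarrow> state \<Rightarrow> state \<Rightarrow> bool" where
  "logs t s s' s1 s1' \<longleftrightarrow> (\<forall>a. reg s' (log_name a) \<le> reg s1' (log_name a) \<and>
    reg s1' (log_name a) \<le> reg s' (log_name a) + t \<and>
    (\<forall>k<reg s' (log_name a). arr s1' (log_name a) k = arr s' (log_name a) k) \<and>
    (\<forall>i. arr s1 a i \<noteq> arr s a i \<longrightarrow> (\<exists>k<reg s1' (log_name a). arr s1' (log_name a) k = i)))"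

lemma logs_refl: "logs t s s' s s'" by (simp add: logs_def)

lemma logs_trans:
  assumes "logs t s s' s1 s1'" "logs u s1 s1' s2 s2'"
  shows "logs (t + u) s s' s2 s2'"
  unfolding logs_def
proof (intro allI conjI impI)
  fix a
  have 1: "reg s' (log_name a) \<le> reg s1' (log_name a)" "reg s1' (log_name a) \<le> reg s' (log_name a) + t"
    "\<And>k. k < reg s' (log_name a) \<Longrightarrow> arr s1' (log_name a) k = arr s' (log_name a) k"
    "\<And>i. arr s1 a i \<noteq> arr s a i \<Longrightarrow> \<exists>k<reg s1' (log_name a). arr s1' (log_name a) k = i"
    using assms(1) unfolding logs_def by blast+
  have 2: "reg s1' (log_name a) \<le> reg s2' (log_name a)" "reg s2' (log_name a) \<le> reg s1' (log_name a) + u"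
    "\<And>k. k < reg s1' (log_name a) \<Longrightarrow> arr s2' (log_name a) k = arr s1' (log_name a) k"
    "\<And>i. arr s2 a i \<noteq> arr s1 a i \<Longrightarrow> \<exists>k<reg s2' (log_name a). arr s2' (log_name a) k = i"
    using assms(2) unfolding logs_def by blast+
  show "reg s' (log_name a) \<le> reg s2' (log_name a)" using 1(1) 2(1) by simp
  show "reg s2' (log_name a) \<le> reg s' (log_name a) + (t + u)" using 1(2) 2(2) by simp
  show "arr s2' (log_name a) k = arr s' (log_name a) k" if "k < reg s' (log_name a)" for k
    using that 1(1,3) 2(3) by simp
  show "\<exists>k<reg s2' (log_name a). arr s2' (log_name a) k = i" if "arr s2 a i \<noteq> arr s a i" for i
  proof (cases "arr s2 a i = arr s1 a i")
    case True
    then have "arr s1 a i \<noteq> arr s a i" using that by simp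
    then obtain k where "k < reg s1' (log_name a)" "arr s1' (log_name a) k = i" using 1(4) by blast
    then show ?thesis using 2(1,3) by (intro exI[of _ k]) simp
  qed (use 2(4) in blast)
qed

lemma logs_mono: "logs t s s' s1 s1' \<Longrightarrow> t \<le> u \<Longrightarrow> logs u s s' s1 s1'"
  unfolding logs_def by (meson add_le_mono le_refl le_trans)

lemma exec_logged:
  assumes "exec p s t s1" "simulates s s'"
  shows "\<exists>u s1'. exec (logged p) s' u s1' \<and> u \<le> 3 * t \<and> simulates s1 s1' \<and> logs t s s' s1 s1'"
  using assms
proof (induction arbitrary: s' rule: exec.induct)
  case (Skip s)
  then show ?case by (intro exI[of _ 1] exI[of _ s']) (simp add: exec_Skip logs_refl)
next
  case (Assign x e s)
  then show ?case
    by (simp add: exec_Assign val_sub_expr) (simp add: simulates_def logs_def)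
next
  case (Store a e e' s)
  let ?s1 = "s'\<lparr>arr := (arr s')(log_name a := (arr s' (log_name a))(reg s' (log_name a) := val e s)),
    reg := (reg s')(log_name a := Suc (reg s' (log_name a)))\<rparr>"
  have sim: "simulates s ?s1" using Store by (simp add: simulates_def)
  let ?s2 = "?s1\<lparr>arr := (arr ?s1)(sub_name a := (arr ?s1 (sub_name a))(val e s := val e' s))\<rparr>"
  have "exec (logged (Store a e e')) s' 3 ?s2"
    using val_sub_expr[OF sim] val_sub_expr[OF Store]
    by (simp add: exec_Seq exec_Assign exec_Store)
  moreover have "simulates (s\<lparr>arr := (arr s)(a := (arr s a)(val e s := val e' s))\<rparr>) ?s2"
    using Store by (simp add: simulates_def)
  moreover have "logs 1 s s' (s\<lparr>arr := (arr s)(a := (arr s a)(val e s := val e' s))\<rparr>) ?s2"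
    by (auto simp: logs_def)
  ultimately show ?case by (intro exI[of _ 3] exI[of _ ?s2]) simp
next
  case (Seq p s t s1 q t' s2)
  obtain u s1' where 1: "exec (logged p) s' u s1'" "u \<le> 3 * t" "simulates s1 s1'" "logs t s s' s1 s1'"
    using Seq.IH(1)[OF Seq.prems] by blast
  obtain u' s2' where 2: "exec (logged q) s1' u' s2'" "u' \<le> 3 * t'" "simulates s2 s2'" "logs t' s1 s1' s2 s2'"
    using Seq.IH(2)[OF 1(3)] by blast
  show ?case
    using exec.Seq[OF 1(1) 2(1)] 1(2) 2(2,3) logs_trans[OF 1(4) 2(4)]
    by (intro exI[of _ "u + u'"] exI[of _ s2']) simp
next
  case (If_true b s p t s1 q)
  obtain u s1' where 1: "exec (logged p) s' u s1'" "u \<le> 3 * t" "simulates s1 s1'" "logs t s s' s1 s1'"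
    using If_true.IH[OF If_true.prems] by blast
  then show ?case
    using If_true.hyps(1) val_sub_expr[OF If_true.prems] logs_mono[OF 1(4), of "t + 1"]
    by (intro exI[of _ "u + 1"] exI[of _ s1']) (simp add: exec_If)
next
  case (If_false b s q t s1 p)
  obtain u s1' where 1: "exec (logged q) s' u s1'" "u \<le> 3 * t" "simulates s1 s1'" "logs t s s' s1 s1'"
    using If_false.IH[OF If_false.prems] by blast
  then show ?case
    using If_false.hyps(1) val_sub_expr[OF If_false.prems] logs_mono[OF 1(4), of "t + 1"]
    by (intro exI[of _ "u + 1"] exI[of _ s1']) (simp add: exec_If)
next
  case (While_true b s p t s1 t' s2)
  obtain u s1' where 1: "exec (logged p) s' u s1'" "u \<le> 3 * t" "simulates s1 s1'" "logs t s s' s1 s1'"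
    using While_true.IH(1)[OF While_true.prems] by blast
  obtain u' s2' where 2: "exec (logged (While b p)) s1' u' s2'" "u' \<le> 3 * t'" "simulates s2 s2'"
      "logs t' s1 s1' s2 s2'"
    using While_true.IH(2)[OF 1(3)] by blast
  have "val (sub_expr b) s' \<noteq> 0" using While_true.hyps(1) val_sub_expr[OF While_true.prems] by simp
  from exec.While_true[OF this 1(1) 2(1)[simplified]] show ?case
    using 1(2) 2(2,3) logs_mono[OF logs_trans[OF 1(4) 2(4)], of "t + t' + 1"]
    by (intro exI[of _ "u + u' + 1"] exI[of _ s2']) simp
next
  case (While_false b s p)
  then show ?case using val_sub_expr[OF While_false.prems]
    by (intro exI[of _ 1] exI[of _ s']) (simp add: exec.While_false logs_refl exec_While)
qed

section \<open>Restoring the memory after a run\<close>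

definition clean_array :: "string \<Rightarrow> prog" where
  "clean_array a = While (Reg (log_name a))
     (Assign (log_name a) (Sub (Reg (log_name a)) (Const 1)) ;;
      Store (sub_name a) (Arr (log_name a) (Reg (log_name a))) (Const 0))"

fun clean_arrays :: "string list \<Rightarrow> prog" where
  "clean_arrays [] = Skip"
| "clean_arrays (a # as) = clean_array a ;; clean_arrays as"

fun clean_regs :: "string list \<Rightarrow> prog" where
  "clean_regs [] = Skip"
| "clean_regs (x # xs) = Assign (sub_name x) (Const 0) ;; clean_regs xs"

text \<open>The cleanup is itself a program text, so the names it treats are put in a list. The list
  is picked by choice and may contain repetitions.\<close>

definition arrays :: "prog \<Rightarrow> string list" where "arrays p = (SOME as. set as = wa p)"
definition regs :: "prog \<Rightarrow> string list" where "regs p = (SOME xs. set xs = wr p)"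

lemma set_arrays [simp]: "set (arrays p) = wa p" and set_regs [simp]: "set (regs p) = wr p"
  unfolding arrays_def regs_def by (metis (mono_tags) finite_list finite_wa finite_wr someI_ex)+

definition cleanup :: "prog \<Rightarrow> prog" where
  "cleanup p = clean_arrays (arrays p) ;; clean_regs (regs p)"

lemma mods_clean_array: "wr (clean_array a) = {log_name a}" "wa (clean_array a) = {sub_name a}"
  by (auto simp: clean_array_def)

lemma mods_clean_arrays: "wr (clean_arrays as) = log_name ` set as" "wa (clean_arrays as) = sub_name ` set as"
  by (induction as) (auto simp: mods_clean_array)

lemma mods_clean_regs: "wr (clean_regs xs) = sub_name ` set xs" "wa (clean_regs xs) = {}"
  by (induction xs) auto

lemma mods_cleanup: "wr (cleanup p) = log_name ` wa p \<union> sub_name ` wr p" "wa (cleanup p) = sub_name ` wa p"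
  by (auto simp: cleanup_def mods_clean_arrays mods_clean_regs)

lemma not_in_mods [simp]:
  assumes "c \<noteq> CHR ''A''" "c \<noteq> CHR ''L''"
  shows "c # x \<notin> wr (logged p)" "c # x \<notin> wa (logged p)" "c # x \<notin> wr (cleanup p)" "c # x \<notin> wa (cleanup p)"
  using assms by (auto simp: wr_logged wa_logged mods_cleanup)

lemma runs_clean_array:
  "runs (clean_array a) s (int (reg s (log_name a)) * 3 + 1) (\<lambda>s'. reg s' (log_name a) = 0 \<and>
    (\<forall>i. arr s' (sub_name a) i = (if \<exists>k<reg s (log_name a). arr s (log_name a) k = i then 0
      else arr s (sub_name a) i)))"
proof (induction "reg s (log_name a)" arbitrary: s)
  case 0
  then show ?case unfolding clean_array_def by (intro runs_While_0) simp_all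
next
  case (Suc n)
  let ?s = "s\<lparr>reg := (reg s)(log_name a := n),
    arr := (arr s)(sub_name a := (arr s (sub_name a))(arr s (log_name a) n := 0))\<rparr>"
  show ?case unfolding clean_array_def
  proof (rule runs_While_step[where T' = 2 and P' = "\<lambda>s'. s' = ?s"], goal_cases)
    case (3 s1)
    show ?case unfolding 3(1) clean_array_def[symmetric]
    proof (rule runs_mono[OF Suc.hyps(1)], goal_cases)
      case (3 s2)
      then show ?case unfolding Suc.hyps(2)[symmetric] by (auto simp: less_Suc_eq)
    qed (simp_all add: Suc.hyps(2)[symmetric])
  qed (simp_all add: Suc.hyps(2)[symmetric])
qed

text \<open>The postcondition is a disjunction because \<open>as\<close> may list an array twice:
  the second pass meets an empty log and keeps the zeros.\<close>

lemma runs_clean_arrays: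
  assumes "\<And>a. reg s (log_name a) \<le> t"
  shows "runs (clean_arrays as) s (int (length as) * (int t * 3 + 1) + 1) (\<lambda>s'. \<forall>a\<in>set as.
    reg s' (log_name a) = 0 \<and> (\<forall>i. arr s' (sub_name a) i = 0 \<or> arr s' (sub_name a) i = arr s (sub_name a) i \<and>
      \<not> (\<exists>k<reg s (log_name a). arr s (log_name a) k = i)))"
  using assms
proof (induction as arbitrary: s)
  case Nil then show ?case by simp
next
  case (Cons a as)
  show ?case unfolding clean_arrays.simps
  proof (rule runs_Seq[OF runs_clean_array], goal_cases)
    case (1 s1)
    note P1 = 1(1) and f1 = frame_reg[OF 1(2)] frame_arr[OF 1(2)]
    have same: "reg s1 (log_name b) = reg s (log_name b)" "arr s1 (sub_name b) = arr s (sub_name b)" if "b \<noteq> a" for b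
      using f1 that by (simp_all add: mods_clean_array)
    have log: "arr s1 (log_name b) = arr s (log_name b)" for b using f1 by (simp add: mods_clean_array)
    have le: "reg s1 (log_name b) \<le> t" for b using P1 same Cons.prems by (cases "b = a") simp_all
    show ?case
    proof (rule runs_mono[OF Cons.IH[OF le]], goal_cases)
      case 1
      have "int (reg s (log_name a)) \<le> int t" using Cons.prems by simp
      then show ?case by (simp add: algebra_simps)
    next
      case (2 s2)
      note P2 = 2(1) and f2 = frame_reg[OF 2(2)] frame_arr[OF 2(2)]
      show ?case
      proof
        fix b assume b: "b \<in> set (a # as)"
        show "reg s2 (log_name b) = 0 \<and> (\<forall>i. arr s2 (sub_name b) i = 0 \<or>
          arr s2 (sub_name b) i = arr s (sub_name b) i \<and> \<not> (\<exists>k<reg s (log_name b). arr s (log_name b) k = i))"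
        proof (cases "b \<in> set as")
          case in_as: True
          show ?thesis
          proof (cases "b = a")
            case True
            then show ?thesis using P2[rule_format, OF in_as] P1 by metis
          next
            case False
            then show ?thesis using P2[rule_format, OF in_as] same[OF False] log by simp
          qed
        next
          case False
          then have "b = a" using b by simp
          moreover have "reg s2 (log_name b) = reg s1 (log_name b)" "arr s2 (sub_name b) = arr s1 (sub_name b)"
            using f2 False by (auto simp: mods_clean_arrays)
          ultimately show ?thesis using P1 by simp
        qed
      qed
    qed
  qed
qed

lemma runs_clean_regs:
  "runs (clean_regs xs) s (int (length xs) + 1) (\<lambda>s'. \<forall>x\<in>set xs. reg s' (sub_name x) = 0)"
proof (induction xs arbitrary: s)
  case (Cons x xs)
  have "runs (clean_regs xs) (s\<lparr>reg := (reg s)(sub_name x := 0)\<rparr>) (int (length xs) + 1)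
    (\<lambda>s'. \<forall>y\<in>set (x # xs). reg s' (sub_name y) = 0)"
  proof (rule runs_mono[OF Cons.IH order_refl], goal_cases)
    case (1 s')
    then show ?case using frame_reg[OF 1(2), of "sub_name x"] by (auto simp: mods_clean_regs)
  qed
  then show ?case by (simp add: add.commute)
qed simp

text \<open>The array \<open>in\<close> of the subroutine is left out, as it is filled anew for each
  run.\<close>

definition pristine :: "state \<Rightarrow> bool" where
  "pristine s \<longleftrightarrow> (\<forall>x. reg s (sub_name x) = 0 \<and> reg s (log_name x) = 0) \<and>
    (\<forall>a. a \<noteq> ''in'' \<longrightarrow> arr s (sub_name a) = (\<lambda>_. 0))"

lemma pristine_cong:
  assumes "pristine s" "\<And>x. reg s' (sub_name x) = reg s (sub_name x)" "\<And>x. reg s' (log_name x) = reg s (log_name x)"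
    "\<And>a. a \<noteq> ''in'' \<Longrightarrow> arr s' (sub_name a) = arr s (sub_name a)"
  shows "pristine s'"
  using assms unfolding pristine_def by simp

text \<open>This describes the moment between a run and its cleanup: \<open>s\<close> carries the
  final state \<open>s1\<close> of the subroutine, and every cell in which \<open>s1\<close> departs
  from the input is on a log of length at most \<open>t\<close>.\<close>

definition dirty :: "prog \<Rightarrow> nat list \<Rightarrow> nat \<Rightarrow> state \<Rightarrow> state \<Rightarrow> bool" where
  "dirty p w t s1 s \<longleftrightarrow> simulates s1 s \<and> (\<forall>a. reg s (log_name a) \<le> t) \<and>
    (\<forall>a. a \<notin> wa p \<longrightarrow> reg s (log_name a) = 0 \<and> arr s1 a = arr (input_state w) a) \<and>
    (\<forall>x. x \<notin> wr p \<longrightarrow> reg s1 x = 0) \<and>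
    (\<forall>a i. arr s1 a i \<noteq> arr (input_state w) a i \<longrightarrow> (\<exists>k<reg s (log_name a). arr s (log_name a) k = i))"

lemma runs_logged:
  assumes p: "pristine s" and inp: "arr s ''Ain'' = arr (input_state w) ''in''"
    and e: "exec p (input_state w) t s1"
  shows "runs (logged p) s (3 * int t) (dirty p w t s1)"
proof -
  have "simulates (input_state w) s"
  proof -
    have "arr s (sub_name a) = arr (input_state w) a" for a
      using p inp by (cases "a = ''in''") (simp_all add: pristine_def input_state_def)
    moreover have "reg s (sub_name x) = reg (input_state w) x" for x
      using p by (simp add: pristine_def input_state_def)
    ultimately show ?thesis by (simp add: simulates_def)
  qed
  from exec_logged[OF e this] obtain u s' where
    1: "exec (logged p) s u s'" "u \<le> 3 * t" "simulates s1 s'" "logs t (input_state w) s s1 s'" by blast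
  note f = frame_reg[OF frame_exec[OF 1(1)]] and g = frame_reg[OF frame_exec[OF e]] frame_arr[OF frame_exec[OF e]]
  have l: "reg s (log_name a) = 0" for a using p by (simp add: pristine_def)
  have "dirty p w t s1 s'" unfolding dirty_def
  proof (intro conjI allI impI)
    fix a show "reg s' (log_name a) \<le> t" using 1(4) l[of a] unfolding logs_def by (metis add_0)
  next
    fix a assume "a \<notin> wa p"
    then show "reg s' (log_name a) = 0" using f[of "log_name a"] l by (auto simp: wr_logged)
  next
    fix a i assume "arr s1 a i \<noteq> arr (input_state w) a i"
    then show "\<exists>k<reg s' (log_name a). arr s' (log_name a) k = i" using 1(4) unfolding logs_def by blast
  next
    fix x assume "x \<notin> wr p"
    then show "reg s1 x = 0" using g(1) by (simp add: input_state_def)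
  qed (use 1(3) g(2) in simp_all)
  then show ?thesis using 1(1,2) unfolding runs_def by force
qed

text \<open>Logged cells become 0 and all others still hold the input, so everything beyond the
  input word is 0. The cells of the word itself are left to \<open>wipe_input\<close>.\<close>

lemma runs_cleanup:
  assumes d: "dirty p w t s1 s"
  shows "runs (cleanup p) s (int (length (arrays p)) * (int t * 3 + 1) + int (length (regs p)) + 2)
    (\<lambda>s'. pristine s' \<and> (\<forall>i\<ge>length w. arr s' ''Ain'' i = 0))"
  unfolding cleanup_def
proof (rule runs_Seq[OF runs_clean_arrays[where t = t]], goal_cases)
  case (1 a) then show ?case using d by (simp add: dirty_def)
next
  case (2 s2)
  note P2 = 2(1) and f2 = frame_reg[OF 2(2)] frame_arr[OF 2(2)]
  have d': "\<And>a. arr s (sub_name a) = arr s1 a" "\<And>x. reg s (sub_name x) = reg s1 x"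
    "\<And>a. a \<notin> wa p \<Longrightarrow> reg s (log_name a) = 0 \<and> arr s1 a = arr (input_state w) a" "\<And>x. x \<notin> wr p \<Longrightarrow> reg s1 x = 0"
    "\<And>a i. arr s1 a i \<noteq> arr (input_state w) a i \<Longrightarrow> (\<exists>k<reg s (log_name a). arr s (log_name a) k = i)"
    using d unfolding dirty_def simulates_def by blast+
  have arr2: "arr s2 (sub_name a) i = 0 \<or> arr s2 (sub_name a) i = arr (input_state w) a i" for a i
  proof (cases "a \<in> wa p")
    case True
    then show ?thesis using P2 d'(1,5) by (metis set_arrays)
  next
    case False
    then have "arr s2 (sub_name a) = arr s (sub_name a)" using f2 by (auto simp: mods_clean_arrays)
    then show ?thesis using d'(1,3) False by simp
  qed
  have log2: "reg s2 (log_name a) = 0" for a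
  proof (cases "a \<in> wa p")
    case True
    then show ?thesis using P2 by simp
  next
    case False
    then have "reg s2 (log_name a) = reg s (log_name a)" using f2 by (auto simp: mods_clean_arrays)
    then show ?thesis using d'(3) False by simp
  qed
  show ?case
  proof (rule runs_mono[OF runs_clean_regs], goal_cases)
    case 1 show ?case by simp
  next
    case (2 s3)
    note P3 = 2(1) and f3 = frame_reg[OF 2(2)] frame_arr[OF 2(2)]
    have "reg s3 (sub_name x) = 0" for x
    proof (cases "x \<in> wr p")
      case True
      then show ?thesis using P3 by simp
    next
      case False
      then have "sub_name x \<notin> log_name ` wa p" "sub_name x \<notin> sub_name ` wr p" by auto
      then have "reg s3 (sub_name x) = reg s (sub_name x)"
        using f2(1)[of "sub_name x"] f3(1)[of "sub_name x"] by (simp add: mods_clean_arrays mods_clean_regs)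
      then show ?thesis using d'(2,4) False by simp
    qed
    moreover have "reg s3 (log_name x) = 0" for x
    proof -
      have "log_name x \<notin> sub_name ` wr p" by auto
      then show ?thesis using f3(1)[of "log_name x"] log2 by (simp add: mods_clean_regs)
    qed
    moreover have a3: "arr s3 = arr s2" using f3(2) by (simp add: mods_clean_regs fun_eq_iff)
    moreover have "arr s2 (sub_name a) = (\<lambda>_. 0)" if "a \<noteq> ''in''" for a
      using arr2[of a] that by (auto simp: input_state_def)
    moreover have "arr s2 ''Ain'' i = 0" if "i \<ge> length w" for i
      using arr2[of "''in''" i] that by (auto simp: input_state_def)
    ultimately show ?case unfolding pristine_def by simp
  qed
qed

section \<open>Memory layout of the input\<close>

definition array_of :: "nat list \<Rightarrow> nat \<Rightarrow> nat" where
  "array_of w = (\<lambda>j. if j < length w then w ! j else 0)"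

lemma array_of_Nil: "array_of [] = (\<lambda>_. 0)"
  by (simp add: array_of_def)

lemma array_of_snoc: "(array_of xs)(length xs := v) = array_of (xs @ [v])"
  by (auto simp: array_of_def fun_eq_iff nth_append)

text \<open>Serves to fill in a tuple count after the tuples that follow it have been
  written.\<close>

lemma array_of_patch: "(array_of (xs @ x # ys))(length xs := v) = array_of (xs @ v # ys)"
  by (auto simp: array_of_def fun_eq_iff nth_append nth_Cons')

lemma array_of_append: "array_of (xs @ ys) (length xs + j) = array_of ys j"
  by (auto simp: array_of_def nth_append)

lemma array_of_nth: "j < length xs \<Longrightarrow> array_of xs j = xs ! j"
  by (simp add: array_of_def)

lemma input_state_in: "arr (input_state w) ''in'' = array_of w"
  by (simp add: input_state_def array_of_def)

lemma length_concat_upt: "length (concat (map f [0..<k])) = (\<Sum>i<k. length (f i))"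
  by (induction k) auto

lemma concat_upt_split:
  assumes "i < k"
  shows "concat (map f [0..<k]) = concat (map f [0..<i]) @ f i @ concat (map f [Suc i..<k])"
proof -
  have "[0..<k] = [0..<i] @ i # [Suc i..<k]"
    using upt_add_eq_append[of 0 i "k - i"] upt_conv_Cons[OF assms] assms by simp
  then show ?thesis by simp
qed

lemma array_of_concat:
  assumes "i < k" "j < length (f i)"
  shows "array_of (concat (map f [0..<k])) ((\<Sum>i'<i. length (f i')) + j) = f i ! j"
  unfolding concat_upt_split[OF assms(1), of f] length_concat_upt[symmetric] array_of_append
  using assms(2) by (simp add: array_of_def nth_append)

lemma length_encode_tuple [simp]: "finite Z \<Longrightarrow> length (encode_tuple Z t) = card Z"
  by (simp add: encode_tuple_def)

lemma encode_query_alt: "encode_query Q =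
    length Q # concat (map (\<lambda>i. card (Q ! i) # sorted_list_of_set (Q ! i)) [0..<length Q])"
proof -
  have "map (\<lambda>Z. card Z # sorted_list_of_set Z) Q
      = map (\<lambda>i. card (Q ! i) # sorted_list_of_set (Q ! i)) [0..<length Q]"
    by (intro nth_equalityI) simp_all
  then show ?thesis by (simp only: encode_query_def)
qed

section \<open>Addresses in the encoded input\<close>

locale query =
  fixes Q :: query
  assumes Q: "is_query Q"
begin

abbreviation "k \<equiv> length Q"
definition width :: "nat \<Rightarrow> nat" where "width i = card (Q ! i)"
text \<open>Address of the arity of atom i; cell 0 is taken by the number of atoms.\<close>

definition qpos :: "nat \<Rightarrow> nat" where "qpos i = 1 + (\<Sum>i'<i. Suc (width i'))"
definition qlen :: nat where "qlen = length (encode_query Q)"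

lemma finite_atom: "i < k \<Longrightarrow> finite (Q ! i)"
  using Q by (auto simp: is_query_def)

lemma finite_vars: "finite (vars Q)"
  using Q by (auto simp: is_query_def vars_def)

lemma qlen: "qlen = qpos k"
proof -
  have "(\<Sum>i<k. length (card (Q ! i) # sorted_list_of_set (Q ! i))) = (\<Sum>i<k. Suc (width i))"
    using finite_atom by (intro sum.cong) (auto simp: width_def)
  then show ?thesis by (simp add: qlen_def qpos_def encode_query_alt length_concat_upt)
qed

text \<open>The block length \<open>l\<close> of the masks has to bound every arity. The length of
  the query encoding does, and parsing yields it at no extra cost.\<close>

lemma width_le_qlen: "i < k \<Longrightarrow> width i \<le> qlen"
proof -
  assume "i < k"
  then have "Suc (width i) \<le> (\<Sum>i<k. Suc (width i))" by (intro member_le_sum) auto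
  then show ?thesis by (simp add: qlen qpos_def)
qed

lemma query_word:
  shows "array_of (encode_query Q) 0 = k"
    and "i < k \<Longrightarrow> array_of (encode_query Q) (qpos i) = width i"
    and "i < k \<Longrightarrow> j < width i \<Longrightarrow> array_of (encode_query Q) (Suc (qpos i) + j) = sorted_list_of_set (Q ! i) ! j"
proof -
  let ?f = "\<lambda>i. card (Q ! i) # sorted_list_of_set (Q ! i)"
  have e: "encode_query Q = [k] @ concat (map ?f [0..<k])" by (simp add: encode_query_alt)
  show "array_of (encode_query Q) 0 = k" by (simp add: e array_of_def)
  assume i: "i < k"
  have s: "(\<Sum>i'<i. length (?f i')) = (\<Sum>i'<i. Suc (width i'))"
    using i finite_atom by (intro sum.cong) (auto simp: width_def)
  have *: "array_of (encode_query Q) (qpos i + j) = ?f i ! j" if "j < length (?f i)" for j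
    using array_of_append[of "[k]" "concat (map ?f [0..<k])" "(\<Sum>i'<i. Suc (width i')) + j"]
      array_of_concat[where f = ?f, OF i that] s by (simp add: e qpos_def)
  show "array_of (encode_query Q) (qpos i) = width i" using *[of 0] by (simp add: width_def)
  show "array_of (encode_query Q) (Suc (qpos i) + j) = sorted_list_of_set (Q ! i) ! j" if "j < width i"
    using *[of "Suc j"] that i finite_atom by (simp add: width_def)
qed

text \<open>Address of the tuple count of relation i; its tuples start one cell later.\<close>

definition rpos :: "(nat \<Rightarrow> tuple list) \<Rightarrow> nat \<Rightarrow> nat" where
  "rpos L i = qlen + (\<Sum>i'<i. Suc (length (L i') * width i'))"

lemma rpos_Suc: "rpos L (Suc i) = Suc (rpos L i) + length (L i) * width i"
  by (simp add: rpos_def)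

lemma length_encode_tuples:
  "i < k \<Longrightarrow> length (concat (map (encode_tuple (Q ! i)) ts)) = length ts * width i"
  using finite_atom by (induction ts) (auto simp: width_def)

lemma length_encode_relation: "i < k \<Longrightarrow> length (encode_relation (Q ! i) ts) = Suc (length ts * width i)"
  by (simp add: encode_relation_def length_encode_tuples)

lemma input_word:
  shows "j < qlen \<Longrightarrow> array_of (encode_input Q L) j = array_of (encode_query Q) j"
    and "i < k \<Longrightarrow> array_of (encode_input Q L) (rpos L i) = length (L i)"
    and "i < k \<Longrightarrow> j < length (L i) \<Longrightarrow> c < width i \<Longrightarrow>
      array_of (encode_input Q L) (Suc (rpos L i) + j * width i + c) = encode_tuple (Q ! i) (L i ! j) ! c"
proof -
  show "array_of (encode_input Q L) j = array_of (encode_query Q) j" if "j < qlen"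
    using that by (simp add: encode_input_def array_of_def nth_append qlen_def)
  assume i: "i < k"
  let ?f = "\<lambda>i. encode_relation (Q ! i) (L i)"
  have s: "(\<Sum>i'<i. length (?f i')) = (\<Sum>i'<i. Suc (length (L i') * width i'))"
    using i by (intro sum.cong) (auto simp: length_encode_relation)
  have *: "array_of (encode_input Q L) (rpos L i + j) = ?f i ! j" if "j < length (?f i)" for j
    using array_of_append[of "encode_query Q" "concat (map ?f [0..<k])" "(\<Sum>i'<i. Suc (length (L i') * width i')) + j"]
      array_of_concat[where f = ?f, OF i that] s by (simp add: rpos_def qlen_def encode_input_def add.assoc)
  show "array_of (encode_input Q L) (rpos L i) = length (L i)"
    using *[of 0] by (simp add: encode_relation_def)
  show "array_of (encode_input Q L) (Suc (rpos L i) + j * width i + c) = encode_tuple (Q ! i) (L i ! j) ! c"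
    if j: "j < length (L i)" and c: "c < width i"
  proof -
    have "j * width i + c < Suc j * width i" using c by simp
    also have "\<dots> \<le> length (L i) * width i" using j by (intro mult_right_mono) auto
    finally have lt: "j * width i + c < length (L i) * width i" .
    let ?g = "\<lambda>j. encode_tuple (Q ! i) (L i ! j)"
    have m: "map (encode_tuple (Q ! i)) (L i) = map ?g [0..<length (L i)]"
      by (intro nth_equalityI) simp_all
    have "(\<Sum>j'<j. length (?g j')) = j * width i" using finite_atom[OF i] by (simp add: width_def)
    then have "array_of (concat (map ?g [0..<length (L i)])) (j * width i + c) = ?g j ! c"
      using array_of_concat[of j "length (L i)" c ?g] j c finite_atom[OF i] by (simp add: width_def)
    then have "concat (map (encode_tuple (Q ! i)) (L i)) ! (j * width i + c) = ?g j ! c"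
      using lt length_encode_tuples[OF i] by (simp add: m[symmetric] array_of_def)
    moreover have "Suc (j * width i + c) < length (?f i)" using lt by (simp add: length_encode_relation[OF i])
    ultimately show ?thesis using *[of "Suc (j * width i + c)"] by (simp add: encode_relation_def add.assoc)
  qed
qed

end

section \<open>Reading the query\<close>

text \<open>Besides the arities, this finds the width \<open>w\<close> of an output row, the number
  of distinct variables, by marking them in an array indexed by the variables themselves.\<close>

definition parse_query :: prog where
  "parse_query = Assign ''k'' (Arr ''in'' (Const 0)) ;; Assign ''p'' (Const 1) ;; Assign ''w'' (Const 0) ;;
     For ''i'' ''k''
       (Assign ''z'' (Arr ''in'' (Reg ''p'')) ;; Store ''zw'' (Reg ''i'') (Reg ''z'') ;;
        Assign ''p'' (Add (Reg ''p'') (Const 1)) ;;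
        For ''j'' ''z''
          (Assign ''x'' (Arr ''in'' (Reg ''p'')) ;;
           If (Arr ''seen'' (Reg ''x'')) Skip
             (Store ''seen'' (Reg ''x'') (Const 1) ;; Assign ''w'' (Add (Reg ''w'') (Const 1))) ;;
           Assign ''p'' (Add (Reg ''p'') (Const 1)))) ;;
     Assign ''l'' (Reg ''p'')"

text \<open>A set Y of at most l columns has at most 2 ^ l subsets, so m = 2 ^ l ends suffice for
  every F. A mask then consists of m + 1 blocks of l bits, one for Y and m for the candidates, and
  \<open>tot\<close> is the number of masks.\<close>

definition set_parameters :: prog where
  "set_parameters =
     Assign ''m'' (Const 1) ;; For ''j'' ''l'' (Assign ''m'' (Add (Reg ''m'') (Reg ''m''))) ;;
     Assign ''m1'' (Add (Reg ''m'') (Const 1)) ;;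
     Assign ''bn'' (Const 0) ;; For ''j'' ''m1'' (Assign ''bn'' (Add (Reg ''bn'') (Reg ''l''))) ;;
     Assign ''tot'' (Const 1) ;; For ''j'' ''bn'' (Assign ''tot'' (Add (Reg ''tot'') (Reg ''tot''))) ;;
     Assign ''ba'' (Const 2)"

text \<open>The trie only needs some bound above all letters, and the sum of all values is one. It
  starts at 2 because letters are values shifted by one and the bound is strict.\<close>

definition bound_values :: prog where
  "bound_values = Assign ''p'' (Reg ''l'') ;; Assign ''mx'' (Const 2) ;;
     For ''i'' ''k''
       (Assign ''n'' (Arr ''in'' (Reg ''p'')) ;; Assign ''mx'' (Add (Reg ''mx'') (Reg ''n'')) ;;
        Assign ''p'' (Add (Reg ''p'') (Const 1)) ;; Assign ''z'' (Arr ''zw'' (Reg ''i'')) ;;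
        For ''j'' ''n'' (For ''c'' ''z''
          (Assign ''mx'' (Add (Reg ''mx'') (Arr ''in'' (Reg ''p''))) ;;
           Assign ''p'' (Add (Reg ''p'') (Const 1)))))"

definition classify :: prog where
  "classify = Assign ''p'' (Reg ''l'') ;; Assign ''o'' (Const 0) ;;
     For ''i'' ''k''
       (Assign ''n'' (Arr ''in'' (Reg ''p'')) ;; Assign ''p'' (Add (Reg ''p'') (Const 1)) ;;
        Assign ''z'' (Arr ''zw'' (Reg ''i'')) ;;
        classify_atom ;;
        For ''j'' ''n'' (Assign ''p'' (Add (Reg ''p'') (Reg ''z''))) ;;
        Assign ''o'' (Add (Reg ''o'') (Reg ''n'')))"

lemma mods_driver [simp]:
  "wr parse_query = {''k'', ''p'', ''w'', ''i'', ''z'', ''j'', ''x'', ''l''}" "wa parse_query = {''zw'', ''seen''}"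
  "wr set_parameters = {''m'', ''j'', ''m1'', ''bn'', ''tot'', ''ba''}" "wa set_parameters = {}"
  "wr bound_values = {''p'', ''mx'', ''i'', ''n'', ''z'', ''j'', ''c''}" "wa bound_values = {}"
  "wr classify = {''p'', ''o'', ''i'', ''n'', ''z''} \<union> wr classify_atom"
  "wa classify = wa classify_atom"
  by (auto simp: parse_query_def set_parameters_def bound_values_def classify_def)

lemma card_insert_Suc: "card {x. f x \<noteq> (0::nat)} = c \<Longrightarrow> finite {x. f x \<noteq> 0} \<Longrightarrow> f y = 0 \<Longrightarrow>
  card {x. (f(y := Suc 0)) x \<noteq> 0} = Suc c"
proof -
  assume a: "card {x. f x \<noteq> 0} = c" "finite {x. f x \<noteq> 0}" "f y = 0"
  have "{x. (f(y := Suc 0)) x \<noteq> 0} = insert y {x. f x \<noteq> 0}" by auto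
  then show ?thesis using a by simp
qed

lemma runs_set_parameters:
  assumes "reg s ''l'' = l"
  shows "runs set_parameters s (int l * 3 + int (Suc (2 ^ l)) * 3 + int (l * Suc (2 ^ l)) * 3 + 11)
    (\<lambda>s'. reg s' ''m'' = 2 ^ l \<and> reg s' ''m1'' = Suc (2 ^ l) \<and> reg s' ''bn'' = l * Suc (2 ^ l) \<and>
      reg s' ''tot'' = 2 ^ (l * Suc (2 ^ l)) \<and> reg s' ''ba'' = 2)"
  unfolding set_parameters_def runs_Seq_Assign
proof (rule runs_For_Seq[where n = l and c = 1 and I = "\<lambda>i s. reg s ''m'' = 2 ^ i"], goal_cases)
  case (7 s1)
  have l: "reg s1 ''l'' = l" using frame_reg[OF 7(2)] assms by simp
  show ?case unfolding runs_Seq_Assign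
  proof (rule runs_For_Seq[where n = "Suc (2 ^ l)" and c = 1 and
      I = "\<lambda>i s. reg s ''bn'' = i * l \<and> reg s ''l'' = l \<and> reg s ''m'' = 2 ^ l \<and> reg s ''m1'' = Suc (2 ^ l)"], goal_cases)
    case (6 i s')
    have "reg s' ''l'' = l" "reg s' ''m'' = 2 ^ l" "reg s' ''m1'' = Suc (2 ^ l)"
      using frame_reg[OF 6(4)] 7(3) l by simp_all
    then show ?case using 6(5) by simp
  next
    case s2: (7 s2)
    have bn: "reg s2 ''bn'' = l * Suc (2 ^ l)" using s2(3) by (simp add: mult.commute)
    show ?case unfolding runs_Seq_Assign
    proof (rule runs_For_Seq[where n = "l * Suc (2 ^ l)" and c = 1 and I = "\<lambda>i s. reg s ''tot'' = 2 ^ i"], goal_cases)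
      case (7 s3)
      have "reg s3 ''m'' = 2 ^ l" "reg s3 ''m1'' = Suc (2 ^ l)" "reg s3 ''bn'' = l * Suc (2 ^ l)"
        using frame_reg[OF 7(2)] s2(3) bn by simp_all
      then show ?case using 7(3) by simp
    qed (use bn in simp_all)
  qed (use 7(3) l in simp_all)
qed (use assms in simp_all)

context query
begin

lemma runs_parse_query:
  assumes inp: "arr s ''in'' = array_of (encode_input Q L)" and seen: "arr s ''seen'' = (\<lambda>_. 0)"
  shows "runs parse_query s ((\<Sum>i<k. int (width i) * 7 + 7) + 6) (\<lambda>s'. reg s' ''k'' = k \<and> reg s' ''l'' = qlen \<and>
    reg s' ''w'' = card (vars Q) \<and> (\<forall>i<k. arr s' ''zw'' i = width i))"
proof -
  \<comment> \<open>The variables met after i atoms and j columns of the next one.\<close>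
  let ?S = "\<lambda>i j. (\<Union>i'<i. Q ! i') \<union> (\<lambda>j. sorted_list_of_set (Q ! i) ! j) ` {..<j}"
  have qpos_lt: "qpos i + j < qlen" if "i < k" "j \<le> width i" for i j
  proof -
    have "qpos i + j < qpos (Suc i)" using that by (simp add: qpos_def)
    also have "\<dots> \<le> qpos k" unfolding qpos_def using that by (intro add_left_mono sum_mono2) auto
    finally show ?thesis by (simp add: qlen)
  qed
  have k: "array_of (encode_input Q L) 0 = k" using input_word(1)[of 0 L] query_word(1) by (simp add: qlen qpos_def)
  have w: "array_of (encode_input Q L) (qpos i) = width i" if "i < k" for i
    using input_word(1)[of "qpos i" L] query_word(2)[OF that] qpos_lt[OF that, of 0] by simp
  have v: "array_of (encode_input Q L) (Suc (qpos i) + j) = sorted_list_of_set (Q ! i) ! j" if "i < k" "j < width i" for i j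
    using input_word(1)[of "Suc (qpos i) + j" L] query_word(3)[OF that] qpos_lt[OF that(1), of "Suc j"] that by simp
  have full: "?S i (width i) = (\<Union>i'<Suc i. Q ! i')" if "i < k" for i
  proof -
    have "(\<lambda>j. sorted_list_of_set (Q ! i) ! j) ` {..<width i} = set (sorted_list_of_set (Q ! i))"
      unfolding set_conv_nth width_def by (auto simp: image_def)
    then show ?thesis using finite_atom[OF that] by (auto simp: lessThan_Suc)
  qed
  show ?thesis
    unfolding parse_query_def runs_Seq_Assign
  proof (rule runs_Seq[OF runs_For[where n = k and c = "\<lambda>i. int (width i) * 7 + 5" and T = "(\<Sum>i<k. int (width i) * 7 + 7) + 2"
      and I = "\<lambda>i s. reg s ''p'' = qpos i \<and> (\<forall>i'<i. arr s ''zw'' i' = width i') \<and>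
        finite {x. arr s ''seen'' x \<noteq> 0} \<and> reg s ''w'' = card {x. arr s ''seen'' x \<noteq> 0} \<and>
        {x. arr s ''seen'' x \<noteq> 0} = (\<Union>i'<i. Q ! i')"]], goal_cases)
    case (6 i s1)
    note P = 6(5) and i = 6(1,2)
    have inp1: "arr s1 ''in'' = array_of (encode_input Q L)" using frame_arr[OF 6(4)] inp by simp
    have p: "reg s1 ''p'' = qpos i" using P by blast
    have fin: "\<forall>x\<in>{..<i}. finite (Q ! x)" "\<forall>x\<in>{..<Suc i}. finite (Q ! x)"
      using finite_atom i by simp_all
    show ?case unfolding runs_Seq_Assign runs_Seq_Store
    proof (rule runs_For_const[where n = "width i" and c = 5 and
      I = "\<lambda>j s. reg s ''p'' = Suc (qpos i) + j \<and> (\<forall>i'<Suc i. arr s ''zw'' i' = width i') \<and>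
        finite {x. arr s ''seen'' x \<noteq> 0} \<and> reg s ''w'' = card {x. arr s ''seen'' x \<noteq> 0} \<and>
        {x. arr s ''seen'' x \<noteq> 0} = ?S i j"], goal_cases)
      case 1 then show ?case using inp1 p w[OF i(1)] by simp
    next
      case 5
      show ?case using inp1 p w[OF i(1)] P i fin by (simp add: less_Suc_eq)
    next
      case (6 j s2)
      have inp2: "arr s2 ''in'' = array_of (encode_input Q L)" using frame_arr[OF 6(4)] inp1 by simp
      let ?x = "sorted_list_of_set (Q ! i) ! j"
      have x: "arr s2 ''in'' (reg s2 ''p'') = ?x" using inp2 6(5) v[OF i(1) 6(1)] by simp
      have S: "?S i (Suc j) = insert ?x (?S i j)" by (simp add: lessThan_Suc)
      show ?case
      proof (cases "arr s2 ''seen'' ?x = 0")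
        case True
        have ins: "{y. ((arr s2 ''seen'')(?x := Suc 0)) y \<noteq> 0} = insert ?x {y. arr s2 ''seen'' y \<noteq> 0}" by auto
        then have "{y. ((arr s2 ''seen'')(?x := Suc 0)) y \<noteq> 0} = ?S i (Suc j)" using 6(5) S by metis
        moreover have "card {y. ((arr s2 ''seen'')(?x := Suc 0)) y \<noteq> 0} = Suc (card {y. arr s2 ''seen'' y \<noteq> 0})"
          using card_insert_Suc[where f = "arr s2 ''seen''" and y = ?x, OF refl _ True] 6(5) by blast
        moreover have "finite {y. ((arr s2 ''seen'')(?x := Suc 0)) y \<noteq> 0}"
        proof -
          have "finite {y. arr s2 ''seen'' y \<noteq> 0}" using 6(5) by blast
          then show ?thesis unfolding ins by (rule finite.insertI)
        qed
        ultimately show ?thesis using x True 6(5) by (simp del: fun_upd_apply) simp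
      next
        case False
        then have "?x \<in> ?S i j" using 6(5) by blast
        then have "?S i (Suc j) = ?S i j" unfolding S by blast
        then show ?thesis using x False 6(5) fin by simp
      qed
    next
      case 7 show ?case by simp
    next
      case (8 s2)
      have "qpos (Suc i) = Suc (qpos i) + width i" by (simp add: qpos_def)
      then show ?case using 8(3) full[OF i(1)] fin by simp
    qed simp_all
  next
    case (8 s1)
    have "(\<Union>i'<k. Q ! i') = vars Q" unfolding vars_def by (auto simp: set_conv_nth)
    moreover have "reg s1 ''k'' = k" using frame_reg[OF 8(2)] k inp by simp
    ultimately show ?case using 8(1) qlen by simp
  next
    case 5 show ?case using seen by (simp add: qpos_def)
  next
    case 7 show ?case by (simp add: algebra_simps sum.distrib)
  qed (use k inp in simp_all)
qed

lemma runs_bound_values: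
  assumes inp: "arr s ''in'' = array_of (encode_input Q L)"
    and regs: "reg s ''k'' = k" "reg s ''l'' = qlen" and zw: "\<And>i. i < k \<Longrightarrow> arr s ''zw'' i = width i"
  shows "runs bound_values s ((\<Sum>i<k. int (length (L i)) * (int (width i) * 4 + 4) + 8) + 4)
    (\<lambda>s'. 0 < reg s' ''mx'' \<and> (\<forall>i<k. \<forall>j<length (L i). \<forall>c<width i.
      Suc (array_of (encode_input Q L) (Suc (rpos L i) + j * width i + c)) < reg s' ''mx''))"
proof -
  define w where "w = array_of (encode_input Q L)"
  let ?I = "\<lambda>p s. reg s ''p'' = p \<and> 2 \<le> reg s ''mx'' \<and> (\<forall>q. qlen \<le> q \<and> q < p \<longrightarrow> Suc (w q) < reg s ''mx'')"
  have step: "runs (Assign ''mx'' (Add (Reg ''mx'') (Arr ''in'' (Reg ''p''))) ;;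
      Assign ''p'' (Add (Reg ''p'') (Const 1))) s 2 (?I (Suc p))" if "?I p s" "arr s ''in'' = w" for s p
    using that by (auto simp: less_Suc_eq trans_less_add1)
  show ?thesis
    unfolding bound_values_def runs_Seq_Assign
  proof (rule runs_mono[OF runs_For[where n = k and c = "\<lambda>i. int (length (L i)) * (int (width i) * 4 + 4) + 6"
      and T = "(\<Sum>i<k. int (length (L i)) * (int (width i) * 4 + 4) + 8) + 2" and I = "\<lambda>i. ?I (rpos L i)"]], goal_cases)
    case (6 i s1)
    note P = 6(5) and i = 6(1,2)
    have inp1: "arr s1 ''in'' = w" "arr s1 ''zw'' i = width i"
      using frame_arr[OF 6(4)] inp zw[OF i(1)] by (simp_all add: w_def)
    have n: "w (rpos L i) = length (L i)" using input_word(2)[OF i(1)] by (simp add: w_def)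
    show ?case unfolding runs_Seq_Assign
    proof (rule runs_For_const[where n = "length (L i)" and c = "int (width i) * 4 + 2" and
        I = "\<lambda>j s. ?I (Suc (rpos L i) + j * width i) s \<and> reg s ''z'' = width i"], goal_cases)
      case (6 j s2)
      have inp2: "arr s2 ''in'' = w" "reg s2 ''j'' = j" using frame_arr[OF 6(4)] inp1 6(2) by simp_all
      show ?case
      proof (rule runs_For_const[where n = "width i" and c = 2 and
          I = "\<lambda>c. ?I (Suc (rpos L i) + j * width i + c)"], goal_cases)
        case (6 c s3)
        have "arr s3 ''in'' = w" using frame_arr[OF 6(4)] inp2 by simp
        then show ?case by (intro runs_mono[OF step[OF 6(5)] order_refl]) simp_all
      next
        case (8 s3)
        have "reg s3 ''z'' = width i" using frame_reg[OF 8(2)] 6(5) by simp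
        then show ?case using 8(3) by (simp add: add.commute)
      qed (use 6(5) in simp_all)
    next
      case 5
      show ?case using P inp1 n i by (auto simp: less_Suc_eq trans_less_add1)
    next
      case (8 s2)
      then show ?case by (simp add: rpos_Suc)
    next
      case 7 show ?case by (simp add: algebra_simps)
    qed (use P inp1 n i in simp_all)
  next
    case (9 s1)
    have "Suc (rpos L i) + j * width i + c < rpos L k" if "i < k" "j < length (L i)" "c < width i" for i j c
    proof -
      have "j * width i + c < Suc j * width i" using that by simp
      also have "\<dots> \<le> length (L i) * width i" using that by (intro mult_right_mono) auto
      finally have "Suc (rpos L i) + j * width i + c < rpos L (Suc i)" by (simp add: rpos_Suc)
      also have "\<dots> \<le> rpos L k" unfolding rpos_def using that by (intro add_left_mono sum_mono2) auto
      finally show ?thesis .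
    qed
    moreover have "qlen \<le> Suc (rpos L i) + j * width i + c" for i j c by (simp add: rpos_def)
    ultimately show ?case using 9(1) by (auto simp: w_def)
  next
    case 7 show ?case by (simp add: algebra_simps sum.distrib)
  qed (use regs in \<open>simp_all add: rpos_def\<close>)
qed

end

lemma classified_cong:
  assumes "classified n m l z f tot C" "\<And>j. j < n \<Longrightarrow> C' j = C j"
  shows "classified n m l z f tot C'"
  using assms unfolding classified_def by metis

context query
begin

text \<open>The classes of all atoms share one array, in which row j of atom i has index
  \<open>off L i + j\<close>.\<close>

definition off :: "(nat \<Rightarrow> tuple list) \<Rightarrow> nat \<Rightarrow> nat" where
  "off L i = (\<Sum>i'<i. length (L i'))"

lemma off_Suc: "off L (Suc i) = off L i + length (L i)"
  by (simp add: off_def)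

lemma off_le: "i' < i \<Longrightarrow> off L i' + length (L i') \<le> off L i"
  unfolding off_Suc[symmetric] unfolding off_def by (rule sum_mono2) auto

definition classify_time :: "(nat \<Rightarrow> tuple list) \<Rightarrow> nat \<Rightarrow> nat \<Rightarrow> int" where
  "classify_time L m tot = (\<Sum>i<k. int tot * (refine_time (length (L i)) (width i) qlen m tot + 2) +
     int (length (L i)) * 3 + 11) + 4"

lemma runs_classify:
  assumes inp: "arr s ''in'' = array_of (encode_input Q L)"
    and regs: "reg s ''k'' = k" "reg s ''l'' = qlen" "reg s ''m'' = m" "reg s ''m1'' = Suc m"
      "reg s ''tot'' = tot" "reg s ''ba'' = 2" "reg s ''bn'' = qlen * Suc m"
    and m: "m \<ge> 1" and zw: "\<And>i. i < k \<Longrightarrow> arr s ''zw'' i = width i"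
    and t: "\<exists>path. trie_in s path" and pos: "0 < reg s ''mx''" and hist: "arr s ''hist'' = (\<lambda>_. 0)"
    and mx: "\<And>i j c. i < k \<Longrightarrow> j < length (L i) \<Longrightarrow> c < width i \<Longrightarrow>
      Suc (array_of (encode_input Q L) (Suc (rpos L i) + j * width i + c)) < reg s ''mx''"
    and C: "arr s ''cls'' = (\<lambda>_. 0)"
  shows "runs classify s (classify_time L m tot) (\<lambda>s'. reg s' ''kk'' = Suc m ^ tot \<and>
    (\<forall>i<k. classified (length (L i)) m qlen (width i)
      (\<lambda>j c. array_of (encode_input Q L) (Suc (rpos L i) + j * width i + c)) tot
      (\<lambda>j. arr s' ''cls'' (off L i + j))))"
proof -
  define w where "w = array_of (encode_input Q L)"
  \<comment> \<open>A query has at least one atom, and classifying it sets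
    \<open>kk\<close>.\<close>
  have k0: "k > 0" using Q by (simp add: is_query_def)
  show ?thesis
    unfolding classify_def runs_Seq_Assign w_def[symmetric]
  proof (rule runs_mono[OF runs_For[where n = k and
      c = "\<lambda>i. int tot * (refine_time (length (L i)) (width i) qlen m tot + 2) + int (length (L i)) * 3 + 9"
      and T = "classify_time L m tot - 2" and
      I = "\<lambda>i s. reg s ''p'' = rpos L i \<and> reg s ''o'' = off L i \<and> (\<exists>path. trie_in s path) \<and>
        arr s ''hist'' = (\<lambda>_. 0) \<and> (0 < i \<longrightarrow> reg s ''kk'' = Suc m ^ tot) \<and>
        (\<forall>y\<ge>off L i. arr s ''cls'' y = 0) \<and>
        (\<forall>i'<i. classified (length (L i')) m qlen (width i')
          (\<lambda>j c. w (Suc (rpos L i') + j * width i' + c)) tot (\<lambda>j. arr s ''cls'' (off L i' + j)))"]], goal_cases)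
    case (6 i s1)
    note f = frame_reg[OF 6(4)] frame_arr[OF 6(4)] and P = 6(5) and i = 6(1,2)
    have n: "w (rpos L i) = length (L i)" using input_word(2)[OF i(1)] by (simp add: w_def)
    have inp1: "arr s1 ''in'' = w" "arr s1 ''zw'' i = width i" "reg s1 ''p'' = rpos L i"
      using f inp zw[OF i(1)] P by (simp_all add: w_def)
    define s2 where "s2 = s1\<lparr>reg := (reg s1)(''n'' := length (L i), ''p'' := Suc (rpos L i), ''z'' := width i)\<rparr>"
    have s2: "reg s2 ''z'' = width i" "reg s2 ''n'' = length (L i)" "reg s2 ''m'' = m" "reg s2 ''m1'' = Suc m"
      "reg s2 ''l'' = qlen" "reg s2 ''p'' = Suc (rpos L i)" "reg s2 ''o'' = off L i" "reg s2 ''tot'' = tot"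
      "reg s2 ''ba'' = 2" "reg s2 ''bn'' = qlen * Suc m" "\<exists>path. trie_in s2 path" "0 < reg s2 ''mx''"
      "arr s2 ''hist'' = (\<lambda>_. 0)"
      using f P regs pos by (simp_all add: s2_def)
    have inp2: "arr s2 ''in'' = w" "reg s2 ''i'' = i" "arr s2 ''cls'' = arr s1 ''cls''" using inp1 i by (simp_all add: s2_def)
    have mx2: "Suc (arr s2 ''in'' (Suc (rpos L i) + j * width i + c)) < reg s2 ''mx''"
      if "j < length (L i)" "c < width i" for j c
      using mx[OF i(1) that] f inp1 by (simp add: s2_def w_def)
    have C2: "arr s2 ''cls'' y = 0" if "off L i \<le> y" for y using P that by (simp add: s2_def)
    have "runs (classify_atom ;; For ''j'' ''n'' (Assign ''p'' (Add (Reg ''p'') (Reg ''z''))) ;;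
        Assign ''o'' (Add (Reg ''o'') (Reg ''n''))) s2
      (int tot * (refine_time (length (L i)) (width i) qlen m tot + 2) + int (length (L i)) * 3 + 6)
      (\<lambda>s'. reg s' ''p'' = rpos L (Suc i) \<and> reg s' ''o'' = off L (Suc i) \<and> (\<exists>path. trie_in s' path) \<and>
        arr s' ''hist'' = (\<lambda>_. 0) \<and> reg s' ''kk'' = Suc m ^ tot \<and>
        (\<forall>y\<ge>off L (Suc i). arr s' ''cls'' y = 0) \<and>
        (\<forall>i'<Suc i. classified (length (L i')) m qlen (width i')
          (\<lambda>j c. w (Suc (rpos L i') + j * width i' + c)) tot (\<lambda>j. arr s' ''cls'' (off L i' + j))))"
    proof (rule runs_Seq[OF runs_classify_atom[OF s2(1-10) width_le_qlen[OF i(1)] m s2(11-13) mx2 C2]], goal_cases)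
      case (4 s3)
      note P3 = 4(1) and f3 = frame_reg[OF 4(2)] frame_arr[OF 4(2)]
      have cl: "classified (length (L i')) m qlen (width i')
          (\<lambda>j c. w (Suc (rpos L i') + j * width i' + c)) tot (\<lambda>j. arr s3 ''cls'' (off L i' + j))" if "i' < Suc i" for i'
      proof (cases "i' = i")
        case True
        then show ?thesis using P3 unfolding inp2 by blast
      next
        case False
        then have "i' < i" using that by simp
        show ?thesis
        proof (rule classified_cong)
          show "classified (length (L i')) m qlen (width i')
            (\<lambda>j c. w (Suc (rpos L i') + j * width i' + c)) tot (\<lambda>j. arr s1 ''cls'' (off L i' + j))"
            using P \<open>i' < i\<close> by blast
          fix j assume "j < length (L i')"
          \<comment> \<open>Rows of earlier atoms lie below the segment that this pass
            writes.\<close>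
          then have "off L i' + j < off L i" using off_le[OF \<open>i' < i\<close>, of L] by simp
          then show "arr s3 ''cls'' (off L i' + j) = arr s1 ''cls'' (off L i' + j)"
            using P3 inp2(3) by simp
        qed
      qed
      have z: "arr s3 ''cls'' y = 0" if "off L (Suc i) \<le> y" for y
        using P3 that C2[of y] by (simp add: off_Suc)
      have s3: "reg s3 ''n'' = length (L i)" "reg s3 ''z'' = width i" "reg s3 ''p'' = Suc (rpos L i)"
        "reg s3 ''o'' = off L i"
        using f3 s2 by simp_all
      show ?case
      proof (rule runs_For_Seq[where n = "length (L i)" and c = 1 and
          I = "\<lambda>j s. reg s ''p'' = Suc (rpos L i) + j * width i"], goal_cases)
        case (6 j s4)
        have "reg s4 ''z'' = width i" using frame_reg[OF 6(4)] s3 by simp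
        then show ?case using 6(5) by simp
      next
        case (7 s4)
        note f4 = frame_reg[OF 7(2)] frame_arr[OF 7(2)]
        have "\<exists>path. trie_in s4 path" "arr s4 ''hist'' = (\<lambda>_. 0)" "reg s4 ''kk'' = Suc m ^ tot" "arr s4 ''cls'' = arr s3 ''cls''"
          "reg s4 ''n'' = length (L i)" "reg s4 ''o'' = off L i"
          using f4 P3 s3 by simp_all
        then show ?case using 7(3) cl z by (simp add: rpos_Suc off_Suc)
      qed (use s3 in simp_all)
    qed
    then show ?case using inp1 n i by (simp add: s2_def algebra_simps)
  next
    case 7 show ?case by (simp add: classify_time_def algebra_simps sum.distrib)
  next
    case 5 show ?case using regs t hist C by (simp add: rpos_def off_def)
  next
    case (9 s1)
    then show ?case using k0 by blast
  qed (use regs in simp_all)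
qed

end

section \<open>Building the parts of the input\<close>

definition copy_query :: prog where
  "copy_query = For ''j'' ''l'' (Store ''Ain'' (Reg ''j'') (Arr ''in'' (Reg ''j''))) ;; Assign ''ip'' (Reg ''l'')"

text \<open>Equality is tested by truncated subtraction: the sum of both differences vanishes
  exactly if the class of the row is the chosen one.\<close>

definition build_tuple :: prog where
  "build_tuple =
     If (Add (Sub (Arr ''cls'' (Reg ''y'')) (Arr ''dig'' (Reg ''i''))) (Sub (Arr ''dig'' (Reg ''i'')) (Arr ''cls'' (Reg ''y''))))
       (For ''c'' ''z'' (Assign ''p'' (Add (Reg ''p'') (Const 1))))
       (Assign ''nn'' (Add (Reg ''nn'') (Const 1)) ;;
        For ''c'' ''z'' (Store ''Ain'' (Reg ''ip'') (Arr ''in'' (Reg ''p'')) ;;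
          Assign ''ip'' (Add (Reg ''ip'') (Const 1)) ;; Assign ''p'' (Add (Reg ''p'') (Const 1)))) ;;
     Assign ''y'' (Add (Reg ''y'') (Const 1))"

text \<open>The number of selected tuples is known only after the scan, so its cell is reserved at
  \<open>hp\<close> and filled in last. An empty class resets \<open>ok\<close>.\<close>

definition build_relation :: prog where
  "build_relation =
     Assign ''n'' (Arr ''in'' (Reg ''p'')) ;; Assign ''p'' (Add (Reg ''p'') (Const 1)) ;;
     Assign ''hp'' (Reg ''ip'') ;; Assign ''ip'' (Add (Reg ''ip'') (Const 1)) ;;
     Assign ''nn'' (Const 0) ;; Assign ''z'' (Arr ''zw'' (Reg ''i'')) ;;
     For ''j'' ''n'' build_tuple ;;
     Store ''Ain'' (Reg ''hp'') (Reg ''nn'') ;;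
     If (Reg ''nn'') Skip (Assign ''ok'' (Const 0))"

definition build :: prog where
  "build = copy_query ;; Assign ''p'' (Reg ''l'') ;; Assign ''y'' (Const 0) ;; Assign ''ok'' (Const 1) ;;
     For ''i'' ''k'' build_relation"

lemma mods_build [simp]:
  "wr copy_query = {''j'', ''ip''}" "wa copy_query = {''Ain''}"
  "wr build_tuple = {''c'', ''p'', ''nn'', ''ip'', ''y''}" "wa build_tuple = {''Ain''}"
  "wr build_relation = {''n'', ''p'', ''hp'', ''ip'', ''nn'', ''z'', ''j'', ''c'', ''y'', ''ok''}"
  "wa build_relation = {''Ain''}"
  "wr build = {''n'', ''p'', ''hp'', ''ip'', ''nn'', ''z'', ''j'', ''c'', ''y'', ''ok'', ''i''}"
  "wa build = {''Ain''}"
  by (auto simp: copy_query_def build_tuple_def build_relation_def build_def)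

lemma array_of_zero: "array_of (xs @ [0]) = array_of xs"
  by (auto simp: array_of_def fun_eq_iff nth_append)

definition part :: "(nat \<Rightarrow> 'a list) \<Rightarrow> (nat \<Rightarrow> nat \<Rightarrow> nat) \<Rightarrow> (nat \<Rightarrow> nat) \<Rightarrow> nat \<Rightarrow> 'a list" where
  "part L C d i = map ((!) (L i)) (filter (\<lambda>j. C i j = d i) [0..<length (L i)])"

context query
begin

lemma runs_build_tuple:
  assumes inp: "arr s ''in'' = array_of (encode_input Q L)" and i: "i < k" and j: "j < length (L i)"
    and regs: "reg s ''i'' = i" "reg s ''z'' = width i" "reg s ''p'' = Suc (rpos L i) + j * width i"
      "reg s ''y'' = y" "reg s ''nn'' = nn" "reg s ''ip'' = length xs"
    and A: "arr s ''Ain'' = array_of xs"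
  shows "runs build_tuple s (int (width i) * 5 + 5) (\<lambda>s'. reg s' ''p'' = Suc (rpos L i) + Suc j * width i \<and>
    reg s' ''y'' = Suc y \<and>
    (let e = (arr s ''cls'' y = arr s ''dig'' i);
         xs' = xs @ (if e then encode_tuple (Q ! i) (L i ! j) else []) in
      reg s' ''nn'' = (if e then Suc nn else nn) \<and> reg s' ''ip'' = length xs' \<and> arr s' ''Ain'' = array_of xs'))"
proof (cases "arr s ''cls'' y = arr s ''dig'' i")
  case True
  let ?t = "encode_tuple (Q ! i) (L i ! j)"
  have t: "length ?t = width i" using finite_atom[OF i] by (simp add: width_def)
  let ?s = "s\<lparr>reg := (reg s)(''nn'' := Suc nn)\<rparr>"
  have "runs (For ''c'' ''z'' (Store ''Ain'' (Reg ''ip'') (Arr ''in'' (Reg ''p'')) ;;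
          Assign ''ip'' (Add (Reg ''ip'') (Const 1)) ;; Assign ''p'' (Add (Reg ''p'') (Const 1))) ;;
     Assign ''y'' (Add (Reg ''y'') (Const 1))) ?s (int (width i) * 5 + 3)
     (\<lambda>s'. reg s' ''p'' = Suc (rpos L i) + Suc j * width i \<and> reg s' ''y'' = Suc y \<and>
      reg s' ''nn'' = Suc nn \<and> reg s' ''ip'' = length (xs @ ?t) \<and> arr s' ''Ain'' = array_of (xs @ ?t))"
  proof (rule runs_For_Seq[where n = "width i" and c = 3 and
      I = "\<lambda>c s. reg s ''p'' = Suc (rpos L i) + j * width i + c \<and> reg s ''ip'' = length xs + c \<and>
        arr s ''Ain'' = array_of (xs @ take c ?t)"], goal_cases)
    case (6 c s1)
    have "arr s1 ''in'' = array_of (encode_input Q L)" using frame_arr[OF 6(4)] inp by simp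
    moreover have "length (xs @ take c ?t) = length xs + c" using t 6(1) by simp
    moreover have "xs @ take (Suc c) ?t = (xs @ take c ?t) @ [?t ! c]"
      using t 6(1) by (simp add: take_Suc_conv_app_nth)
    ultimately show ?case using 6(5) input_word(3)[where L = L and i = i and j = j and c = c, OF i j 6(1)] array_of_snoc[of "xs @ take c ?t" "?t ! c"]
      by simp
  next
    case (7 s1)
    have "reg s1 ''y'' = y" "reg s1 ''nn'' = Suc nn" using frame_reg[OF 7(2)] regs by simp_all
    then show ?case using 7(3) t by (simp add: algebra_simps)
  qed (use regs A in simp_all)
  then show ?thesis using True regs unfolding build_tuple_def by (simp add: Let_def add.commute)
next
  case False
  have "runs (For ''c'' ''z'' (Assign ''p'' (Add (Reg ''p'') (Const 1))) ;;
     Assign ''y'' (Add (Reg ''y'') (Const 1))) s (int (width i) * 5 + 4)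
     (\<lambda>s'. reg s' ''p'' = Suc (rpos L i) + Suc j * width i \<and> reg s' ''y'' = Suc y \<and>
      reg s' ''nn'' = nn \<and> reg s' ''ip'' = length xs \<and> arr s' ''Ain'' = array_of xs)"
  proof (rule runs_For_Seq[where n = "width i" and c = 1 and
      I = "\<lambda>c s. reg s ''p'' = Suc (rpos L i) + j * width i + c"], goal_cases)
    case (7 s1)
    have "reg s1 ''y'' = y" "reg s1 ''nn'' = nn" "reg s1 ''ip'' = length xs" "arr s1 ''Ain'' = array_of xs"
      using frame_reg[OF 7(2)] frame_arr[OF 7(2)] regs A by simp_all
    then show ?case using 7(3) by (simp add: algebra_simps)
  qed (use regs in simp_all)
  moreover have "arr s ''cls'' y - arr s ''dig'' i + (arr s ''dig'' i - arr s ''cls'' y) \<noteq> 0"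
    using False by linarith
  ultimately show ?thesis using False regs unfolding build_tuple_def by (simp add: Let_def add.commute)
qed

lemma runs_build_relation:
  assumes inp: "arr s ''in'' = array_of (encode_input Q L)" and i: "i < k"
    and regs: "reg s ''i'' = i" "reg s ''p'' = rpos L i" "reg s ''y'' = off L i" "reg s ''ip'' = length xs"
    and zw: "arr s ''zw'' i = width i" and dig: "arr s ''dig'' i = d i"
    and C: "\<And>j. j < length (L i) \<Longrightarrow> arr s ''cls'' (off L i + j) = C i j"
    and A: "arr s ''Ain'' = array_of xs"
  shows "runs build_relation s (int (length (L i)) * (int (width i) * 5 + 7) + 11) (\<lambda>s'.
    let xs' = xs @ encode_relation (Q ! i) (part L C d i) in
      reg s' ''p'' = rpos L (Suc i) \<and> reg s' ''y'' = off L (Suc i) \<and> reg s' ''ip'' = length xs' \<and>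
      arr s' ''Ain'' = array_of xs' \<and> reg s' ''ok'' = (if part L C d i = [] then 0 else reg s ''ok''))"
proof -
  let ?P = "\<lambda>j. map ((!) (L i)) (filter (\<lambda>j. C i j = d i) [0..<j])"
  \<comment> \<open>The cell after \<open>xs\<close> holds 0 as a placeholder for the tuple
    count.\<close>
  let ?X = "\<lambda>j. xs @ 0 # concat (map (encode_tuple (Q ! i)) (?P j))"
  have n: "arr s ''in'' (rpos L i) = length (L i)" using input_word(2)[OF i] inp by simp
  define s1 where "s1 = s\<lparr>reg := (reg s)(''n'' := length (L i), ''p'' := Suc (rpos L i), ''hp'' := length xs,
    ''ip'' := Suc (length xs), ''nn'' := 0, ''z'' := width i)\<rparr>"
  have "runs (For ''j'' ''n'' build_tuple ;; Store ''Ain'' (Reg ''hp'') (Reg ''nn'') ;;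
     If (Reg ''nn'') Skip (Assign ''ok'' (Const 0))) s1 (int (length (L i)) * (int (width i) * 5 + 7) + 5) (\<lambda>s'.
    let xs' = xs @ encode_relation (Q ! i) (part L C d i) in
      reg s' ''p'' = rpos L (Suc i) \<and> reg s' ''y'' = off L (Suc i) \<and> reg s' ''ip'' = length xs' \<and>
      arr s' ''Ain'' = array_of xs' \<and> reg s' ''ok'' = (if part L C d i = [] then 0 else reg s ''ok''))"
  proof (rule runs_For_Seq[where n = "length (L i)" and c = "int (width i) * 5 + 5" and
      I = "\<lambda>j s. reg s ''p'' = Suc (rpos L i) + j * width i \<and> reg s ''y'' = off L i + j \<and>
        reg s ''nn'' = length (?P j) \<and> reg s ''ip'' = length (?X j) \<and> arr s ''Ain'' = array_of (?X j)"], goal_cases)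
    case (6 j s2)
    note f2 = frame_reg[OF 6(4)] frame_arr[OF 6(4)] and P = 6(5) and j = 6(1,2)
    have s2: "arr s2 ''in'' = array_of (encode_input Q L)" "reg s2 ''i'' = i" "reg s2 ''z'' = width i"
      "arr s2 ''dig'' i = d i" "arr s2 ''cls'' = arr s ''cls''"
      using f2 inp regs dig by (simp_all add: s1_def)
    have p: "reg s2 ''p'' = Suc (rpos L i) + j * width i" "reg s2 ''y'' = off L i + j"
        "reg s2 ''nn'' = length (?P j)" "reg s2 ''ip'' = length (?X j)" "arr s2 ''Ain'' = array_of (?X j)"
      using P by blast+
    have c: "arr s2 ''cls'' (off L i + j) = C i j" using s2(5) C[OF j(1)] by simp
    show ?case
    proof (rule runs_mono[OF runs_build_tuple[OF s2(1) i j(1) s2(2,3) p] order_refl], goal_cases)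
      case (1 s3)
      show ?case
      proof (cases "C i j = d i")
        case True
        then have "?P (Suc j) = ?P j @ [L i ! j]" by simp
        then have "?X (Suc j) = ?X j @ encode_tuple (Q ! i) (L i ! j)" by simp
        then show ?thesis using 1(1) True c s2(4) \<open>?P (Suc j) = ?P j @ [L i ! j]\<close> by (simp add: Let_def)
      next
        case False
        then have "?P (Suc j) = ?P j" by simp
        then show ?thesis using 1(1) False c s2(4) by (simp add: Let_def)
      qed
    qed
  next
    case (7 s2)
    note P = 7(3)
    have f2: "reg s2 ''hp'' = length xs" "reg s2 ''ok'' = reg s ''ok''"
      using frame_reg[OF 7(2)] by (simp_all add: s1_def)
    have part: "?P (length (L i)) = part L C d i" by (simp add: part_def)
    have enc: "xs @ encode_relation (Q ! i) (part L C d i) =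
        xs @ length (part L C d i) # concat (map (encode_tuple (Q ! i)) (part L C d i))"
      by (simp add: encode_relation_def)
    show ?case using P f2 unfolding part Let_def enc
      by (simp add: array_of_patch rpos_Suc off_Suc) (simp add: algebra_simps)
  next
    case 5
    show ?case using regs A array_of_zero[of xs] by (simp add: s1_def)
  qed (simp_all add: s1_def)
  then show ?thesis using n regs zw unfolding build_relation_def
    by (simp add: s1_def add.commute split del: if_split)
qed

definition build_time :: "(nat \<Rightarrow> tuple list) \<Rightarrow> int" where
  "build_time L = int qlen * 3 + (\<Sum>i<k. int (length (L i)) * (int (width i) * 5 + 7) + 13) + 8"

lemma runs_build:
  assumes inp: "arr s ''in'' = array_of (encode_input Q L)"
    and regs: "reg s ''k'' = k" "reg s ''l'' = qlen"
    and zw: "\<And>i. i < k \<Longrightarrow> arr s ''zw'' i = width i" and dig: "\<And>i. i < k \<Longrightarrow> arr s ''dig'' i = d i"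
    and C: "\<And>i j. i < k \<Longrightarrow> j < length (L i) \<Longrightarrow> arr s ''cls'' (off L i + j) = C i j"
    and A: "arr s ''Ain'' = (\<lambda>_. 0)"
  shows "runs build s (build_time L) (\<lambda>s'. arr s' ''Ain'' = array_of (encode_input Q (part L C d)) \<and>
    reg s' ''ip'' = length (encode_input Q (part L C d)) \<and>
    (reg s' ''ok'' \<noteq> 0 \<longleftrightarrow> (\<forall>i<k. part L C d i \<noteq> [])))"
proof -
  let ?X = "\<lambda>i. encode_query Q @ concat (map (\<lambda>i. encode_relation (Q ! i) (part L C d i)) [0..<i])"
  have q: "runs copy_query s (int qlen * 3 + 3) (\<lambda>s'. arr s' ''Ain'' = array_of (encode_query Q) \<and> reg s' ''ip'' = qlen)"
    unfolding copy_query_def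
  proof (rule runs_For_Seq[where n = qlen and c = 1 and I = "\<lambda>j s. arr s ''Ain'' = array_of (take j (encode_query Q))"],
      goal_cases)
    case (6 j s1)
    have "arr s1 ''in'' j = encode_query Q ! j"
      using frame_arr[OF 6(4)] inp input_word(1)[OF 6(1)] 6(1) by (simp add: array_of_nth qlen_def)
    moreover have "(array_of (take j (encode_query Q)))(j := encode_query Q ! j) = array_of (take (Suc j) (encode_query Q))"
      using array_of_snoc[of "take j (encode_query Q)"] 6(1) by (simp add: take_Suc_conv_app_nth qlen_def)
    ultimately show ?case using 6(2,5) by simp
  next
    case (7 s1)
    have "reg s1 ''l'' = qlen" using frame_reg[OF 7(2)] regs by simp
    then show ?case using 7(3) by (simp add: qlen_def)
  qed (use regs A in \<open>simp_all add: array_of_Nil\<close>)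
  show ?thesis
    unfolding build_def
  proof (rule runs_Seq[OF q], goal_cases)
    case (1 s1)
    note P1 = 1(1) and f1 = frame_reg[OF 1(2)] frame_arr[OF 1(2)]
    have s1: "reg s1 ''k'' = k" "reg s1 ''l'' = qlen" using f1 regs by simp_all
    show ?case unfolding runs_Seq_Assign
    proof (rule runs_mono[OF runs_For[where n = k and c = "\<lambda>i. int (length (L i)) * (int (width i) * 5 + 7) + 11"
        and T = "(\<Sum>i<k. int (length (L i)) * (int (width i) * 5 + 7) + 13) + 2" and
        I = "\<lambda>i s. reg s ''p'' = rpos L i \<and> reg s ''y'' = off L i \<and> reg s ''ip'' = length (?X i) \<and>
          arr s ''Ain'' = array_of (?X i) \<and> (reg s ''ok'' \<noteq> 0 \<longleftrightarrow> (\<forall>i'<i. part L C d i' \<noteq> []))"]], goal_cases)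
      case (6 i s2)
      note f2 = frame_reg[OF 6(4)] frame_arr[OF 6(4)] and P = 6(5) and i = 6(1,2)
      have p: "reg s2 ''p'' = rpos L i" "reg s2 ''y'' = off L i" "reg s2 ''ip'' = length (?X i)"
        "arr s2 ''Ain'' = array_of (?X i)" using P by blast+
      have s2: "arr s2 ''in'' = array_of (encode_input Q L)" "arr s2 ''zw'' i = width i" "arr s2 ''dig'' i = d i"
        using f2 f1 inp zw[OF i(1)] dig[OF i(1)] by simp_all
      have C2: "arr s2 ''cls'' (off L i + j) = C i j" if "j < length (L i)" for j
        using f2 f1 C[OF i(1) that] by simp
      show ?case
      proof (rule runs_mono[OF runs_build_relation[where L = L and C = C and d = d and xs = "?X i", OF s2(1) i p(1-3) s2(2,3) C2 p(4)] order_refl], goal_cases)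
        case (2 s3)
        have X: "?X (Suc i) = ?X i @ encode_relation (Q ! i) (part L C d i)" by simp
        show ?case using 2(1) P unfolding X by (simp add: Let_def less_Suc_eq all_conj_distrib)
      qed
    next
      case 7
      show ?case by (simp add: algebra_simps sum.distrib)
    next
      case 8
      show ?case by (simp add: build_time_def)
    next
      case 5
      show ?case using P1 s1 by (simp add: rpos_def off_def qlen_def)
    next
      case (9 s2)
      then show ?case by (simp add: encode_input_def)
    qed (use s1 in simp_all)
  qed
qed

end

section \<open>Running the algorithm on all parts\<close>

text \<open>Rows are appended without inspection. Duplicates cannot arise, because distinct
  combinations of classes have disjoint joins.\<close>

definition copy_output :: prog where
  "copy_output = Assign ''nn'' (Arr ''Aout'' (Const 0)) ;; Assign ''oc'' (Add (Reg ''oc'') (Reg ''nn'')) ;;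
     Assign ''q'' (Const 1) ;;
     For ''j'' ''nn'' (For ''c'' ''w'' (Store ''out'' (Reg ''op'') (Arr ''Aout'' (Reg ''q'')) ;;
       Assign ''op'' (Add (Reg ''op'') (Const 1)) ;; Assign ''q'' (Add (Reg ''q'') (Const 1))))"

definition wipe_input :: prog where
  "wipe_input = For ''j'' ''ip'' (Store ''Ain'' (Reg ''j'') (Const 0))"

definition run_part :: "prog \<Rightarrow> prog" where
  "run_part A = decode ;; build ;; If (Reg ''ok'') (logged A ;; copy_output ;; cleanup A) Skip ;; wipe_input"

text \<open>The number of combinations, \<open>kk\<close> to the power \<open>k\<close>, is formed
  by repeated addition. Output cell 0 is reserved for the total count, so \<open>op\<close> starts
  at 1.\<close>

definition run_parts :: "prog \<Rightarrow> prog" where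
  "run_parts A = Assign ''ba'' (Reg ''kk'') ;; Assign ''bn'' (Reg ''k'') ;; Assign ''kt'' (Const 1) ;;
     For ''i'' ''k'' (Assign ''x'' (Const 0) ;; For ''j'' ''kk'' (Assign ''x'' (Add (Reg ''x'') (Reg ''kt''))) ;;
       Assign ''kt'' (Reg ''x'')) ;;
     Assign ''oc'' (Const 0) ;; Assign ''op'' (Const 1) ;;
     For ''v'' ''kt'' (run_part A) ;; Store ''out'' (Const 0) (Reg ''oc'')"

lemma mods_copy_output [simp]:
  "wr copy_output = {''nn'', ''oc'', ''q'', ''j'', ''c'', ''op''}" "wa copy_output = {''out''}"
  "wr wipe_input = {''j''}" "wa wipe_input = {''Ain''}"
  by (auto simp: copy_output_def wipe_input_def)

lemma mods_run_part [simp]: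
  "wr (run_part A) = wr decode \<union> wr build \<union> wr copy_output \<union> wr wipe_input \<union> wr (logged A) \<union> wr (cleanup A)"
  "wa (run_part A) = wa decode \<union> wa build \<union> wa copy_output \<union> wa wipe_input \<union> wa (logged A) \<union> wa (cleanup A)"
  by (auto simp: run_part_def)

context query
begin

abbreviation "ow \<equiv> card (vars Q)"
abbreviation "rows \<equiv> \<lambda>ts. concat (map (encode_tuple (vars Q)) ts)"

lemma length_rows: "length (rows ts) = length ts * ow"
  using finite_vars by (induction ts) auto

lemma runs_copy_output:
  assumes out: "\<And>j. j < length (encode_relation (vars Q) ts) \<Longrightarrow> arr s ''Aout'' j = encode_relation (vars Q) ts ! j"
    and regs: "reg s ''w'' = ow" "reg s ''op'' = length os" and o: "arr s ''out'' = array_of os"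
  shows "runs copy_output s (int (length ts) * (int ow * 5 + 4) + 5) (\<lambda>s'. reg s' ''oc'' = reg s ''oc'' + length ts \<and>
    reg s' ''op'' = length (os @ rows ts) \<and> arr s' ''out'' = array_of (os @ rows ts))"
proof -
  have n: "arr s ''Aout'' 0 = length ts" using out[of 0] by (simp add: encode_relation_def)
  have r: "arr s ''Aout'' (Suc q) = rows ts ! q" if "q < length ts * ow" for q
    using out[of "Suc q"] that by (simp add: encode_relation_def length_rows)
  have bd: "j * ow + c < length ts * ow" if "j < length ts" "c < ow" for j c
  proof -
    have "j * ow + c < Suc j * ow" using that by simp
    also have "\<dots> \<le> length ts * ow" using that by (intro mult_right_mono) auto
    finally show ?thesis .
  qed
  let ?I = "\<lambda>q s. reg s ''q'' = Suc q \<and> reg s ''op'' = length os + q \<and> arr s ''out'' = array_of (os @ take q (rows ts))"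
  show ?thesis
    unfolding copy_output_def runs_Seq_Assign
  proof (rule runs_For_const[where n = "length ts" and c = "int ow * 5 + 2" and I = "\<lambda>j. ?I (j * ow)"], goal_cases)
    case (6 j s1)
    note f1 = frame_reg[OF 6(4)] frame_arr[OF 6(4)] and P = 6(5) and j = 6(1,2)
    have w: "reg s1 ''w'' = ow" using f1 regs by simp
    show ?case
    proof (rule runs_For_const[where n = ow and c = 3 and I = "\<lambda>c. ?I (j * ow + c)"], goal_cases)
      case (6 c s2)
      have "arr s2 ''Aout'' (Suc (j * ow + c)) = rows ts ! (j * ow + c)"
        using frame_arr[OF 6(4)] f1 r[OF bd[OF j(1) 6(1)]] by simp
      moreover have "(array_of (os @ take (j * ow + c) (rows ts)))(length os + (j * ow + c) := rows ts ! (j * ow + c))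
        = array_of (os @ take (Suc (j * ow + c)) (rows ts))"
        using array_of_snoc[of "os @ take (j * ow + c) (rows ts)"] bd[OF j(1) 6(1)]
        by (simp add: take_Suc_conv_app_nth length_rows)
      ultimately show ?case using 6(5) by simp
    next
      case (8 s2)
      then show ?case by (simp add: add.commute)
    qed (use w P in simp_all)
  next
    case 7 show ?case by (simp add: algebra_simps)
  next
    case (8 s1)
    have "reg s1 ''oc'' = reg s ''oc'' + length ts" using frame_reg[OF 8(2)] n by simp
    then show ?case using 8(3) by (simp add: length_rows)
  qed (use n regs o in simp_all)
qed

lemma runs_wipe_input:
  assumes "reg s ''ip'' = n" "\<And>j. n \<le> j \<Longrightarrow> arr s ''Ain'' j = 0"
  shows "runs wipe_input s (int n * 3 + 2) (\<lambda>s'. arr s' ''Ain'' = (\<lambda>_. 0))"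
  unfolding wipe_input_def
proof (rule runs_For_const[where n = n and c = 1 and I = "\<lambda>i s. \<forall>j. j < i \<or> n \<le> j \<longrightarrow> arr s ''Ain'' j = 0"], goal_cases)
  case (8 s1)
  then show ?case by (metis not_le)
qed (use assms in \<open>simp_all add: less_Suc_eq\<close>)

definition input_length :: "(nat \<Rightarrow> tuple list) \<Rightarrow> nat" where
  "input_length L = qlen + (\<Sum>i<k. Suc (length (L i) * width i))"

lemma length_encode_input: "length (encode_input Q L) = input_length L"
  by (simp add: encode_input_def input_length_def qlen_def length_concat_upt length_encode_relation)

lemma length_part_le: "length (part L C d i) \<le> length (L i)"
  unfolding part_def using length_filter_le[of _ "[0..<length (L i)]"] by simp

lemma input_length_part: "input_length (part L C d) \<le> input_length L"
  unfolding input_length_def by (intro add_left_mono sum_mono le_SucI Suc_le_mono[THEN iffD2] mult_right_mono length_part_le) auto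

definition digits :: "nat \<Rightarrow> nat \<Rightarrow> nat \<Rightarrow> nat" where
  "digits K v i = v div K ^ i mod K"

definition sub_time :: "prog \<Rightarrow> nat \<Rightarrow> nat \<Rightarrow> int" where
  "sub_time A t n = 3 * int t + (int n * (int ow * 5 + 4) + 5) +
     (int (length (arrays A)) * (int t * 3 + 1) + int (length (regs A)) + 2)"

definition part_time :: "(nat \<Rightarrow> tuple list) \<Rightarrow> nat \<Rightarrow> int" where
  "part_time L v = (int k * (int v * 3 + 6) + 3) + build_time L + 1 + (int (input_length L) * 3 + 2)"

lemma runs_run_part:
  assumes inp: "arr s ''in'' = array_of (encode_input Q L)"
    and regs: "reg s ''k'' = k" "reg s ''l'' = qlen" "reg s ''w'' = ow" "reg s ''ba'' = K" "reg s ''bn'' = k"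
      "reg s ''v'' = v" "reg s ''op'' = length os"
    and K: "K \<ge> 1" and zw: "\<And>i. i < k \<Longrightarrow> arr s ''zw'' i = width i"
    and C: "\<And>i j. i < k \<Longrightarrow> j < length (L i) \<Longrightarrow> arr s ''cls'' (off L i + j) = C i j"
    and p: "pristine s" and A: "arr s ''Ain'' = (\<lambda>_. 0)" and o: "arr s ''out'' = array_of os"
    and P: "P = part L C (digits K v)"
    and e: "exec A (input_state (encode_input Q P)) t sA" and out: "has_output sA (encode_relation (vars Q) ts)"
    and ts': "ts' = (if \<forall>i<k. P i \<noteq> [] then ts else [])"
  shows "runs (run_part A) s (part_time L v + (if \<forall>i<k. P i \<noteq> [] then sub_time A t (length ts) else 1))
    (\<lambda>s'. pristine s' \<and> arr s' ''Ain'' = (\<lambda>_. 0) \<and> reg s' ''oc'' = reg s ''oc'' + length ts' \<and>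
      reg s' ''op'' = length (os @ rows ts') \<and> arr s' ''out'' = array_of (os @ rows ts'))"
  unfolding run_part_def
proof (rule runs_Seq[OF runs_decode[OF regs(4) K regs(5,6)]], goal_cases)
  case (1 s1)
  note P1 = 1(1) and f1 = frame_reg[OF 1(2)] frame_arr[OF 1(2)]
  have s1: "arr s1 ''in'' = array_of (encode_input Q L)" "reg s1 ''k'' = k" "reg s1 ''l'' = qlen"
    "arr s1 ''Ain'' = (\<lambda>_. 0)" using f1 inp regs A by simp_all
  have zw1: "\<And>i. i < k \<Longrightarrow> arr s1 ''zw'' i = width i" using f1 zw by simp
  have dig1: "\<And>i. i < k \<Longrightarrow> arr s1 ''dig'' i = digits K v i" using P1 by (simp add: digits_def)
  have C1: "\<And>i j. i < k \<Longrightarrow> j < length (L i) \<Longrightarrow> arr s1 ''cls'' (off L i + j) = C i j" using f1 C by simp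
  have p1: "pristine s1" using f1 by (intro pristine_cong[OF p]) simp_all
  have o1: "reg s1 ''w'' = ow" "reg s1 ''op'' = length os" "arr s1 ''out'' = array_of os" "reg s1 ''oc'' = reg s ''oc''"
    using f1 regs o by simp_all
  show ?case
  proof (rule runs_Seq[OF runs_build[where L = L and C = C and d = "digits K v", OF s1(1-3) zw1 dig1 C1 s1(4)]], goal_cases)
    case (5 s2)
    note f2 = frame_reg[OF 5(2)] frame_arr[OF 5(2)]
    have b: "arr s2 ''Ain'' = array_of (encode_input Q P)" "reg s2 ''ip'' = input_length P"
      "reg s2 ''ok'' \<noteq> 0 \<longleftrightarrow> (\<forall>i<k. P i \<noteq> [])"
      using 5(1) unfolding P length_encode_input by blast+
    have p2: "pristine s2" using f2 by (intro pristine_cong[OF p1]) simp_all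
    have o2: "reg s2 ''w'' = ow" "reg s2 ''op'' = length os" "arr s2 ''out'' = array_of os" "reg s2 ''oc'' = reg s ''oc''"
      using f2 o1 by simp_all
    have le: "int (input_length P) \<le> int (input_length L)" using input_length_part P by simp
    show ?case
    proof (cases "\<forall>i<k. P i \<noteq> []")
      case False
      then have ok: "reg s2 ''ok'' = 0" and ts0: "ts' = []" using b(3) ts' by auto
      have Z: "arr s2 ''Ain'' j = 0" if "input_length P \<le> j" for j
        using that by (simp add: b(1) array_of_def length_encode_input)
      have "runs wipe_input s2 (int (input_length L) * 3 + 2)
        (\<lambda>s'. pristine s' \<and> arr s' ''Ain'' = (\<lambda>_. 0) \<and> reg s' ''oc'' = reg s ''oc'' + length ts' \<and>
          reg s' ''op'' = length (os @ rows ts') \<and> arr s' ''out'' = array_of (os @ rows ts'))"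
      proof (rule runs_mono[OF runs_wipe_input[OF b(2) Z]], goal_cases)
        case (3 s3)
        note f3 = frame_reg[OF 3(2)] frame_arr[OF 3(2)]
        have "pristine s3" using f3 by (intro pristine_cong[OF p2]) simp_all
        then show ?case using 3(1) f3 o2 ts0 by simp
      qed (use le in simp_all)
      then show ?thesis unfolding if_not_P[OF False] using ok by (simp add: part_time_def add.commute)
    next
      case True
      then have ok: "reg s2 ''ok'' \<noteq> 0" and ts0: "ts' = ts" using b(3) ts' by auto
      have A2: "arr s2 ''Ain'' = arr (input_state (encode_input Q P)) ''in''" by (simp add: b(1) input_state_in)
      have "runs (logged A ;; (copy_output ;; cleanup A) ;; wipe_input) s2
        (sub_time A t (length ts) + (int (input_length L) * 3 + 2))
        (\<lambda>s'. pristine s' \<and> arr s' ''Ain'' = (\<lambda>_. 0) \<and> reg s' ''oc'' = reg s ''oc'' + length ts' \<and>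
          reg s' ''op'' = length (os @ rows ts') \<and> arr s' ''out'' = array_of (os @ rows ts'))"
      proof (rule runs_Seq[OF runs_logged[OF p2 A2 e]], goal_cases)
        case (1 s3)
        note d3 = 1(1) and f3 = frame_reg[OF 1(2)] frame_arr[OF 1(2)]
        have o3: "reg s3 ''w'' = ow" "reg s3 ''op'' = length os" "arr s3 ''out'' = array_of os"
          "reg s3 ''oc'' = reg s ''oc''" "reg s3 ''ip'' = input_length P"
          using f3 o2 b by simp_all
        have out3: "arr s3 ''Aout'' j = encode_relation (vars Q) ts ! j" if "j < length (encode_relation (vars Q) ts)" for j
        proof -
          have "arr s3 (sub_name ''out'') = arr sA ''out''" using d3 unfolding dirty_def simulates_def by blast
          then show ?thesis using out that unfolding has_output_def by simp
        qed
        show ?case unfolding runs_Seq_assoc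
        proof (rule runs_Seq[OF runs_copy_output[OF out3 o3(1-3)]], goal_cases)
          case (2 s4)
          note P4 = 2(1) and f4 = frame_reg[OF 2(2)] frame_arr[OF 2(2)]
          \<comment> \<open>Copying touches neither the memory of the subroutine nor its logs, so
            the cleanup can wait until the output is saved.\<close>
          have d4: "dirty A (encode_input Q P) t sA s4"
            using d3 f4 unfolding dirty_def simulates_def by simp
          have ip4: "reg s4 ''ip'' = input_length P" using f4 o3 by simp
          show ?case
          proof (rule runs_Seq[OF runs_cleanup[OF d4]], goal_cases)
            case (1 s5)
            note P5 = 1(1) and f5 = frame_reg[OF 1(2)] frame_arr[OF 1(2)]
            have s5: "reg s5 ''ip'' = input_length P" "reg s5 ''oc'' = reg s4 ''oc''" "reg s5 ''op'' = reg s4 ''op''"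
              "arr s5 ''out'' = arr s4 ''out''" using f5 ip4 by simp_all
            have Z: "arr s5 ''Ain'' j = 0" if "input_length P \<le> j" for j
              using P5 that by (simp add: length_encode_input)
            show ?case
            proof (rule runs_mono[OF runs_wipe_input[OF s5(1) Z]], goal_cases)
              case (3 s6)
              note f6 = frame_reg[OF 3(2)] frame_arr[OF 3(2)]
              have p5: "pristine s5" using P5 by blast
              have "pristine s6" using f6 by (intro pristine_cong[OF p5]) simp_all
              moreover have "reg s6 ''oc'' = reg s4 ''oc''" "reg s6 ''op'' = reg s4 ''op''"
                "arr s6 ''out'' = arr s4 ''out''" using f6 s5 by simp_all
              ultimately show ?case using 3(1) P4 o3(4) ts0 by simp
            qed (use le in \<open>simp_all add: sub_time_def\<close>)
          qed
        qed simp
      qed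
      then show ?thesis using ok True by (simp add: part_time_def add.commute add.left_commute)
    qed
  qed simp_all
qed

definition parts_time :: "prog \<Rightarrow> (nat \<Rightarrow> tuple list) \<Rightarrow> nat \<Rightarrow> (nat \<Rightarrow> bool) \<Rightarrow> (nat \<Rightarrow> nat) \<Rightarrow> (nat \<Rightarrow> nat) \<Rightarrow> int" where
  "parts_time A L K full t n = int k * (int K * 3 + 6) + 10 +
     (\<Sum>v<K ^ k. part_time L v + (if full v then sub_time A (t v) (n v) else 1) + 2)"

lemma runs_run_parts:
  assumes inp: "arr s ''in'' = array_of (encode_input Q L)"
    and regs: "reg s ''k'' = k" "reg s ''l'' = qlen" "reg s ''w'' = ow" "reg s ''kk'' = K"
    and K: "K \<ge> 1" and zw: "\<And>i. i < k \<Longrightarrow> arr s ''zw'' i = width i"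
    and C: "\<And>i j. i < k \<Longrightarrow> j < length (L i) \<Longrightarrow> arr s ''cls'' (off L i + j) = C i j"
    and p: "pristine s" and A: "arr s ''Ain'' = (\<lambda>_. 0)" and o: "arr s ''out'' = (\<lambda>_. 0)"
    and P: "\<And>v. P v = part L C (digits K v)"
    and e: "\<And>v. exec A (input_state (encode_input Q (P v))) (t v) (sA v)"
    and out: "\<And>v. has_output (sA v) (encode_relation (vars Q) (ts v))"
    and full: "\<And>v. full v \<longleftrightarrow> (\<forall>i<k. P v i \<noteq> [])"
  shows "runs (run_parts A) s (parts_time A L K full t (\<lambda>v. length (ts v)))
    (\<lambda>s'. has_output s' (encode_relation (vars Q) (concat (map (\<lambda>v. if full v then ts v else []) [0..<K ^ k]))))"
proof -
  let ?ts = "\<lambda>v. concat (map (\<lambda>v. if full v then ts v else []) [0..<v])"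
  let ?T = "\<Sum>v<K ^ k. part_time L v + (if full v then sub_time A (t v) (length (ts v)) else 1) + 2"
  show ?thesis
    unfolding run_parts_def runs_Seq_Assign
  proof (rule runs_For_Seq[where n = k and c = "int K * 3 + 4" and I = "\<lambda>i s. reg s ''kt'' = K ^ i"], goal_cases)
    case (6 i s1)
    have kk: "reg s1 ''kk'' = K" using frame_reg[OF 6(4)] regs by simp
    show ?case unfolding runs_Seq_Assign
    proof (rule runs_For_Seq[where n = K and c = 1 and I = "\<lambda>j s. reg s ''x'' = j * K ^ i"], goal_cases)
      case (6 j s2)
      have "reg s2 ''kt'' = K ^ i" using frame_reg[OF 6(4)] \<open>reg s1 ''kt'' = K ^ i\<close> by simp
      then show ?case using 6(5) by simp
    qed (use kk in simp_all)
  next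
    case (7 s1)
    note f1 = frame_reg[OF 7(2)] frame_arr[OF 7(2)]
    have s1: "reg s1 ''kt'' = K ^ k" "reg s1 ''ba'' = K" "reg s1 ''bn'' = k" "reg s1 ''k'' = k" "reg s1 ''l'' = qlen"
      "reg s1 ''w'' = ow" "arr s1 = arr s"
      using f1 7(3) regs by (simp_all add: fun_eq_iff)
    have p1: "pristine s1" using f1 by (intro pristine_cong[OF p]) simp_all
    show ?case unfolding runs_Seq_Assign
    proof (rule runs_Seq[OF runs_For[where n = "K ^ k" and
        c = "\<lambda>v. part_time L v + (if full v then sub_time A (t v) (length (ts v)) else 1)" and T = "?T + 2" and
        I = "\<lambda>v s. pristine s \<and> arr s ''Ain'' = (\<lambda>_. 0) \<and> reg s ''oc'' = length (?ts v) \<and>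
          reg s ''op'' = length (0 # rows (?ts v)) \<and> arr s ''out'' = array_of (0 # rows (?ts v))"]], goal_cases)
      case (6 v s2)
      note f2 = frame_reg[OF 6(4)] frame_arr[OF 6(4)] and P2 = 6(5) and v = 6(1,2)
      have s2: "arr s2 ''in'' = array_of (encode_input Q L)" "reg s2 ''k'' = k" "reg s2 ''l'' = qlen" "reg s2 ''w'' = ow"
        "reg s2 ''ba'' = K" "reg s2 ''bn'' = k"
        using f2 s1 inp by simp_all
      have s2': "reg s2 ''op'' = length (0 # rows (?ts v))" "pristine s2" "arr s2 ''Ain'' = (\<lambda>_. 0)"
        "arr s2 ''out'' = array_of (0 # rows (?ts v))" "reg s2 ''oc'' = length (?ts v)" using P2 by blast+
      have zw2: "\<And>i. i < k \<Longrightarrow> arr s2 ''zw'' i = width i" using f2 s1 zw by simp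
      have C2: "\<And>i j. i < k \<Longrightarrow> j < length (L i) \<Longrightarrow> arr s2 ''cls'' (off L i + j) = C i j" using f2 s1 C by simp
      note run = runs_run_part[where L = L and C = C and os = "0 # rows (?ts v)" and P = "P v",
          OF s2 v(2) s2'(1) K zw2 C2 s2'(2-4) P e out refl]
      show ?case
      proof (rule runs_mono[OF run], goal_cases)
        case 4 show ?case using full[of v] by simp
      next
        case (5 s3)
        have "?ts (Suc v) = ?ts v @ (if \<forall>i<k. P v i \<noteq> [] then ts v else [])" using full[of v] by simp
        then show ?case using 5(1) s2'(5) by (simp add: pristine_def)
      qed simp_all
    next
      case (8 s2)
      let ?R = "?ts (K ^ k)"
      have "arr s2 ''out'' = array_of ([] @ 0 # rows ?R)" "reg s2 ''oc'' = length ?R" using 8(1) by simp_all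
      then have "(arr s2 ''out'')(0 := reg s2 ''oc'') = array_of (encode_relation (vars Q) ?R)"
        using array_of_patch[of "[]" 0 "rows ?R"] by (simp add: encode_relation_def)
      then have "has_output (s2\<lparr>arr := (arr s2)(''out'' := (arr s2 ''out'')(0 := reg s2 ''oc''))\<rparr>)
          (encode_relation (vars Q) ?R)"
        by (simp add: has_output_def array_of_nth)
      then show ?case by (simp add: parts_time_def algebra_simps)
    next
      case 5
      show ?case using p1 s1 A o array_of_zero[of "[]"] by (simp add: pristine_def array_of_Nil)
    qed (use s1 in simp_all)
  qed (use regs in simp_all)
qed

end

section \<open>Degrees of the classes\<close>

text \<open>Adding \<open>d k * K ^ k\<close> to a number below \<open>K ^ k\<close> sets digit k
  and leaves the lower digits alone. The lemma supplies mask numbers in base 2 and combinations of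
  classes in base \<open>KK\<close>.\<close>

lemma ex_digits:
  assumes "\<And>i. i < k \<Longrightarrow> d i < (K::nat)"
  shows "\<exists>v<K ^ k. \<forall>i<k. v div K ^ i mod K = d i"
  using assms
proof (induction k)
  case 0 then show ?case by simp
next
  case (Suc k)
  then obtain v where v: "v < K ^ k" "\<And>i. i < k \<Longrightarrow> v div K ^ i mod K = d i" by (metis less_SucI)
  have K: "K > 0" using Suc.prems[of 0] by simp
  have dk: "d k < K" using Suc.prems by simp
  let ?v = "v + d k * K ^ k"
  have "?v < Suc (d k) * K ^ k" using v(1) by simp
  also have "\<dots> \<le> K * K ^ k" using dk by (intro mult_right_mono) auto
  finally have "?v < K ^ Suc k" by simp
  moreover have "?v div K ^ i mod K = d i" if "i < Suc k" for i
  proof (cases "i = k")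
    case True
    then show ?thesis using v(1) dk K by simp
  next
    case False
    then have i: "i < k" using that by simp
    have "K ^ k = K ^ (k - i) * K ^ i" using i by (simp flip: power_add)
    then have "?v div K ^ i = v div K ^ i + d k * K ^ (k - i)" using K by (simp add: mult.assoc[symmetric])
    also have "K ^ (k - i) = K * K ^ (k - i - 1)"
    proof -
      have "k - i = Suc (k - i - 1)" using i by simp
      then show ?thesis by (metis power_Suc)
    qed
    finally have "?v div K ^ i mod K = v div K ^ i mod K" by (simp add: mult.left_commute)
    then show ?thesis using v(2)[OF i] by simp
  qed
  ultimately show ?case by blast
qed

text \<open>Uniqueness of digits keeps the combinations of classes apart.\<close>

lemma digits_eq:
  assumes "v < K ^ k" "w < K ^ k" "\<And>i. i < k \<Longrightarrow> v div K ^ i mod K = w div K ^ i mod (K::nat)"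
  shows "v = w"
  using assms
proof (induction k arbitrary: v w)
  case 0 then show ?case by simp
next
  case (Suc k)
  have "v div K = w div K"
  proof (rule Suc.IH)
    show "v div K < K ^ k" "w div K < K ^ k"
      using Suc.prems(1,2) by (simp_all add: less_mult_imp_div_less mult.commute)
    fix i assume "i < k"
    then show "v div K div K ^ i mod K = w div K div K ^ i mod K"
      using Suc.prems(3)[of "Suc i"] by (simp add: div_mult2_eq)
  qed
  moreover have "v mod K = w mod K" using Suc.prems(3)[of 0] by simp
  ultimately show ?case by (metis div_mult_mod_eq)
qed

lemma masked_eq_iff:
  "masked B z f = masked B' z f' \<longleftrightarrow> (\<forall>c<z. B c = B' c \<and> (B c \<longrightarrow> f c = f' c))"
  by (auto simp: masked_def map_eq_conv split: if_splits)

text \<open>The trie word of the restriction to X, for columns in the order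
  \<open>zs\<close>.\<close>

definition mask :: "nat list \<Rightarrow> nat set \<Rightarrow> tuple \<Rightarrow> nat list" where
  "mask zs X t = masked (\<lambda>c. zs ! c \<in> X) (length zs) (\<lambda>c. the (t (zs ! c)))"

text \<open>Zero letters reveal the set. Inside the domains, comparing the values
  \<open>the (t x)\<close> compares the tuples, which is why the sets are required to lie
  there.\<close>

lemma mask_eq_iff:
  assumes "X \<subseteq> set zs" "X' \<subseteq> set zs" "X \<subseteq> dom t" "X' \<subseteq> dom t'"
  shows "mask zs X t = mask zs X' t' \<longleftrightarrow> X = X' \<and> t |` X = t' |` X'"
proof
  assume e: "mask zs X t = mask zs X' t'"
  then have *: "zs ! c \<in> X \<longleftrightarrow> zs ! c \<in> X'" "zs ! c \<in> X \<Longrightarrow> the (t (zs ! c)) = the (t' (zs ! c))" if "c < length zs" for c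
    using that unfolding mask_def masked_eq_iff by blast+
  have X: "X = X'"
  proof (rule set_eqI)
    fix x
    have "x \<in> X \<longleftrightarrow> x \<in> X'" if "x \<in> set zs"
    proof -
      obtain c where "c < length zs" "x = zs ! c" using \<open>x \<in> set zs\<close> by (metis in_set_conv_nth)
      then show ?thesis using *(1) by simp
    qed
    then show "x \<in> X \<longleftrightarrow> x \<in> X'" using subsetD[OF assms(1), of x] subsetD[OF assms(2), of x] by argo
  qed
  have "t x = t' x" if "x \<in> X" for x
  proof -
    have "x \<in> set zs" using that assms(1) by blast
    then obtain c where c: "c < length zs" "x = zs ! c" by (metis in_set_conv_nth)
    then have "the (t x) = the (t' x)" using *(2) that by blast
    moreover have "x \<in> dom t" "x \<in> dom t'" using that assms(3,4) X by blast+
    ultimately show ?thesis by auto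
  qed
  then have "t |` X = t' |` X'" using X by (simp add: restrict_map_def fun_eq_iff)
  then show "X = X' \<and> t |` X = t' |` X'" using X by blast
next
  assume e: "X = X' \<and> t |` X = t' |` X'"
  then have "t x = t' x" if "x \<in> X" for x using that by (metis restrict_in)
  then show "mask zs X t = mask zs X' t'" using e by (simp add: mask_def masked_eq_iff)
qed

lemma mask_restrict: "X \<subseteq> Y \<Longrightarrow> mask zs X (t |` Y) = mask zs X t"
  by (auto simp: mask_def masked_eq_iff)

lemma degree_le_iff:
  "degree R X Y \<le> enat d \<longleftrightarrow> (\<forall>x. dom x = X \<longrightarrow> card (project Y (select X x R)) \<le> d)"
  by (auto simp: degree_def SUP_le_iff)

text \<open>Extended naturals are well-ordered, so the infimum over a nonempty family is attained; a
  finite value excludes the empty family.\<close>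

lemma partition_degree_attained:
  assumes "partition_degree R F Y = enat d"
  obtains P where "P \<in> partitions R F" "\<And>X. X \<in> F \<Longrightarrow> degree (P X) X Y \<le> enat d"
proof -
  let ?g = "\<lambda>P. SUP X\<in>F. degree (P X) X Y"
  have ne: "partitions R F \<noteq> {}"
  proof
    assume "partitions R F = {}"
    then have "partition_degree R F Y = \<infinity>" by (simp add: partition_degree_def top_enat_def)
    then show False using assms by simp
  qed
  have "Inf (?g ` partitions R F) \<in> ?g ` partitions R F"
    using ne by (intro wellorder_InfI[of "?g (SOME P. P \<in> partitions R F)"]) (simp add: some_in_eq)
  then obtain P where P: "P \<in> partitions R F" "enat d = ?g P"
    using assms unfolding partition_degree_def by force
  show ?thesis
  proof (rule that[OF P(1)])
    fix X assume "X \<in> F"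
    then show "degree (P X) X Y \<le> enat d" unfolding P(2) by (rule SUP_upper)
  qed
qed

text \<open>The edge format has exactly m ends, so a smaller F is padded by repeating one of its
  elements. This is why ends are counted with multiplicity.\<close>

lemma ex_enumeration:
  assumes "finite F" "F \<noteq> {}" "card F \<le> m"
  obtains X where "X ` {1..m::nat} = F"
proof -
  obtain h where h: "bij_betw h {1..card F} F" using assms(1) by (metis ex_bij_betw_nat_finite_1)
  obtain a where a: "a \<in> F" using assms(2) by blast
  have "(\<lambda>b. if b \<le> card F then h b else a) ` {1..m} = F"
  proof
    show "(\<lambda>b. if b \<le> card F then h b else a) ` {1..m} \<subseteq> F" using h a by (auto simp: bij_betw_def)
    show "F \<subseteq> (\<lambda>b. if b \<le> card F then h b else a) ` {1..m}"
    proof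
      fix y assume "y \<in> F"
      then have "y \<in> h ` {1..card F}" using h by (simp add: bij_betw_def)
      then obtain b where "b \<in> {1..card F}" "y = h b" by blast
      then show "y \<in> (\<lambda>b. if b \<le> card F then h b else a) ` {1..m}"
        using assms(3) by (intro image_eqI[of _ _ b]) auto
    qed
  qed
  then show ?thesis using that by blast
qed

text \<open>Some mask number spells out Y and an enumeration of F. A partition that attains d is an
  orientation of in-degree d, so the labelling for this mask has load at most
  \<open>2 * m * d\<close>. Its label is constant on a class and names the X that serves for the
  whole class.\<close>

lemma class_degree_le:
  assumes cl: "classified (length ts) (2 ^ l) l (length zs) (\<lambda>j c. the ((ts ! j) (zs ! c)))
      (2 ^ (l * Suc (2 ^ l))) C"
    and zl: "length zs \<le> l" and dom: "\<And>t. t \<in> set ts \<Longrightarrow> dom t = set zs"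
    and Y: "Y \<subseteq> set zs" and F: "F \<subseteq> Pow Y" "F \<noteq> {}"
    and pd: "partition_degree (set ts) F Y = enat d"
  shows "\<exists>X\<in>F. degree {ts ! j | j. j < length ts \<and> C j = c} X Y \<le> enat (2 * 2 ^ l * d)"
proof -
  define m :: nat where "m = 2 ^ l"
  let ?n = "length ts" and ?z = "length zs"
  have finY: "finite Y" using Y finite_subset by blast
  have finF: "finite F" using F(1) finY by (meson finite_Pow_iff finite_subset)
  have "card F \<le> card (Pow Y)" using F(1) finY by (intro card_mono) auto
  also have "\<dots> = 2 ^ card Y" using finY by (rule card_Pow)
  also have "\<dots> \<le> (2::nat) ^ l"
  proof (rule power_increasing)
    have "card Y \<le> card (set zs)" using Y by (intro card_mono) auto
    then show "card Y \<le> l" using card_length[of zs] zl by linarith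
  qed simp
  finally have cF: "card F \<le> m" by (simp add: m_def)
  obtain X0 where X0: "X0 ` {1..m} = F" using ex_enumeration[OF finF F(2) cF] by blast
  \<comment> \<open>Block 0 is reserved for Y itself; the enumeration of F starts at 1.\<close>
  define X where "X = (\<lambda>b. if b = 0 then Y else X0 b)"
  have XF: "X b \<in> F" if "b \<in> {1..m}" for b using X0 that by (auto simp: X_def)
  have XY: "X b \<subseteq> Y" if "b \<le> m" for b using XF[of b] F(1) that by (cases "b = 0") (auto simp: X_def)
  have FX: "\<exists>b\<in>{1..m}. X b = x" if xF: "x \<in> F" for x
  proof -
    obtain b where "b \<in> {1..m}" "X0 b = x" using X0 xF by blast
    then show ?thesis by (intro bexI[of _ b]) (auto simp: X_def)
  qed
  \<comment> \<open>Bit q belongs to column \<open>q mod l\<close> of block \<open>q div l\<close>;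
    positions beyond the columns of the atom are set to 0.\<close>
  define \<beta> where "\<beta> = (\<lambda>q. if q mod l < ?z \<and> zs ! (q mod l) \<in> X (q div l) then 1 else 0 :: nat)"
  obtain v where v: "v < 2 ^ (l * Suc m)" "\<And>q. q < l * Suc m \<Longrightarrow> v div 2 ^ q mod 2 = \<beta> q"
  proof -
    have "\<beta> q < 2" for q by (simp add: \<beta>_def)
    then show ?thesis using ex_digits[of "l * Suc m" \<beta> 2] that by blast
  qed
  have bit: "bit_of v (b * l + q) \<longleftrightarrow> zs ! q \<in> X b" if "b \<le> m" "q < ?z" for b q
  proof -
    have ql: "q < l" using that zl by simp
    have "b * l + q < Suc b * l" using ql by simp
    also have "\<dots> \<le> Suc m * l" using that by (intro mult_right_mono) auto
    finally have "b * l + q < l * Suc m" by (simp add: mult.commute)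
    then have "v div 2 ^ (b * l + q) mod 2 = \<beta> (b * l + q)" by (rule v(2))
    moreover have "(b * l + q) div l = b" "(b * l + q) mod l = q" using ql by simp_all
    ultimately show ?thesis using that by (simp add: bit_of_def \<beta>_def)
  qed
  define key where "key = (\<lambda>j. block_key l ?z (\<lambda>c. the ((ts ! j) (zs ! c))) v)"
  have key: "key j b = mask zs (X b) (ts ! j)" if "b \<le> m" for j b
  proof -
    have "zs ! q \<in> X 0 \<and> zs ! q \<in> X b \<longleftrightarrow> zs ! q \<in> X b" for q using XY[OF that] by (auto simp: X_def)
    then show ?thesis using bit[of 0] bit[OF that] by (auto simp: key_def block_key_def mask_def masked_eq_iff)
  qed
  have dj: "dom (ts ! j) = set zs" if "j < ?n" for j using dom that by simp
  have key_eq: "key j b = key j' b' \<longleftrightarrow> X b = X b' \<and> (ts ! j) |` X b = (ts ! j') |` X b'"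
    if "j < ?n" "j' < ?n" "b \<le> m" "b' \<le> m" for j j' b b'
    unfolding key[OF that(3)] key[OF that(4)]
    by (rule mask_eq_iff) (use XY that Y dj in blast)+
  define h where "h = mask zs Y"
  have h: "h ((ts ! j) |` Y) = key j 0" for j
    unfolding h_def by (simp add: key mask_restrict) (simp add: X_def)
  have fin_project: "finite (project Y (select X x R))" if "R \<subseteq> set ts" for X x R
  proof -
    have "select X x R \<subseteq> set ts" using that by (auto simp: select_def)
    then show ?thesis unfolding project_def by (meson finite_imageI finite_set finite_subset)
  qed
  obtain P where P: "P \<in> partitions (set ts) F" "\<And>X. X \<in> F \<Longrightarrow> degree (P X) X Y \<le> enat d"
    using partition_degree_attained[OF pd] by blast
  have "orientable_keys ?n m key d"
  proof -
    \<comment> \<open>A row is oriented towards the X whose part contains it.\<close>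
    have "\<exists>b\<in>{1..m}. ts ! j \<in> P (X b)" if "j < ?n" for j
    proof -
      have "ts ! j \<in> (\<Union>X\<in>F. P X)" using P(1) that by (simp add: partitions_def)
      then show ?thesis using FX by blast
    qed
    then obtain f where f: "\<And>j. j < ?n \<Longrightarrow> f j \<in> {1..m}" "\<And>j. j < ?n \<Longrightarrow> ts ! j \<in> P (X (f j))" by metis
    have "card ((\<lambda>j. key j 0) ` {j. j < ?n \<and> key j (f j) = u}) \<le> d" for u
    proof (cases "{j. j < ?n \<and> key j (f j) = u} = {}")
      case False
      then obtain j0 where j0: "j0 < ?n" "key j0 (f j0) = u" by blast
      let ?X = "X (f j0)" and ?x = "(ts ! j0) |` X (f j0)"
      have XfF: "?X \<in> F" using XF f(1)[OF j0(1)] by blast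
      have PR: "P ?X \<subseteq> set ts" using P(1) XfF by (auto simp: partitions_def)
      \<comment> \<open>The vertex u is a pair of X and a value x, so the rows sent to it lie in a
        single selection from a single part, and the degree of that part bounds their
        projections.\<close>
      have "(\<lambda>j. key j 0) ` {j. j < ?n \<and> key j (f j) = u} \<subseteq> h ` project Y (select ?X ?x (P ?X))"
      proof
        fix w assume "w \<in> (\<lambda>j. key j 0) ` {j. j < ?n \<and> key j (f j) = u}"
        then obtain j where j: "j < ?n" "key j (f j) = u" "w = key j 0" by blast
        have "X (f j) = ?X \<and> (ts ! j) |` X (f j) = ?x"
        proof -
          have fm: "f j \<le> m" "f j0 \<le> m" using f(1)[OF j(1)] f(1)[OF j0(1)] by simp_all
          have "key j (f j) = key j0 (f j0)" using j(2) j0(2) by simp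
          then show ?thesis unfolding key_eq[OF j(1) j0(1) fm] .
        qed
        then have "X (f j) = ?X" "(ts ! j) |` ?X = ?x" by metis+
        then have "ts ! j \<in> select ?X ?x (P ?X)" using f(2)[OF j(1)] by (simp add: select_def)
        then have "(ts ! j) |` Y \<in> project Y (select ?X ?x (P ?X))" unfolding project_def by blast
        then show "w \<in> h ` project Y (select ?X ?x (P ?X))" using h j(3) by (metis imageI)
      qed
      then have "card ((\<lambda>j. key j 0) ` {j. j < ?n \<and> key j (f j) = u}) \<le> card (h ` project Y (select ?X ?x (P ?X)))"
        by (intro card_mono finite_imageI fin_project[OF PR])
      also have "\<dots> \<le> card (project Y (select ?X ?x (P ?X)))"
        by (intro card_image_le fin_project[OF PR])
      also have "\<dots> \<le> d"
      proof -
        have "f j0 \<le> m" using f(1)[OF j0(1)] by simp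
        then have "dom ?x = ?X" using XY Y dj[OF j0(1)] by auto
        then show ?thesis using P(2)[OF XfF] unfolding degree_le_iff by blast
      qed
      finally show ?thesis .
    qed (simp only: image_empty card.empty zero_le)
    then show ?thesis using f(1) unfolding orientable_keys_def by blast
  qed
  moreover obtain lab where bal: "balanced_labels ?n m key lab"
    and lab: "\<And>j j'. j < ?n \<Longrightarrow> j' < ?n \<Longrightarrow> C j = C j' \<Longrightarrow> lab j = lab j'"
    using cl v(1) unfolding classified_def m_def[symmetric] key_def by metis
  ultimately have load: "card ((\<lambda>j. key j 0) ` {j. j < ?n \<and> lab j = b \<and> key j b = u}) \<le> 2 * m * d" for b u
    unfolding balanced_labels_def by blast
  let ?R = "{ts ! j | j. j < ?n \<and> C j = c}"
  show ?thesis
  proof (cases "?R = {}")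
    case True
    \<comment> \<open>An empty class meets any bound, so an arbitrary element of F serves.\<close>
    obtain x where "x \<in> F" using F(2) by blast
    moreover have "degree {} x Y \<le> enat (2 * 2 ^ l * d)" by (simp add: degree_le_iff project_def select_def)
    ultimately show ?thesis unfolding True by blast
  next
    case False
    then obtain j1 where j1: "j1 < ?n" "C j1 = c" by blast
    \<comment> \<open>Any row of the class will do, since equal classes have equal labels.\<close>
    define b where "b = lab j1"
    have b: "b \<in> {1..m}" using bal j1 unfolding balanced_labels_def b_def by blast
    have bm: "b \<le> m" using b by simp
    have "card (project Y (select (X b) x ?R)) \<le> 2 * m * d" for x
    proof (cases "select (X b) x ?R = {}")
      case False
      then obtain j0 where j0: "j0 < ?n" "C j0 = c" "(ts ! j0) |` X b = x" by (auto simp: select_def)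
      have sub: "h ` project Y (select (X b) x ?R) \<subseteq> (\<lambda>j. key j 0) ` {j. j < ?n \<and> lab j = b \<and> key j b = key j0 b}"
      proof
        fix w assume "w \<in> h ` project Y (select (X b) x ?R)"
        then obtain j where j: "j < ?n" "C j = c" "(ts ! j) |` X b = x" "w = h ((ts ! j) |` Y)"
          by (auto simp: select_def project_def)
        have "lab j = b" using lab[OF j(1) j1(1)] j(2) j1(2) by (simp add: b_def)
        moreover have "key j b = key j0 b" using key_eq[OF j(1) j0(1) bm bm] j(3) j0(3) by simp
        ultimately show "w \<in> (\<lambda>j. key j 0) ` {j. j < ?n \<and> lab j = b \<and> key j b = key j0 b}"
          using j(1,4) h by blast
      qed
      \<comment> \<open>Block 0 is the mask of Y, so \<open>h\<close> distinguishes projections to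
        Y, and the load counts them without loss.\<close>
      have "inj_on h (project Y (select (X b) x ?R))"
      proof (rule inj_onI)
        fix y y' assume y: "y \<in> project Y (select (X b) x ?R)" "y' \<in> project Y (select (X b) x ?R)" "h y = h y'"
        obtain j where j: "j < ?n" "y = (ts ! j) |` Y" using y(1) by (auto simp: select_def project_def)
        obtain j' where j': "j' < ?n" "y' = (ts ! j') |` Y" using y(2) by (auto simp: select_def project_def)
        have "key j 0 = key j' 0" using y(3) h j(2) j'(2) by simp
        then show "y = y'" using key_eq[OF j(1) j'(1), of 0 0] j(2) j'(2) by (simp add: X_def)
      qed
      then have "card (project Y (select (X b) x ?R)) = card (h ` project Y (select (X b) x ?R))"
        by (simp add: card_image)
      also have "\<dots> \<le> card ((\<lambda>j. key j 0) ` {j. j < ?n \<and> lab j = b \<and> key j b = key j0 b})"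
        by (intro card_mono sub finite_imageI) simp
      also have "\<dots> \<le> 2 * m * d" by (rule load)
      finally show ?thesis .
    qed (simp add: project_def)
    then have "degree ?R (X b) Y \<le> enat (2 * m * d)" by (simp add: degree_le_iff)
    then show ?thesis using XF[OF b] unfolding m_def by blast
  qed
qed

section \<open>The algorithm\<close>

definition prepare :: prog where
  "prepare = parse_query ;; bound_values ;; set_parameters ;; classify"

definition partition_join :: "prog \<Rightarrow> prog" where
  "partition_join A = prepare ;; run_parts A"

lemma orientable_keys_cong:
  assumes "\<And>j. j < n \<Longrightarrow> key j = key' j" "orientable_keys n m key d"
  shows "orientable_keys n m key' d"
proof -
  have "(\<lambda>j. key j 0) ` {j. j < n \<and> key j (f j) = u} = (\<lambda>j. key' j 0) ` {j. j < n \<and> key' j (f j) = u}" for f u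
    using assms(1) by (intro image_cong Collect_cong) auto
  then show ?thesis using assms(2) unfolding orientable_keys_def by simp
qed

lemma balanced_labels_cong:
  assumes "\<And>j. j < n \<Longrightarrow> key j = key' j" "balanced_labels n m key lab"
  shows "balanced_labels n m key' lab"
proof -
  have eq: "(\<lambda>j. key' j 0) ` {j. j < n \<and> lab j = b \<and> key' j b = u}
      = (\<lambda>j. key j 0) ` {j. j < n \<and> lab j = b \<and> key j b = u}" for b u
    using assms(1) by (intro image_cong Collect_cong) auto
  show ?thesis unfolding balanced_labels_def eq
  proof (intro conjI impI allI)
    fix d b u assume d: "orientable_keys n m key' d"
    have "orientable_keys n m key d" by (rule orientable_keys_cong[OF _ d]) (simp add: assms(1))
    then show "card ((\<lambda>j. key j 0) ` {j. j < n \<and> lab j = b \<and> key j b = u}) \<le> 2 * m * d"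
      using assms(2) by (simp add: balanced_labels_def)
  qed (use assms(2) in \<open>simp add: balanced_labels_def\<close>)
qed

lemma classified_key_cong:
  assumes "\<And>j c. j < n \<Longrightarrow> c < z \<Longrightarrow> f j c = f' j c" "classified n m l z f tot C"
  shows "classified n m l z f' tot C"
proof -
  have "block_key l z (f j) v = block_key l z (f' j) v" if "j < n" for j v
    using assms(1)[OF that] by (auto simp: block_key_def masked_eq_iff fun_eq_iff)
  then have "balanced_labels n m (\<lambda>j. block_key l z (f' j) v) lab"
    if "balanced_labels n m (\<lambda>j. block_key l z (f j) v) lab" for v lab
    by (rule balanced_labels_cong[OF _ that]) simp
  then show ?thesis using assms(2) unfolding classified_def by blast
qed

context query
begin

text \<open>Three parameters of the query alone: ends per edge, number of masks, and classes per
  atom.\<close>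

definition mm :: nat where "mm = 2 ^ qlen"
definition masks :: nat where "masks = 2 ^ (qlen * Suc mm)"
definition KK :: nat where "KK = Suc mm ^ masks"

definition prepare_time :: "(nat \<Rightarrow> tuple list) \<Rightarrow> int" where
  "prepare_time L = ((\<Sum>i<k. int (width i) * 7 + 7) + 6) +
     ((\<Sum>i<k. int (length (L i)) * (int (width i) * 4 + 4) + 8) + 4) +
     (int qlen * 3 + int (Suc mm) * 3 + int (qlen * Suc mm) * 3 + 11) + classify_time L mm masks"

definition entry :: "(nat \<Rightarrow> tuple list) \<Rightarrow> nat \<Rightarrow> nat \<Rightarrow> nat \<Rightarrow> nat" where
  "entry L i j c = the ((L i ! j) (sorted_list_of_set (Q ! i) ! c))"

lemma runs_prepare:
  shows "runs prepare (input_state (encode_input Q L)) (prepare_time L) (\<lambda>s.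
    arr s ''in'' = array_of (encode_input Q L) \<and> reg s ''k'' = k \<and> reg s ''l'' = qlen \<and> reg s ''w'' = ow \<and>
    reg s ''kk'' = KK \<and> (\<forall>i<k. arr s ''zw'' i = width i) \<and> pristine s \<and> arr s ''Ain'' = (\<lambda>_. 0) \<and>
    arr s ''out'' = (\<lambda>_. 0) \<and>
    (\<forall>i<k. classified (length (L i)) mm qlen (width i) (entry L i) masks (\<lambda>j. arr s ''cls'' (off L i + j))))"
proof -
  let ?s = "input_state (encode_input Q L)"
  have s: "arr ?s ''in'' = array_of (encode_input Q L)" "\<And>a. a \<noteq> ''in'' \<Longrightarrow> arr ?s a = (\<lambda>_. 0)" "\<And>x. reg ?s x = 0"
    by (simp_all add: input_state_in) (simp_all add: input_state_def)
  show ?thesis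
    unfolding prepare_def
  proof (rule runs_Seq[OF runs_parse_query[OF s(1)]], goal_cases)
    case 1 show ?case using s(2) by simp
  next
    case (2 s1)
    note P1 = 2(1) and f1 = frame_reg[OF 2(2)] frame_arr[OF 2(2)]
    have s1: "arr s1 ''in'' = array_of (encode_input Q L)" "reg s1 ''k'' = k" "reg s1 ''l'' = qlen"
      using f1 s P1 by simp_all
    have zw1: "\<And>i. i < k \<Longrightarrow> arr s1 ''zw'' i = width i" using P1 by blast
    have r1: "reg s1 x = 0" if "x \<notin> wr parse_query" for x using f1(1)[OF that] s by simp
    have a1: "arr s1 a = (\<lambda>_. 0)" if "a \<notin> wa parse_query" "a \<noteq> ''in''" for a using f1(2)[OF that(1)] s(2)[OF that(2)] by simp
    have w1: "reg s1 ''w'' = ow" using P1 by blast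
    show ?case
    proof (rule runs_Seq[OF runs_bound_values[OF s1 zw1]], goal_cases)
      case 1 then show ?case .
    next
      case (2 s2)
      note P2 = 2(1) and f2 = frame_reg[OF 2(2)] frame_arr[OF 2(2)]
      have s2: "reg s2 ''l'' = qlen" "reg s2 ''k'' = k" "reg s2 ''w'' = ow" using f2 s1 w1 by simp_all
      have a2: "arr s2 = arr s1" using f2(2) by (simp add: fun_eq_iff)
      show ?case
      proof (rule runs_Seq[OF runs_set_parameters[OF s2(1)]], goal_cases)
        case (1 s3)
        note P3 = 1(1) and f3 = frame_reg[OF 1(2)] frame_arr[OF 1(2)]
        have a3: "arr s3 = arr s1" using f3(2) a2 by (simp add: fun_eq_iff)
        have s3: "arr s3 ''in'' = array_of (encode_input Q L)" "reg s3 ''k'' = k" "reg s3 ''l'' = qlen" "reg s3 ''m'' = mm"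
          "reg s3 ''m1'' = Suc mm" "reg s3 ''tot'' = masks" "reg s3 ''ba'' = 2" "reg s3 ''bn'' = qlen * Suc mm"
          using f3 s2 P3 a3 s1 by (simp_all add: mm_def masks_def)
        have mx3: "0 < reg s3 ''mx''" "Suc (array_of (encode_input Q L) (Suc (rpos L i) + j * width i + c)) < reg s3 ''mx''"
          if "i < k" "j < length (L i)" "c < width i" for i j c
          using f3 P2 that by simp_all
        have mx0: "0 < reg s3 ''mx''" using f3 P2 by simp
        have r3: "reg s3 ''cnt'' = 0" "reg s3 ''w'' = ow" using f3 f2 r1 s2 by simp_all
        have z3: "arr s3 ''hist'' = (\<lambda>_. 0)" "arr s3 ''cls'' = (\<lambda>_. 0)" "arr s3 ''base'' = (\<lambda>_. 0)" "arr s3 ''tab'' = (\<lambda>_. 0)"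
          using a3 a1 by simp_all
        \<comment> \<open>All tables are zero, which represents the trie that consists of its
          root.\<close>
        have "trie_in s3 (\<lambda>_. [])" using mx0 r3 z3 by (simp add: is_trie_def)
        then have t3: "\<exists>path. trie_in s3 path" by blast
        have zw3: "\<And>i. i < k \<Longrightarrow> arr s3 ''zw'' i = width i" using zw1 a3 by simp
        show ?case
        proof (rule runs_mono[OF runs_classify[where m = mm and tot = masks, OF s3 _ zw3 t3 mx0 z3(1) mx3(2) z3(2)]], goal_cases)
          case (7 s4)
          note P4 = 7(1) and f4 = frame_reg[OF 7(2)] frame_arr[OF 7(2)]
          have "classified (length (L i)) mm qlen (width i) (entry L i) masks (\<lambda>j. arr s4 ''cls'' (off L i + j))" if i: "i < k" for i
          proof (rule classified_key_cong)
            show "classified (length (L i)) mm qlen (width i)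
              (\<lambda>j c. array_of (encode_input Q L) (Suc (rpos L i) + j * width i + c)) masks (\<lambda>j. arr s4 ''cls'' (off L i + j))"
              using P4 i by blast
            fix j c assume "j < length (L i)" "c < width i"
            then show "array_of (encode_input Q L) (Suc (rpos L i) + j * width i + c) = entry L i j c"
              unfolding input_word(3)[where L = L and i = i and j = j and c = c, OF i \<open>j < length (L i)\<close> \<open>c < width i\<close>]
              using finite_atom[OF i] by (simp add: encode_tuple_def entry_def width_def)
          qed
          moreover have "pristine s4"
            unfolding pristine_def using f4 f3(1) f2(1) r1 a3 a1 by simp
          moreover have "arr s4 ''Ain'' = (\<lambda>_. 0)" "arr s4 ''out'' = (\<lambda>_. 0)" using f4 a3 a1 by simp_all
          moreover have "reg s4 ''k'' = k" "reg s4 ''l'' = qlen" "reg s4 ''w'' = ow" "\<forall>i<k. arr s4 ''zw'' i = width i"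
            "arr s4 ''in'' = array_of (encode_input Q L)"
            using f4 s3 r3 zw3 by simp_all
          ultimately show ?case using P4 unfolding KK_def by blast
        qed (simp_all add: prepare_time_def mm_def)
      qed
    qed
  qed
qed

text \<open>The digits of \<open>v\<close> in base \<open>KK\<close> choose one class for each atom.\<close>

definition part_db :: "(nat \<Rightarrow> tuple list) \<Rightarrow> (nat \<Rightarrow> nat \<Rightarrow> nat) \<Rightarrow> nat \<Rightarrow> db" where
  "part_db L C v i = set (part L C (digits KK v) i)"

lemma set_part: "set (part L C d i) = {L i ! j | j. j < length (L i) \<and> C i j = d i}"
  by (auto simp: part_def)

lemma in_part_db: "t \<in> part_db L C v i \<longleftrightarrow> (\<exists>j<length (L i). C i j = digits KK v i \<and> t = L i ! j)"
  unfolding part_db_def set_part by auto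

lemma listed: "lists_db Q L I \<Longrightarrow> i < k \<Longrightarrow> set (L i) = I i \<and> distinct (L i)"
  by (auto simp: lists_db_def lists_relation_def)

lemma part_db_subset:
  assumes "lists_db Q L I" "i < k"
  shows "part_db L C v i \<subseteq> I i"
proof
  fix t assume "t \<in> part_db L C v i"
  then obtain j where "j < length (L i)" "t = L i ! j" unfolding part_db_def set_part by blast
  then show "t \<in> I i" using listed[OF assms] nth_mem by blast
qed

lemma is_db_part_db:
  assumes "is_db Q I" "lists_db Q L I"
  shows "is_db Q (part_db L C v)"
  unfolding is_db_def
proof (intro allI impI)
  fix i assume i: "i < k"
  have "dom t = Q ! i" if "t \<in> I i" for t using assms(1) i that by (simp add: is_db_def)
  then have "\<forall>t\<in>part_db L C v i. dom t = Q ! i" using part_db_subset[OF assms(2) i] by (meson subsetD)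
  moreover have "finite (part_db L C v i)" unfolding part_db_def by (rule finite_set)
  ultimately show "finite (part_db L C v i) \<and> (\<forall>t\<in>part_db L C v i. dom t = Q ! i)" by (rule conjI[rotated])
qed

lemma lists_db_part_db:
  assumes "lists_db Q L I"
  shows "lists_db Q (part L C (digits KK v)) (part_db L C v)"
proof -
  have "distinct (part L C d i)" if "i < k" for d i
    unfolding part_def using listed[OF assms that] by (auto simp: distinct_map intro: inj_on_nth)
  then show ?thesis by (simp add: lists_db_def lists_relation_def part_db_def)
qed

text \<open>Classes partition each relation, so a tuple of the join projects into exactly one class
  for each atom. The joins of the combinations are therefore disjoint and exhaust the join.\<close>

lemma join_parts:
  assumes db: "is_db Q I" and L: "lists_db Q L I"
    and C: "\<And>i j. i < k \<Longrightarrow> j < length (L i) \<Longrightarrow> C i j < KK"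
    and ts: "\<And>v. lists_relation (ts v) (join Q (part_db L C v))"
    and full: "\<And>v. full v \<longleftrightarrow> (\<forall>i<k. part L C (digits KK v) i \<noteq> [])"
  shows "lists_relation (concat (map (\<lambda>v. if full v then ts v else []) [0..<KK ^ k])) (join Q I)"
proof -
  have LI: "set (L i) = I i" "distinct (L i)" if "i < k" for i
    using L that by (auto simp: lists_db_def lists_relation_def)
  let ?ts = "\<lambda>v. if full v then ts v else []"
  have set_ts: "set (?ts v) = join Q (part_db L C v)" for v
  proof (cases "full v")
    case True then show ?thesis using ts by (simp add: lists_relation_def)
  next
    \<comment> \<open>A combination with an empty class has an empty join, so skipping it loses
      nothing.\<close>
    case False
    then obtain i where "i < k" "part_db L C v i = {}" using full by (auto simp: part_db_def)
    then have "join Q (part_db L C v) = {}" unfolding join_def by blast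
    then show ?thesis using False by simp
  qed
  have dist: "distinct (?ts v)" for v using ts by (simp add: lists_relation_def)
  \<comment> \<open>The rows of an atom are distinct, so a tuple fixes its row and with it the
    class.\<close>
  have idx: "digits KK v i = digits KK w i"
    if tv: "t \<in> part_db L C v i" and tw: "t \<in> part_db L C w i" and i: "i < k" for t v w i
  proof -
    obtain j where j: "j < length (L i)" "C i j = digits KK v i" "t = L i ! j"
      using tv unfolding in_part_db by metis
    obtain j' where j': "j' < length (L i)" "C i j' = digits KK w i" "t = L i ! j'"
      using tw unfolding in_part_db by metis
    have "j = j'" using nth_eq_iff_index_eq[OF LI(2)[OF i] j(1) j'(1)] j(3) j'(3) by simp
    then show ?thesis using j(2) j'(2) by simp
  qed
  have disj: "v = w" if "v < KK ^ k" "w < KK ^ k" "t \<in> join Q (part_db L C v)" "t \<in> join Q (part_db L C w)" for v w t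
  proof (rule digits_eq[OF that(1,2)])
    fix i assume i: "i < k"
    then have "t |` (Q ! i) \<in> part_db L C v i" "t |` (Q ! i) \<in> part_db L C w i"
      using that(3,4) by (auto simp: join_def)
    then show "v div KK ^ i mod KK = w div KK ^ i mod KK" using idx i unfolding digits_def by blast
  qed
  have "distinct (concat (map ?ts [0..<n]))" if "n \<le> KK ^ k" for n
    using that
  proof (induction n)
    case (Suc n)
    have "set (concat (map ?ts [0..<n])) \<inter> set (?ts n) = {}"
    proof (rule ccontr)
      assume "set (concat (map ?ts [0..<n])) \<inter> set (?ts n) \<noteq> {}"
      then obtain t v where v: "v < n" "t \<in> set (?ts v)" "t \<in> set (?ts n)" by fastforce
      then show False using disj[of v n t] Suc.prems unfolding set_ts by simp
    qed
    then show ?case using Suc dist[of n] by simp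
  qed simp
  moreover have "set (concat (map ?ts [0..<KK ^ k])) = join Q I"
  proof
    have "join Q (part_db L C v) \<subseteq> join Q I" for v
      using part_db_subset[OF L] unfolding join_def by blast
    then show "set (concat (map ?ts [0..<KK ^ k])) \<subseteq> join Q I" using set_ts by auto
    show "join Q I \<subseteq> set (concat (map ?ts [0..<KK ^ k]))"
    proof
      fix t assume t: "t \<in> join Q I"
      have "\<exists>j<length (L i). t |` (Q ! i) = L i ! j" if "i < k" for i
        using t LI(1)[OF that] that unfolding join_def by (metis (no_types, lifting) in_set_conv_nth mem_Collect_eq)
      then obtain j where j: "\<And>i. i < k \<Longrightarrow> j i < length (L i) \<and> t |` (Q ! i) = L i ! j i" by metis
      obtain v where v: "v < KK ^ k" "\<And>i. i < k \<Longrightarrow> v div KK ^ i mod KK = C i (j i)"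
        using ex_digits[of k "\<lambda>i. C i (j i)" KK] C j by blast
      have "t |` (Q ! i) \<in> part_db L C v i" if "i < k" for i
        using j[OF that] v(2)[OF that] unfolding in_part_db digits_def by (intro exI[of _ "j i"]) simp
      then have "t \<in> join Q (part_db L C v)" using t by (auto simp: join_def)
      then show "t \<in> set (concat (map ?ts [0..<KK ^ k]))" using v(1) set_ts[of v] by auto
    qed
  qed
  ultimately show ?thesis by (simp add: lists_relation_def)
qed

text \<open>The running times \<open>t v\<close> of the subroutine remain parameters: correctness
  needs only that its runs halt, and bounding them takes the constraints, which the program does not
  see.\<close>

lemma exec_partition_join:
  assumes A: "join_algorithm A" and db: "is_db Q I" and L: "lists_db Q L I"
  obtains C t ts u s' where
    "\<And>i. i < k \<Longrightarrow> classified (length (L i)) mm qlen (width i) (entry L i) masks (C i)"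
    "\<And>v. \<exists>s. exec A (input_state (encode_input Q (part L C (digits KK v)))) (t v) s"
    "\<And>v. lists_relation (ts v) (join Q (part_db L C v))"
    "exec (partition_join A) (input_state (encode_input Q L)) u s'"
    "int u \<le> prepare_time L + parts_time A L KK (\<lambda>v. \<forall>i<k. part L C (digits KK v) i \<noteq> []) t (\<lambda>v. length (ts v))"
    "\<exists>ts. lists_relation ts (join Q I) \<and> has_output s' (encode_relation (vars Q) ts)"
proof -
  let ?w = "encode_input Q L"
  obtain u1 s where s: "exec prepare (input_state ?w) u1 s" "int u1 \<le> prepare_time L"
    "arr s ''in'' = array_of ?w" "reg s ''k'' = k" "reg s ''l'' = qlen" "reg s ''w'' = ow"
    "reg s ''kk'' = KK" "\<And>i. i < k \<Longrightarrow> arr s ''zw'' i = width i" "pristine s" "arr s ''Ain'' = (\<lambda>_. 0)"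
    "arr s ''out'' = (\<lambda>_. 0)"
    "\<And>i. i < k \<Longrightarrow> classified (length (L i)) mm qlen (width i) (entry L i) masks (\<lambda>j. arr s ''cls'' (off L i + j))"
    using runs_prepare[of L] unfolding runs_def by blast
  define C where "C = (\<lambda>i j. arr s ''cls'' (off L i + j))"
  define P where "P = (\<lambda>v. part L C (digits KK v))"
  have "\<exists>t sA ts. exec A (input_state (encode_input Q (P v))) t sA \<and>
      lists_relation ts (join Q (part_db L C v)) \<and> has_output sA (encode_relation (vars Q) ts)" for v
    using A Q is_db_part_db[OF db L, of C v] lists_db_part_db[OF L, of C v] unfolding join_algorithm_def P_def by blast
  then obtain t sA ts where e: "\<And>v. exec A (input_state (encode_input Q (P v))) (t v) (sA v)"
      "\<And>v. lists_relation (ts v) (join Q (part_db L C v))" "\<And>v. has_output (sA v) (encode_relation (vars Q) (ts v))"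
    by metis
  define full where "full = (\<lambda>v. \<forall>i<k. P v i \<noteq> [])"
  have K: "KK \<ge> 1" unfolding KK_def by (rule one_le_power) simp
  have Peq: "\<And>v. P v = part L C (digits KK v)" by (simp add: P_def)
  have Ceq: "\<And>i j. i < k \<Longrightarrow> j < length (L i) \<Longrightarrow> arr s ''cls'' (off L i + j) = C i j" by (simp add: C_def)
  have feq: "\<And>v. full v = (\<forall>i<k. P v i \<noteq> [])" by (simp add: full_def)
  obtain u2 s' where u2: "exec (run_parts A) s u2 s'" "int u2 \<le> parts_time A L KK full t (\<lambda>v. length (ts v))"
    "has_output s' (encode_relation (vars Q) (concat (map (\<lambda>v. if full v then ts v else []) [0..<KK ^ k])))"
    using runs_run_parts[OF s(3-7) K s(8) Ceq s(9-11) Peq e(1,3) feq] unfolding runs_def by blast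
  have cl: "\<And>i. i < k \<Longrightarrow> classified (length (L i)) mm qlen (width i) (entry L i) masks (C i)"
    using s(12) by (simp add: C_def)
  have CK: "\<And>i j. i < k \<Longrightarrow> j < length (L i) \<Longrightarrow> C i j < KK" using cl by (simp add: classified_def KK_def)
  have lr: "lists_relation (concat (map (\<lambda>v. if full v then ts v else []) [0..<KK ^ k])) (join Q I)"
    by (rule join_parts[OF db L CK e(2)]) (simp_all add: full_def P_def)
  show ?thesis
  proof (rule that[of C t ts "u1 + u2" s'])
    show "\<exists>s. exec A (input_state (encode_input Q (part L C (digits KK v)))) (t v) s" for v
      using e(1)[of v] unfolding P_def by (rule exI)
    show "exec (partition_join A) (input_state ?w) (u1 + u2) s'"
      unfolding partition_join_def by (rule exec.Seq[OF s(1) u2(1)])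
    show "int (u1 + u2) \<le> prepare_time L +
      parts_time A L KK (\<lambda>v. \<forall>i<k. part L C (digits KK v) i \<noteq> []) t (\<lambda>v. length (ts v))"
      using s(2) u2(2) unfolding full_def P_def by simp
    show "\<exists>ts. lists_relation ts (join Q I) \<and> has_output s' (encode_relation (vars Q) ts)"
      by (rule exI, rule conjI[OF lr u2(3)])
  qed (fact cl e(2))+
qed

end

section \<open>Worst-case optimality\<close>

context query
begin

text \<open>The factor may depend on the query. The closure properties below reduce the check of a
  long time bound to its syntax.\<close>

definition linear_cost :: "((nat \<Rightarrow> tuple list) \<Rightarrow> int) \<Rightarrow> bool" where
  "linear_cost f \<longleftrightarrow> (\<exists>c\<ge>0. \<forall>L. f L \<le> c * (int (\<Sum>i<k. length (L i)) + 1))"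

lemma linear_const: "linear_cost (\<lambda>L. a)"
proof -
  have "a \<le> \<bar>a\<bar> * (int (\<Sum>i<k. length (L i)) + 1)" for L :: "nat \<Rightarrow> tuple list"
  proof -
    have "\<bar>a\<bar> * 1 \<le> \<bar>a\<bar> * (int (\<Sum>i<k. length (L i)) + 1)" by (intro mult_left_mono) (simp_all del: of_nat_sum)
    then show ?thesis by linarith
  qed
  then show ?thesis unfolding linear_cost_def by (intro exI[of _ "\<bar>a\<bar>"]) (simp del: of_nat_sum)
qed

lemma linear_length: "i \<in> {..<k} \<Longrightarrow> linear_cost (\<lambda>L. int (length (L i)))"
proof -
  assume i: "i \<in> {..<k}"
  have "int (length (L i)) \<le> 1 * (int (\<Sum>i<k. length (L i)) + 1)" for L :: "nat \<Rightarrow> tuple list"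
  proof -
    define S where "S = (\<Sum>i<k. length (L i))"
    have "length (L i) \<le> S" unfolding S_def using i by (intro member_le_sum) auto
    then show ?thesis unfolding S_def[symmetric] by simp
  qed
  then show ?thesis unfolding linear_cost_def by (intro exI[of _ 1] conjI allI) simp_all
qed

lemma linear_add:
  assumes "linear_cost f" "linear_cost g"
  shows "linear_cost (\<lambda>L. f L + g L)"
proof -
  obtain c c' where *: "c \<ge> 0" "c' \<ge> 0" "\<And>L. f L \<le> c * (int (\<Sum>i<k. length (L i)) + 1)"
    "\<And>L. g L \<le> c' * (int (\<Sum>i<k. length (L i)) + 1)"
    using assms unfolding linear_cost_def by metis
  show ?thesis unfolding linear_cost_def
  proof (intro exI[of _ "c + c'"] conjI allI)
    fix L show "f L + g L \<le> (c + c') * (int (\<Sum>i<k. length (L i)) + 1)"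
      using add_mono[OF *(3,4)[of L]] by (simp only: distrib_right)
  qed (use * in simp)
qed

lemma linear_mult:
  assumes "linear_cost f" "0 \<le> a"
  shows "linear_cost (\<lambda>L. f L * a)" "linear_cost (\<lambda>L. a * f L)"
proof -
  obtain c where *: "c \<ge> 0" "\<And>L. f L \<le> c * (int (\<Sum>i<k. length (L i)) + 1)"
    using assms unfolding linear_cost_def by metis
  have "f L * a \<le> (a * c) * (int (\<Sum>i<k. length (L i)) + 1)" for L
    using mult_right_mono[OF *(2)[of L] assms(2)] by (simp only: ac_simps)
  then show "linear_cost (\<lambda>L. f L * a)" unfolding linear_cost_def using * assms(2) by (intro exI[of _ "a * c"]) simp
  then show "linear_cost (\<lambda>L. a * f L)" by (simp only: mult.commute)
qed

lemma linear_sum: "finite A \<Longrightarrow> (\<And>x. x \<in> A \<Longrightarrow> linear_cost (f x)) \<Longrightarrow> linear_cost (\<lambda>L. \<Sum>x\<in>A. f x L)"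
proof (induction rule: finite_induct)
  case empty then show ?case using linear_const[of 0] by simp
next
  case (insert x A)
  then have "linear_cost (\<lambda>L. f x L + (\<Sum>x\<in>A. f x L))" by (intro linear_add) simp_all
  then show ?case using insert.hyps by simp
qed

lemma int_input_length: "int (input_length L) = int qlen + (\<Sum>i<k. int (length (L i)) * int (width i) + 1)"
  by (simp add: input_length_def sum.distrib)

text \<open>This covers everything except the runs of the subroutine. The sum over v has
  \<open>KK ^ k\<close> terms, a number fixed by the query.\<close>

lemma linear_overhead:
  "linear_cost (\<lambda>L. prepare_time L + (int k * (int KK * 3 + 6) + 10) + (\<Sum>v<KK ^ k. part_time L v + 3))"
  unfolding prepare_time_def classify_time_def refine_time_def part_time_def build_time_def int_input_length
  by (intro linear_const linear_length linear_add linear_mult linear_sum) simp_all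

end

section \<open>Choices of one X for each partition constraint\<close>

lemma degree_empty: "degree {} X Y = 0"
proof -
  have "degree {} X Y \<le> enat 0" by (simp add: degree_le_iff project_def select_def)
  then show ?thesis by (simp add: zero_enat_def[symmetric])
qed

text \<open>The empty database satisfies all well-formed constraints. Nonnegativity lets one summand
  be bounded by the whole sum and factors be enlarged.\<close>

lemma cardinality_bound_nonneg:
  assumes "cardinality_bound CB" "is_query Q" "admissible_dcs Q D"
  shows "0 \<le> CB Q D"
proof -
  have "is_db Q (\<lambda>_. {})" by (simp add: is_db_def)
  moreover have "\<forall>\<delta>\<in>D. sat_dc (\<lambda>_. {}) \<delta>"
  proof
    fix \<delta> assume "\<delta> \<in> D"
    then have "wf_dc Q \<delta>" using assms(3) by (simp add: admissible_dcs_def)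
    then show "sat_dc (\<lambda>_. {}) \<delta>" by (cases \<delta>) (simp add: degree_empty)
  qed
  ultimately have "real (card (join Q (\<lambda>_. {}))) \<le> CB Q D"
    using assms unfolding cardinality_bound_def by blast
  then show ?thesis using of_nat_0_le_iff order_trans by blast
qed

lemma finite_pc_keys: "is_query Q \<Longrightarrow> wf_pc Q \<pi> \<Longrightarrow> finite (pc_keys \<pi>)"
proof (cases \<pi>)
  case (PC i F Y d)
  assume "is_query Q" "wf_pc Q \<pi>"
  then have "finite (Q ! i)" "F \<subseteq> Pow Y" "Y \<subseteq> Q ! i" using PC by (simp_all add: is_query_def)
  then have "finite F" by (meson finite_Pow_iff finite_subset)
  then show ?thesis using PC by simp
qed

text \<open>A constraint is determined by its relation, F and Y, for which there are finitely many
  possibilities. Sums over infinite sets are 0 by convention, so finiteness gives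
  \<open>extend_bound\<close> its meaning.\<close>

lemma admissible_pcs_finite:
  assumes Q: "is_query Q" and P: "admissible_pcs Q P"
  shows "finite P"
proof -
  let ?key = "\<lambda>\<pi>. case \<pi> of PC i F Y d \<Rightarrow> (i, F, Y)"
  let ?U = "Pow (vars Q)"
  have fin: "finite (vars Q)" using Q by (auto simp: is_query_def vars_def)
  have "?key \<pi> \<in> {..<length Q} \<times> Pow ?U \<times> ?U" if "\<pi> \<in> P" for \<pi>
  proof (cases \<pi>)
    case (PC i F Y d)
    have "wf_pc Q \<pi>" using P that by (simp add: admissible_pcs_def)
    then have w: "i < length Q" "F \<subseteq> Pow Y" "Y \<subseteq> Q ! i" using PC by simp_all
    then have "Y \<subseteq> vars Q" unfolding vars_def using nth_mem by blast
    then show ?thesis using PC w by auto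
  qed
  then have "?key ` P \<subseteq> {..<length Q} \<times> Pow ?U \<times> ?U" by blast
  then have "finite (?key ` P)" using fin by (meson finite_SigmaI finite_Pow_iff finite_lessThan finite_subset)
  moreover have "inj_on ?key P"
  proof (rule inj_onI)
    fix \<pi> \<pi>' assume a: "\<pi> \<in> P" "\<pi>' \<in> P" "?key \<pi> = ?key \<pi>'"
    obtain i F Y d where p: "\<pi> = PC i F Y d" by (cases \<pi>)
    obtain d' where p': "\<pi>' = PC i F Y d'" using a(3) p by (cases \<pi>') simp
    show "\<pi> = \<pi>'" using P a(1,2) unfolding p p' admissible_pcs_def by blast
  qed
  ultimately show ?thesis by (rule finite_imageD)
qed

text \<open>A cardinality constraint has F = {{}}, which leaves only the choice X = {}; so the
  covering of the variables survives every choice.\<close>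

lemma admissible_choice:
  assumes Q: "is_query Q" and P: "admissible_pcs Q P" and \<sigma>: "\<sigma> \<in> Pi\<^sub>E P pc_keys"
  shows "admissible_dcs Q ((\<lambda>\<pi>. dc_of_pc \<pi> (\<sigma> \<pi>)) ` P)"
  unfolding admissible_dcs_def
proof (intro conjI ballI)
  show "finite ((\<lambda>\<pi>. dc_of_pc \<pi> (\<sigma> \<pi>)) ` P)" using admissible_pcs_finite[OF Q P] by simp
next
  fix \<delta> assume "\<delta> \<in> (\<lambda>\<pi>. dc_of_pc \<pi> (\<sigma> \<pi>)) ` P"
  then obtain \<pi> where \<pi>: "\<pi> \<in> P" "\<delta> = dc_of_pc \<pi> (\<sigma> \<pi>)" by blast
  have "wf_pc Q \<pi>" "\<sigma> \<pi> \<in> pc_keys \<pi>" using P \<pi>(1) \<sigma> by (auto simp: admissible_pcs_def)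
  then show "wf_dc Q \<delta>" unfolding \<pi>(2) by (cases \<pi>) auto
next
  fix z assume "z \<in> vars Q"
  then obtain i d where i: "i < length Q" "z \<in> Q ! i" "PC i {{}} (Q ! i) d \<in> P"
    using P unfolding admissible_pcs_def by blast
  have "\<sigma> (PC i {{}} (Q ! i) d) = {}" using PiE_mem[OF \<sigma> i(3)] by simp
  then have "DC i {} (Q ! i) d \<in> (\<lambda>\<pi>. dc_of_pc \<pi> (\<sigma> \<pi>)) ` P"
    using i(3) by (intro image_eqI[OF _ i(3)]) simp
  then show "\<exists>i<length Q. z \<in> Q ! i \<and> (\<exists>d. DC i {} (Q ! i) d \<in> (\<lambda>\<pi>. dc_of_pc \<pi> (\<sigma> \<pi>)) ` P)"
    using i by blast
qed

lemma admissible_scale: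
  assumes D: "admissible_dcs Q D" and \<alpha>: "\<alpha> > 0"
  shows "admissible_dcs Q (scale_dc \<alpha> ` D)"
  unfolding admissible_dcs_def
proof (intro conjI ballI)
  show "finite (scale_dc \<alpha> ` D)" using D by (simp add: admissible_dcs_def)
next
  fix \<delta> assume "\<delta> \<in> scale_dc \<alpha> ` D"
  then obtain \<delta>' where \<delta>': "\<delta>' \<in> D" "\<delta> = scale_dc \<alpha> \<delta>'" by blast
  then have "wf_dc Q \<delta>'" using D by (simp add: admissible_dcs_def)
  then show "wf_dc Q \<delta>" unfolding \<delta>'(2) using \<alpha> by (cases \<delta>') simp
next
  fix z assume "z \<in> vars Q"
  then obtain i d where i: "i < length Q" "z \<in> Q ! i" "DC i {} (Q ! i) d \<in> D"
    using D unfolding admissible_dcs_def by blast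
  have "DC i {} (Q ! i) (\<alpha> * d) \<in> scale_dc \<alpha> ` D" by (intro image_eqI[OF _ i(3)]) simp
  then show "\<exists>i<length Q. z \<in> Q ! i \<and> (\<exists>d. DC i {} (Q ! i) d \<in> scale_dc \<alpha> ` D)"
    using i by blast
qed

text \<open>No summand is negative, so each is at most the sum.\<close>

lemma extend_bound_ge:
  assumes CB: "cardinality_bound CB" and Q: "is_query Q" and P: "admissible_pcs Q P"
  shows "\<sigma> \<in> Pi\<^sub>E P pc_keys \<Longrightarrow> CB Q ((\<lambda>\<pi>. dc_of_pc \<pi> (\<sigma> \<pi>)) ` P) \<le> extend_bound CB Q P"
    and "0 \<le> extend_bound CB Q P"
proof -
  have pos: "0 \<le> CB Q ((\<lambda>\<pi>. dc_of_pc \<pi> (\<sigma> \<pi>)) ` P)" if "\<sigma> \<in> Pi\<^sub>E P pc_keys" for \<sigma>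
    using cardinality_bound_nonneg[OF CB Q admissible_choice[OF Q P that]] .
  have "finite (Pi\<^sub>E P pc_keys)"
    using admissible_pcs_finite[OF Q P] finite_pc_keys[OF Q] P
    by (intro finite_PiE) (auto simp: admissible_pcs_def)
  then show "\<sigma> \<in> Pi\<^sub>E P pc_keys \<Longrightarrow> CB Q ((\<lambda>\<pi>. dc_of_pc \<pi> (\<sigma> \<pi>)) ` P) \<le> extend_bound CB Q P"
    unfolding extend_bound_def using pos by (intro member_le_sum) auto
  show "0 \<le> extend_bound CB Q P" unfolding extend_bound_def using pos by (intro sum_nonneg)
qed

context query
begin

text \<open>The bound of the constraint is real, but the partition degree is a natural number p that
  it dominates. To p the lemma \<open>class_degree_le\<close> applies, and its factor
  \<open>2 * mm\<close> becomes the scaling.\<close>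

lemma ex_part_constraint:
  assumes db: "is_db Q I" and L: "lists_db Q L I" and sat: "sat_pc I \<pi>" and wf: "wf_pc Q \<pi>"
    and cl: "\<And>i. i < k \<Longrightarrow> classified (length (L i)) mm qlen (width i) (entry L i) masks (C i)"
    and full: "\<And>i. i < k \<Longrightarrow> part L C (digits KK v) i \<noteq> []"
  shows "\<exists>X\<in>pc_keys \<pi>. sat_dc (part_db L C v) (scale_dc (real (2 * mm)) (dc_of_pc \<pi> X))"
proof (cases \<pi>)
  case (PC i F Y d)
  have i: "i < k" and F: "F \<subseteq> Pow Y" and Y: "Y \<subseteq> Q ! i" using wf PC by simp_all
  have LI: "set (L i) = I i" using listed[OF L i] by blast
  have zs: "set (sorted_list_of_set (Q ! i)) = Q ! i" "length (sorted_list_of_set (Q ! i)) = width i"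
    using finite_atom[OF i] by (simp_all add: width_def)
  have le: "ereal_of_enat (partition_degree (I i) F Y) \<le> ereal d" using sat PC by simp
  then obtain p where p: "partition_degree (I i) F Y = enat p" "real p \<le> d"
    by (cases "partition_degree (I i) F Y") simp_all
  \<comment> \<open>With F empty the constraint forces an empty relation, which has no nonempty
    class.\<close>
  have "F \<noteq> {}"
  proof
    assume "F = {}"
    moreover have "I i \<noteq> {}" using full[OF i] LI by (auto simp: part_def)
    ultimately have "partitions (I i) F = {}" by (auto simp: partitions_def)
    then have "partition_degree (I i) F Y = \<infinity>" by (simp add: partition_degree_def top_enat_def)
    then show False using p(1) by simp
  qed
  have cli: "classified (length (L i)) (2 ^ qlen) qlen (length (sorted_list_of_set (Q ! i)))
      (\<lambda>j c. the ((L i ! j) (sorted_list_of_set (Q ! i) ! c))) (2 ^ (qlen * Suc (2 ^ qlen))) (C i)"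
    using cl[OF i] unfolding zs(2) mm_def masks_def entry_def by (simp add: fun_eq_iff)
  have zl: "length (sorted_list_of_set (Q ! i)) \<le> qlen" using width_le_qlen[OF i] zs by simp
  have dom: "dom t = set (sorted_list_of_set (Q ! i))" if "t \<in> set (L i)" for t
    using that db i LI zs by (simp add: is_db_def)
  have Y': "Y \<subseteq> set (sorted_list_of_set (Q ! i))" using Y zs by simp
  have pd: "partition_degree (set (L i)) F Y = enat p" using p LI by simp
  obtain X where X: "X \<in> F"
    "degree {L i ! j | j. j < length (L i) \<and> C i j = digits KK v i} X Y \<le> enat (2 * 2 ^ qlen * p)"
    using class_degree_le[OF cli zl dom Y' F \<open>F \<noteq> {}\<close> pd] by blast
  have "ereal_of_enat (degree (part_db L C v i) X Y) \<le> ereal_of_enat (enat (2 * mm * p))"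
    using X(2) unfolding part_db_def set_part mm_def ereal_of_enat_le_iff .
  also have "\<dots> \<le> ereal (real (2 * mm) * d)"
    using p(2) mult_left_mono[of "real p" d "real (2 * mm)"] by simp
  finally show ?thesis using X(1) PC by auto
qed

end

lemma partition_join_optimal:
  fixes CB :: dc_bound
  assumes CB: "cardinality_bound CB" and sc: "scalable CB" and A: "worst_case_optimal_dc A CB"
  shows "worst_case_optimal_pc (partition_join A) (extend_bound CB)"
  unfolding worst_case_optimal_pc_def
proof (intro conjI allI impI)
  have alg: "join_algorithm A" using A by (simp add: worst_case_optimal_dc_def)
  show "join_algorithm (partition_join A)"
    unfolding join_algorithm_def
  proof (intro allI impI)
    fix Q I L assume a: "is_query Q" "is_db Q I" "lists_db Q L I"
    interpret query Q by unfold_locales (rule a(1))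
    from exec_partition_join[OF alg a(2,3)] show "\<exists>t s ts. exec (partition_join A) (input_state (encode_input Q L)) t s \<and>
           lists_relation ts (join Q I) \<and> has_output s (encode_relation (vars Q) ts)" by metis
  qed
  fix Q :: query assume Q: "is_query Q"
  interpret query Q by unfold_locales (rule Q)
  obtain a where a: "\<And>D I. admissible_dcs Q D \<Longrightarrow> is_db Q I \<Longrightarrow> (\<forall>\<delta>\<in>D. sat_dc I \<delta>) \<Longrightarrow>
      runs_within A Q I (a * (real (db_size Q I) + CB Q D + 1))"
    using A Q unfolding worst_case_optimal_dc_def by metis
  obtain f :: "real \<Rightarrow> real" where f: "\<And>\<alpha> D. \<alpha> > 0 \<Longrightarrow> admissible_dcs Q D \<Longrightarrow> CB Q (scale_dc \<alpha> ` D) \<le> f \<alpha> * CB Q D"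
    using sc Q unfolding scalable_def by metis
  obtain c0 where c0: "c0 \<ge> 0" "\<And>L. prepare_time L + (int k * (int KK * 3 + 6) + 10) + (\<Sum>v<KK ^ k. part_time L v + 3)
      \<le> c0 * (int (\<Sum>i<k. length (L i)) + 1)"
    using linear_overhead unfolding linear_cost_def by blast
  define \<alpha> where "\<alpha> = real (2 * mm)"
  \<comment> \<open>The constants \<open>a\<close> and \<open>f \<alpha>\<close> may be negative;
    cutting off at 0 makes the estimates monotone.\<close>
  define a' where "a' = max a 0"
  define f' where "f' = max (f \<alpha>) 0"
  \<comment> \<open>In \<open>sub_time\<close>, \<open>c1\<close> is the coefficient of the running
    time, \<open>c2\<close> that of the output size, and \<open>c3\<close> the constant
    term.\<close>
  define c1 where "c1 = 3 + 3 * real (length (arrays A))"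
  define c2 where "c2 = real (ow * 5 + 4)"
  define c3 where "c3 = 7 + real (length (arrays A)) + real (length (regs A))"
  define c4 where "c4 = c1 * (a' * (1 + f')) + c2 * f' + c3"
  have nn: "0 \<le> a'" "0 \<le> f'" "0 \<le> c1" "0 \<le> c2" "0 \<le> c3" "0 \<le> c4" "\<alpha> > 0"
    by (simp_all add: a'_def f'_def c1_def c2_def c3_def c4_def \<alpha>_def mm_def)
  show "\<exists>c. \<forall>P I. admissible_pcs Q P \<longrightarrow> is_db Q I \<longrightarrow> (\<forall>\<pi>\<in>P. sat_pc I \<pi>) \<longrightarrow>
      runs_within (partition_join A) Q I (c * (real (db_size Q I) + extend_bound CB Q P + 1))"
  \<comment> \<open>Each of the \<open>KK ^ k\<close> combinations is charged the whole extended
    bound, even if several of them fall under the same choice.\<close>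
  proof (intro exI[of _ "real_of_int c0 + real (KK ^ k) * c4"] allI impI)
    fix P I assume P: "admissible_pcs Q P" and db: "is_db Q I" and sat: "\<forall>\<pi>\<in>P. sat_pc I \<pi>"
    define N where "N = real (db_size Q I)"
    define B where "B = extend_bound CB Q P"
    have B0: "0 \<le> B" unfolding B_def by (rule extend_bound_ge(2)[OF CB Q P])
    have N0: "0 \<le> N" by (simp add: N_def)
    show "runs_within (partition_join A) Q I ((real_of_int c0 + real (KK ^ k) * c4) * (real (db_size Q I) + extend_bound CB Q P + 1))"
      unfolding runs_within_def N_def[symmetric] B_def[symmetric]
    proof (intro allI impI)
      fix L t0 s0 assume L: "lists_db Q L I" and run: "exec (partition_join A) (input_state (encode_input Q L)) t0 s0"
      show "real t0 \<le> (real_of_int c0 + real (KK ^ k) * c4) * (N + B + 1)"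
      proof (rule exec_partition_join[OF alg db L], goal_cases)
        case (1 C t ts u s')
        note cl = 1(1) and e = 1(2) and ts = 1(3) and u = 1(4,5)
        define full where "full = (\<lambda>v. \<forall>i<k. part L C (digits KK v) i \<noteq> [])"
        have N: "N = real (\<Sum>i<k. length (L i))"
        proof -
          have "card (I i) = length (L i)" if "i < k" for i
            using listed[OF L that] distinct_card by metis
          then show ?thesis by (simp add: N_def db_size_def)
        qed
        have sub: "real_of_int (sub_time A (t v) (length (ts v))) \<le> c4 * (N + B + 1)" if v: "full v" for v
        proof -
          have "\<exists>X\<in>pc_keys \<pi>. sat_dc (part_db L C v) (scale_dc \<alpha> (dc_of_pc \<pi> X))" if "\<pi> \<in> P" for \<pi>
            unfolding \<alpha>_def
          proof (rule ex_part_constraint[OF db L _ _ cl])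
            show "sat_pc I \<pi>" "wf_pc Q \<pi>" using sat P that by (simp_all add: admissible_pcs_def)
          qed (use v in \<open>simp_all add: full_def\<close>)
          then obtain \<sigma>0 where \<sigma>0: "\<And>\<pi>. \<pi> \<in> P \<Longrightarrow> \<sigma>0 \<pi> \<in> pc_keys \<pi>"
            "\<And>\<pi>. \<pi> \<in> P \<Longrightarrow> sat_dc (part_db L C v) (scale_dc \<alpha> (dc_of_pc \<pi> (\<sigma>0 \<pi>)))" by metis
          \<comment> \<open>The summands are indexed by extensional functions, hence the restriction
            to \<open>P\<close>.\<close>
          define \<sigma> where "\<sigma> = restrict \<sigma>0 P"
          have \<sigma>: "\<sigma> \<in> Pi\<^sub>E P pc_keys" using \<sigma>0(1) by (auto simp: \<sigma>_def)
          define D where "D = (\<lambda>\<pi>. dc_of_pc \<pi> (\<sigma> \<pi>)) ` P"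
          have D: "admissible_dcs Q D" unfolding D_def by (rule admissible_choice[OF Q P \<sigma>])
          have D': "admissible_dcs Q (scale_dc \<alpha> ` D)" by (rule admissible_scale[OF D nn(7)])
          have satD: "\<forall>\<delta>\<in>scale_dc \<alpha> ` D. sat_dc (part_db L C v) \<delta>"
            using \<sigma>0(2) by (auto simp: D_def \<sigma>_def)
          have dbv: "is_db Q (part_db L C v)" by (rule is_db_part_db[OF db L])
          \<comment> \<open>Scaling by \<open>\<alpha>\<close> costs a factor that depends on the
            query only, and the unscaled constraints form one summand of the extended bound.\<close>
          have B1: "CB Q (scale_dc \<alpha> ` D) \<le> f' * B"
          proof -
            have "CB Q (scale_dc \<alpha> ` D) \<le> f \<alpha> * CB Q D" by (rule f[OF nn(7) D])
            also have "\<dots> \<le> f' * CB Q D"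
              using cardinality_bound_nonneg[OF CB Q D] by (intro mult_right_mono) (simp_all add: f'_def)
            also have "\<dots> \<le> f' * B"
              using extend_bound_ge(1)[OF CB Q P \<sigma>] nn by (intro mult_left_mono) (simp_all add: D_def B_def)
            finally show ?thesis .
          qed
          have Nv: "real (db_size Q (part_db L C v)) \<le> N"
          proof -
            have "card (part_db L C v i) \<le> card (I i)" if "i < k" for i
              using part_db_subset[OF L that] db that by (intro card_mono) (simp_all add: is_db_def)
            then have "db_size Q (part_db L C v) \<le> db_size Q I" unfolding db_size_def by (intro sum_mono) simp
            then show ?thesis by (simp add: N_def)
          qed
          have pos: "0 \<le> CB Q (scale_dc \<alpha> ` D)" by (rule cardinality_bound_nonneg[OF CB Q D'])
          have tv: "real (t v) \<le> a' * (N + f' * B + 1)"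
          proof -
            obtain sv where "exec A (input_state (encode_input Q (part L C (digits KK v)))) (t v) sv" using e by blast
            then have "real (t v) \<le> a * (real (db_size Q (part_db L C v)) + CB Q (scale_dc \<alpha> ` D) + 1)"
              using a[OF D' dbv satD] lists_db_part_db[OF L] unfolding runs_within_def by blast
            also have "\<dots> \<le> a' * (real (db_size Q (part_db L C v)) + CB Q (scale_dc \<alpha> ` D) + 1)"
              using pos by (intro mult_right_mono) (simp_all add: a'_def)
            also have "\<dots> \<le> a' * (N + f' * B + 1)"
              using Nv B1 nn by (intro mult_left_mono) simp_all
            finally show ?thesis .
          qed
          \<comment> \<open>The output of a run obeys the same cardinality bound, which pays for
            copying it.\<close>
          have nv: "real (length (ts v)) \<le> f' * B"
          proof -
            have "length (ts v) = card (join Q (part_db L C v))"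
              using ts[of v] distinct_card unfolding lists_relation_def by metis
            moreover have "real (card (join Q (part_db L C v))) \<le> CB Q (scale_dc \<alpha> ` D)"
              using CB Q D' dbv satD unfolding cardinality_bound_def by blast
            ultimately show ?thesis using B1 by simp
          qed
          have "real_of_int (sub_time A (t v) (length (ts v))) = c1 * real (t v) + c2 * real (length (ts v)) + c3"
            by (simp add: sub_time_def c1_def c2_def c3_def algebra_simps)
          also have "\<dots> \<le> c1 * (a' * (N + f' * B + 1)) + c2 * (f' * B) + c3"
            using tv nv nn by (intro add_mono mult_left_mono) simp_all
          also have "\<dots> \<le> c1 * (a' * ((1 + f') * (N + B + 1))) + c2 * (f' * (N + B + 1)) + c3 * (N + B + 1)"
          proof (intro add_mono mult_left_mono)
            have "0 \<le> f' * N" "0 \<le> f'" using nn N0 by simp_all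
            then show "N + f' * B + 1 \<le> (1 + f') * (N + B + 1)" using B0 by (simp add: algebra_simps)
            show "c3 \<le> c3 * (N + B + 1)" using mult_left_mono[of 1 "N + B + 1" c3] nn N0 B0 by simp
          qed (use nn N0 B0 in simp_all)
          also have "\<dots> = c4 * (N + B + 1)" by (simp add: c4_def algebra_simps)
          finally show ?thesis .
        qed
        \<comment> \<open>The single step of a skipped combination moves to the overhead, which
          explains \<open>part_time L v + 3\<close>.\<close>
        define sub where "sub = (\<lambda>v. if full v then sub_time A (t v) (length (ts v)) else 0)"
        have "t0 = u" using exec_deterministic[OF run u(1)] by blast
        have le1: "(\<Sum>v<KK ^ k. part_time L v + (if full v then sub_time A (t v) (length (ts v)) else 1) + 2)
            \<le> (\<Sum>v<KK ^ k. part_time L v + 3 + sub v)"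
          by (intro sum_mono) (simp add: sub_def)
        have "int u \<le> prepare_time L + (int k * (int KK * 3 + 6) + 10) + (\<Sum>v<KK ^ k. part_time L v + 3) + (\<Sum>v<KK ^ k. sub v)"
          using u(2) le1 unfolding parts_time_def full_def[symmetric] sum.distrib[of "\<lambda>v. part_time L v + 3"] by linarith
        also have "\<dots> \<le> c0 * (int (\<Sum>i<k. length (L i)) + 1) + (\<Sum>v<KK ^ k. sub v)"
          using c0(2)[of L] by (rule add_right_mono)
        finally have "real u \<le> real_of_int (c0 * (int (\<Sum>i<k. length (L i)) + 1) + (\<Sum>v<KK ^ k. sub v))"
          by linarith
        also have "\<dots> = real_of_int c0 * (N + 1) + (\<Sum>v<KK ^ k. real_of_int (sub v))" by (simp add: N)
        also have "\<dots> \<le> real_of_int c0 * (N + B + 1) + (\<Sum>v<KK ^ k. c4 * (N + B + 1))"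
        proof (intro add_mono sum_mono mult_left_mono)
          fix v show "real_of_int (sub v) \<le> c4 * (N + B + 1)"
            using sub[of v] nn N0 B0 by (simp add: sub_def)
        qed (use B0 c0 in simp_all)
        also have "\<dots> = (real_of_int c0 + real (KK ^ k) * c4) * (N + B + 1)" by (simp add: distrib_right)
        finally show ?case unfolding \<open>t0 = u\<close> .
      qed
    qed
  qed
qed

theorem theorem20:
  fixes CB :: dc_bound
  assumes "cardinality_bound CB"
    and "scalable CB"
    and "\<exists>A. worst_case_optimal_dc A CB"
  shows "\<exists>A'. worst_case_optimal_pc A' (extend_bound CB)"
  using assms partition_join_optimal by blast

end
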